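(* Let $R$ be a commutative Noetherian ring, $\mathfrak{a}$ an ideal of $R$, and $\mathcal{S}$ a Serre class of $R$-modules. Let $s \in \mathbb{N}_0$ and let $M$ be an $R$-module such that $\operatorname{Ext}^{s}_{R}(R/\mathfrak{a},M)\in \mathcal{S}$. If $\operatorname{Ext}^{j}_{R}(R/\mathfrak{a},H^{i}_{\mathfrak{a}}(M))\in \mathcal{S}$ for all $i<s$ and all $j\geq 0$, then $\operatorname{Hom}_{R}(R/\mathfrak{a},H^{s}_{\mathfrak{a}}(M))\in \mathcal{S}$.
   Context: $H^i_{\mathfrak{a}}(-)$ denotes the $i$-th local cohomology functor with respect to $\mathfrak{a}$, i.e. the $i$-th right derived functor of the $\mathfrak{a}$-torsion functor $\Gamma_{\mathfrak{a}}$. A Serre class of $R$-modules is a nonempty class of $R$-modules closed under taking submodules, quotients and extensions (hence it contains the zero module). $\mathbb{N}_0$ is the set of non-negative integers. No finiteness assumption is made on $M$. *)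

theory Defs
  imports "HOL-Algebra.Module" "HOL-Algebra.Ideal_Product" "HOL-Algebra.Ring_Divisibility" "HOL-Library.Infinite_Typeclass"
begin

section \<open>Modules and their homomorphisms\<close>

text \<open>
  The fields \<open>mult\<close> and \<open>one\<close> that module records inherit from rings carry no information and
  are filled with \<open>undefined\<close>. Homomorphisms are extensional, so that distinct elements of a
  Hom module differ on the carrier.
\<close>

definition module_hom ::
    "('r, 'k) ring_scheme \<Rightarrow> ('r, 'm) module \<Rightarrow> ('r, 'n) module \<Rightarrow> ('m \<Rightarrow> 'n) set" where
  "module_hom R M N =
    {f \<in> carrier M \<rightarrow>\<^sub>E carrier N.
       (\<forall>x\<in>carrier M. \<forall>y\<in>carrier M. f (x \<oplus>\<^bsub>M\<^esub> y) = f x \<oplus>\<^bsub>N\<^esub> f y) \<and>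
       (\<forall>r\<in>carrier R. \<forall>x\<in>carrier M. f (r \<odot>\<^bsub>M\<^esub> x) = r \<odot>\<^bsub>N\<^esub> f x)}"

definition module_isomorphic ::
    "('r, 'k) ring_scheme \<Rightarrow> ('r, 'm) module \<Rightarrow> ('r, 'n) module \<Rightarrow> bool" where
  "module_isomorphic R M N \<longleftrightarrow> (\<exists>f\<in>module_hom R M N. bij_betw f (carrier M) (carrier N))"

definition Hom ::
    "('r, 'k) ring_scheme \<Rightarrow> ('r, 'm) module \<Rightarrow> ('r, 'n) module \<Rightarrow> ('r, 'm \<Rightarrow> 'n) module" where
  "Hom R M N =
    \<lparr>carrier = module_hom R M N, monoid.mult = undefined, one = undefined,
     zero = (\<lambda>x\<in>carrier M. \<zero>\<^bsub>N\<^esub>),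
     add = (\<lambda>f g. \<lambda>x\<in>carrier M. f x \<oplus>\<^bsub>N\<^esub> g x),
     smult = (\<lambda>r f. \<lambda>x\<in>carrier M. r \<odot>\<^bsub>N\<^esub> f x)\<rparr>"

definition quotient_module :: "('r, 'm) module \<Rightarrow> 'm set \<Rightarrow> ('r, 'm set) module" where
  "quotient_module M N =
    \<lparr>carrier = a_rcosets\<^bsub>M\<^esub> N, monoid.mult = undefined, one = undefined,
     zero = N, add = set_add M,
     smult = (\<lambda>r C. \<Union>x\<in>C. N +>\<^bsub>M\<^esub> (r \<odot>\<^bsub>M\<^esub> x))\<rparr>"

definition regular_module :: "('r, 'k) ring_scheme \<Rightarrow> ('r, 'r) module" where
  "regular_module R =
    \<lparr>carrier = carrier R, monoid.mult = undefined, one = undefined,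
     zero = \<zero>\<^bsub>R\<^esub>, add = add R, smult = monoid.mult R\<rparr>"

definition cyclic_module :: "('r, 'k) ring_scheme \<Rightarrow> 'r set \<Rightarrow> ('r, 'r set) module" where
  "cyclic_module R I = quotient_module (regular_module R) I"


section \<open>Right derived functors\<close>

definition cohomology ::
    "(nat \<Rightarrow> ('r, 'm) module) \<Rightarrow> (nat \<Rightarrow> 'm \<Rightarrow> 'm) \<Rightarrow> nat \<Rightarrow> ('r, 'm set) module" where
  "cohomology X d i =
    quotient_module
      ((X i)\<lparr>carrier := a_kernel (X i) (X (Suc i)) (d i)\<rparr>)
      (case i of 0 \<Rightarrow> {\<zero>\<^bsub>X 0\<^esub>} | Suc k \<Rightarrow> d k ` carrier (X k))"

text \<open>
  A formula cannot quantify over types, so the test modules \<open>A\<close>, \<open>B\<close> in the extension property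
  have carriers in the type of the ring elements. Nothing is lost: the inclusions of ideals in
  the ring are among these test maps, and by Baer's criterion extension along them yields
  extension along monomorphisms of modules over arbitrary carrier types.
\<close>

definition injective_module :: "('r, 'k) ring_scheme \<Rightarrow> ('r, 'm) module \<Rightarrow> bool" where
  "injective_module R E \<longleftrightarrow> module R E \<and>
    (\<forall>(A :: ('r, 'r) module) (B :: ('r, 'r) module). \<forall>f\<in>module_hom R A B. \<forall>g\<in>module_hom R A E.
       module R A \<and> module R B \<and> inj_on f (carrier A) \<longrightarrow>
       (\<exists>h\<in>module_hom R B E. \<forall>x\<in>carrier A. h (f x) = g x))"

definition injective_resolution ::
    "('r, 'k) ring_scheme \<Rightarrow> ('r, 'm) module \<Rightarrow> (nat \<Rightarrow> ('r, 'e) module) \<times> (nat \<Rightarrow> 'e \<Rightarrow> 'e) \<Rightarrow> bool"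
  where
  "injective_resolution R M = (\<lambda>(E, d).
    (\<forall>n. injective_module R (E n)) \<and>
    (\<forall>n. d n \<in> module_hom R (E n) (E (Suc n))) \<and>
    (\<exists>\<epsilon>\<in>module_hom R M (E 0).
       inj_on \<epsilon> (carrier M) \<and> \<epsilon> ` carrier M = a_kernel (E 0) (E 1) (d 0)) \<and>
    (\<forall>n. d n ` carrier (E n) = a_kernel (E (Suc n)) (E (Suc (Suc n))) (d (Suc n))))"

text \<open>
  Derived functors are computed from a chosen injective resolution, whose terms have carriers
  in the type \<open>'r list \<Rightarrow> 'm + nat\<close>. This type \<open>W\<close> always accommodates an injective resolution:
  \<open>W\<close> is infinite, \<open>'m\<close> embeds in it, and functions \<open>'r \<Rightarrow> W\<close> embed in \<open>W\<close> because pairs in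
  \<open>'r \<times> 'r list\<close> embed in \<open>'r list\<close>. A module \<open>N\<close> with carrier in \<open>W\<close> is additively a quotient
  of a free abelian group on its elements, hence a subgroup of a quotient \<open>D\<close> of a rational
  vector space with basis \<open>N\<close>; \<open>D\<close> is divisible and no larger than \<open>W\<close>. So \<open>N\<close> embeds in
  the injective module of additive maps from the ring to \<open>D\<close>, which fits in \<open>W\<close> again, as does
  the cokernel.
\<close>

definition chosen_resolution ::
    "('r, 'k) ring_scheme \<Rightarrow> ('r, 'm) module \<Rightarrow>
     (nat \<Rightarrow> ('r, 'r list \<Rightarrow> 'm + nat) module) \<times>
     (nat \<Rightarrow> ('r list \<Rightarrow> 'm + nat) \<Rightarrow> ('r list \<Rightarrow> 'm + nat))" where
  "chosen_resolution R M = (SOME X. injective_resolution R M X)"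

text \<open>
  A functor is given by its action \<open>T\<close> on objects and its action \<open>T'\<close> on morphisms, the latter
  depending on the domain of the morphism.
\<close>

definition right_derived ::
    "('r, 'k) ring_scheme \<Rightarrow>
     (('r, 'r list \<Rightarrow> 'm + nat) module \<Rightarrow> ('r, 'x) module) \<Rightarrow>
     (('r, 'r list \<Rightarrow> 'm + nat) module \<Rightarrow>
       (('r list \<Rightarrow> 'm + nat) \<Rightarrow> ('r list \<Rightarrow> 'm + nat)) \<Rightarrow> 'x \<Rightarrow> 'x) \<Rightarrow>
     nat \<Rightarrow> ('r, 'm) module \<Rightarrow> ('r, 'x set) module" where
  "right_derived R T T' i M =
    (let (E, d) = chosen_resolution R M
     in cohomology (\<lambda>n. T (E n)) (\<lambda>n. T' (E n) (d n)) i)"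

definition Ext ::
    "('r, 'k) ring_scheme \<Rightarrow> nat \<Rightarrow> ('r, 'l) module \<Rightarrow> ('r, 'm) module \<Rightarrow>
     ('r, ('l \<Rightarrow> 'r list \<Rightarrow> 'm + nat) set) module" where
  "Ext R j L M =
    right_derived R (Hom R L) (\<lambda>X \<phi>. \<lambda>f\<in>module_hom R L X. compose (carrier L) \<phi> f) j M"

definition torsion :: "('r, 'k) ring_scheme \<Rightarrow> 'r set \<Rightarrow> ('r, 'm) module \<Rightarrow> ('r, 'm) module" where
  "torsion R I M =
    M\<lparr>carrier := {x \<in> carrier M. \<exists>n::nat. \<forall>r \<in> I [^]\<^bsub>ideals_set R\<^esub> n. r \<odot>\<^bsub>M\<^esub> x = \<zero>\<^bsub>M\<^esub>}\<rparr>"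

definition local_cohomology ::
    "('r, 'k) ring_scheme \<Rightarrow> 'r set \<Rightarrow> nat \<Rightarrow> ('r, 'm) module \<Rightarrow>
     ('r, ('r list \<Rightarrow> 'm + nat) set) module" where
  "local_cohomology R I i M =
    right_derived R (torsion R I) (\<lambda>X \<phi>. restrict \<phi> (carrier (torsion R I X))) i M"


section \<open>Serre classes\<close>

text \<open>
  A Serre class is given by its members with carrier in a type \<open>'u\<close>; a module over any other
  type belongs to the class if it is isomorphic to one of these (\<open>belongs_to\<close> below). Closure
  under monomorphisms into and epimorphisms from members comprises closure under isomorphism.
  The type \<open>'u\<close> is infinite so that an extension of two modules with carriers in \<open>'u\<close>, being
  in bijection with their product, again fits in \<open>'u\<close>. Hence the modules belonging to the
  class form a Serre class among all modules, and for \<open>'u\<close> large enough any Serre class is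
  captured on any given set of modules.
\<close>

definition serre_class :: "('r, 'k) ring_scheme \<Rightarrow> ('r, 'u::infinite) module set \<Rightarrow> bool" where
  "serre_class R S \<longleftrightarrow>
    S \<noteq> {} \<and> (\<forall>N\<in>S. module R N) \<and>
    (\<forall>N\<in>S. \<forall>A. \<forall>f\<in>module_hom R A N.
       module R A \<and> inj_on f (carrier A) \<longrightarrow> A \<in> S) \<and>
    (\<forall>N\<in>S. \<forall>C. \<forall>f\<in>module_hom R N C.
       module R C \<and> f ` carrier N = carrier C \<longrightarrow> C \<in> S) \<and>
    (\<forall>A\<in>S. \<forall>C\<in>S. \<forall>B. \<forall>f\<in>module_hom R A B. \<forall>g\<in>module_hom R B C.
       module R B \<and> inj_on f (carrier A) \<and> f ` carrier A = a_kernel B C g \<and>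
       g ` carrier B = carrier C \<longrightarrow> B \<in> S)"

definition belongs_to ::
    "('r, 'k) ring_scheme \<Rightarrow> ('r, 'm) module \<Rightarrow> ('r, 'u) module set \<Rightarrow> bool" where
  "belongs_to R M S \<longleftrightarrow> (\<exists>N\<in>S. module_isomorphic R M N)"

end

theory Submission
  imports Defs "HOL-Algebra.Free_Abelian_Groups"
begin

text \<open>
  Let \<open>X = R / \<aa>\<close> and let \<open>J\<close> be the torsion part of an injective resolution of \<open>M\<close>, with cocycles
  \<open>Z\<close>, coboundaries \<open>B\<close> and cohomology \<open>H\<close>. By an Artin--Rees argument the modules \<open>J\<^sup>i\<close> are
  again injective, so that \<open>0 \<rightarrow> Z\<^sup>i \<rightarrow> J\<^sup>i \<rightarrow> B\<^sup>i\<^sup>+\<^sup>1 \<rightarrow> 0\<close> shifts dimensions: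
  \<open>Ext\<^sup>j(X, B\<^sup>i\<^sup>+\<^sup>1)\<close> is isomorphic to \<open>Ext\<^sup>j\<^sup>+\<^sup>1(X, Z\<^sup>i)\<close> for positive \<open>j\<close>. Together with the exact
  sequence of \<open>0 \<rightarrow> B\<^sup>i \<rightarrow> Z\<^sup>i \<rightarrow> H\<^sup>i \<rightarrow> 0\<close> this gives by induction that \<open>Ext\<^sup>j(X, B\<^sup>i)\<close> belongs to
  the Serre class for all positive \<open>j\<close> and all \<open>i \<le> s\<close>. Finally \<open>Hom(X, H\<^sup>s)\<close> is an extension of a
  submodule of \<open>Ext\<^sup>1(X, B\<^sup>s)\<close> by the image of \<open>Hom(X, Z\<^sup>s)\<close>, which is a quotient of \<open>Ext\<^sup>s(X, M)\<close>
  because the coboundaries of \<open>Hom(X, J)\<close> take values in \<open>B\<^sup>s\<close>.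

  For the exact sequences, \<open>Ext\<close> is computed from a resolution of \<open>X\<close> by finitely generated free
  modules, that is, from matrices over \<open>R\<close>, and compared with the definition by dimension shifting
  along an injective resolution. Quotients of modules are avoided by working with subquotients and
  linear relations between them.
\<close>

section \<open>Linear maps and subquotients\<close>

text \<open>Ext(R/I, M) and local cohomology are linked by the fact that every element annihilated
  by I is torsion. Hom(R/I, -) therefore takes the same value on an injective module and on its
  torsion part, so the torsion complex, which computes local cohomology, also yields Ext(R/I, M).
  The hypothesis on H^i is used in all degrees because going back from B^(i+1) to Z^i raises the
  degree by one, so the induction must carry every positive degree along.

  By definition, each module in the second argument of Ext has its own injective resolution, on its
  own carrier type, and long exact sequences would force these to be compared. A single resolution
  of R/I serves all modules at once. Over a Noetherian ring it consists of finite matrices, and Hom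
  from it into a short exact sequence is exact entry by entry.

  The Serre class lives on one type \<open>'u\<close>, so quotients and extensions have to be
  rebuilt there, by coset representatives and by an encoding of pairs. Injective resolutions have to
  stay on one type for the same kind of reason.\<close>

lemma (in module) submodule_criterion:
  assumes "H \<subseteq> carrier M" "\<zero>\<^bsub>M\<^esub> \<in> H"
    and "\<And>a b. \<lbrakk>a \<in> H; b \<in> H\<rbrakk> \<Longrightarrow> a \<oplus>\<^bsub>M\<^esub> b \<in> H"
    and "\<And>a x. \<lbrakk>a \<in> carrier R; x \<in> H\<rbrakk> \<Longrightarrow> a \<odot>\<^bsub>M\<^esub> x \<in> H"
  shows "submodule H R M"
proof (rule submoduleI)
  fix a assume a: "a \<in> H"
  then have "\<ominus>\<^bsub>M\<^esub> a = (\<ominus> \<one>) \<odot>\<^bsub>M\<^esub> a"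
    using assms(1) by (subst smult_l_minus) auto
  then show "\<ominus>\<^bsub>M\<^esub> a \<in> H" using assms(4)[of "\<ominus> \<one>" a] a by simp
qed (use assms in auto)

lemma (in module) submodule_zero: "submodule {\<zero>\<^bsub>M\<^esub>} R M"
  by (rule submodule_criterion) auto

lemma (in module) submoduleD:
  assumes "submodule H R M"
  shows "\<zero>\<^bsub>M\<^esub> \<in> H" "\<And>x. x \<in> H \<Longrightarrow> x \<in> carrier M"
    "\<And>x y. \<lbrakk>x \<in> H; y \<in> H\<rbrakk> \<Longrightarrow> x \<oplus>\<^bsub>M\<^esub> y \<in> H"
    "\<And>x y. \<lbrakk>x \<in> H; y \<in> H\<rbrakk> \<Longrightarrow> x \<ominus>\<^bsub>M\<^esub> y \<in> H"
    "\<And>x. x \<in> H \<Longrightarrow> \<ominus>\<^bsub>M\<^esub> x \<in> H"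
    "\<And>r x. \<lbrakk>r \<in> carrier R; x \<in> H\<rbrakk> \<Longrightarrow> r \<odot>\<^bsub>M\<^esub> x \<in> H"
proof -
  show "\<zero>\<^bsub>M\<^esub> \<in> H"
    using submodule.axioms(1)[OF assms] subgroup.one_closed by fastforce
qed (use submoduleE[OF assms] in \<open>auto simp: a_minus_def\<close>)

lemma (in module) smult_r_diff:
  "\<lbrakk>r \<in> carrier R; x \<in> carrier M; y \<in> carrier M\<rbrakk> \<Longrightarrow>
   r \<odot>\<^bsub>M\<^esub> (x \<ominus>\<^bsub>M\<^esub> y) = r \<odot>\<^bsub>M\<^esub> x \<ominus>\<^bsub>M\<^esub> r \<odot>\<^bsub>M\<^esub> y"
  by (simp add: a_minus_def smult_r_distr smult_r_minus)

lemma (in abelian_group) diff_eq_zero_iff: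
  "\<lbrakk>x \<in> carrier G; y \<in> carrier G\<rbrakk> \<Longrightarrow> x \<ominus> y = \<zero> \<longleftrightarrow> x = y"
  by (metis a_minus_def add.inv_solve_right l_zero r_neg zero_closed)

lemma (in abelian_group) add_diff_add:
  "\<lbrakk>a \<in> carrier G; b \<in> carrier G; c \<in> carrier G; d \<in> carrier G\<rbrakk> \<Longrightarrow>
   (a \<oplus> b) \<ominus> (c \<oplus> d) = (a \<ominus> c) \<oplus> (b \<ominus> d)"
  by (simp add: a_minus_def minus_add a_ac)

lemma (in abelian_group) diff_add_cancel:
  "\<lbrakk>a \<in> carrier G; b \<in> carrier G\<rbrakk> \<Longrightarrow> (a \<ominus> b) \<oplus> b = a"
  "\<lbrakk>a \<in> carrier G; b \<in> carrier G\<rbrakk> \<Longrightarrow> b \<oplus> (a \<ominus> b) = a"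
  "\<lbrakk>a \<in> carrier G; b \<in> carrier G\<rbrakk> \<Longrightarrow> (a \<oplus> b) \<ominus> b = a"
  by (simp_all add: a_minus_def a_ac l_neg r_neg)

lemma (in abelian_group) diff_zero: "a \<in> carrier G \<Longrightarrow> a \<ominus> \<zero> = a"
  using diff_add_cancel(3)[of a \<zero>] by simp

lemma (in abelian_group) diff_telescope:
  assumes "a \<in> carrier G" "b \<in> carrier G" "c \<in> carrier G"
  shows "(a \<ominus> b) \<oplus> (b \<ominus> c) = a \<ominus> c" "(a \<ominus> c) \<ominus> (b \<ominus> c) = a \<ominus> b"
proof -
  have *: "(a \<ominus> b) \<oplus> (b \<ominus> c) = a \<ominus> c" if "a \<in> carrier G" "b \<in> carrier G" "c \<in> carrier G" for a b c
  proof -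
    have "(a \<ominus> b) \<oplus> (b \<ominus> c) = ((a \<ominus> b) \<oplus> b) \<ominus> c"
      using that by (simp add: a_minus_def a_assoc)
    then show ?thesis using that by (simp add: diff_add_cancel)
  qed
  show "(a \<ominus> b) \<oplus> (b \<ominus> c) = a \<ominus> c" using * assms by simp
  have "(a \<ominus> c) \<ominus> (b \<ominus> c) = (a \<ominus> c) \<oplus> (c \<ominus> b)"
    using assms by (simp add: a_minus_def minus_add a_comm)
  then show "(a \<ominus> c) \<ominus> (b \<ominus> c) = a \<ominus> b" using * assms by simp
qed

text \<open>The predicate under \<open>SOME\<close> depends only on the coset of \<open>n\<close>,
  so equal cosets receive the same representative. This keeps a quotient on the carrier type of
  \<open>M\<close>, where cosets would move it to a type of sets.\<close>

lemma (in module) coset_representatives: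
  assumes B: "submodule B R M"
  shows "\<exists>\<psi> :: 'c \<Rightarrow> 'c. \<forall>x\<in>carrier M. \<forall>y\<in>carrier M. \<psi> x = \<psi> y \<longleftrightarrow> x \<ominus>\<^bsub>M\<^esub> y \<in> B"
proof -
  note BD = submoduleD[OF B]
  define \<psi> where "\<psi> n = (SOME n'. n' \<in> carrier M \<and> n \<ominus>\<^bsub>M\<^esub> n' \<in> B)" for n
  have \<psi>: "\<psi> n \<in> carrier M \<and> n \<ominus>\<^bsub>M\<^esub> \<psi> n \<in> B" if "n \<in> carrier M" for n
    unfolding \<psi>_def by (rule someI[of _ n]) (use that BD(1) in \<open>simp add: a_minus_def M.r_neg\<close>)
  have tr: "x \<ominus>\<^bsub>M\<^esub> z \<in> B"
    if "x \<ominus>\<^bsub>M\<^esub> y \<in> B" "y \<ominus>\<^bsub>M\<^esub> z \<in> B" "x \<in> carrier M" "y \<in> carrier M" "z \<in> carrier M" for x y z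
  proof -
    have "x \<ominus>\<^bsub>M\<^esub> z = (x \<ominus>\<^bsub>M\<^esub> y) \<oplus>\<^bsub>M\<^esub> (y \<ominus>\<^bsub>M\<^esub> z)"
      using that(3-) by (simp add: M.diff_telescope)
    then show ?thesis using BD(3)[OF that(1,2)] by simp
  qed
  have sy: "y \<ominus>\<^bsub>M\<^esub> x \<in> B" if "x \<ominus>\<^bsub>M\<^esub> y \<in> B" "x \<in> carrier M" "y \<in> carrier M" for x y
  proof -
    have "y \<ominus>\<^bsub>M\<^esub> x = \<ominus>\<^bsub>M\<^esub> (x \<ominus>\<^bsub>M\<^esub> y)"
      using that(2-) by (simp add: a_minus_def M.minus_add M.a_ac)
    then show ?thesis using BD(5)[OF that(1)] by simp
  qed
  have fib: "\<psi> x = \<psi> y \<longleftrightarrow> x \<ominus>\<^bsub>M\<^esub> y \<in> B" if "x \<in> carrier M" "y \<in> carrier M" for x y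
  proof
    assume "\<psi> x = \<psi> y"
    then show "x \<ominus>\<^bsub>M\<^esub> y \<in> B" using \<psi> that tr sy by metis
  next
    assume "x \<ominus>\<^bsub>M\<^esub> y \<in> B"
    then have "(n' \<in> carrier M \<and> x \<ominus>\<^bsub>M\<^esub> n' \<in> B) = (n' \<in> carrier M \<and> y \<ominus>\<^bsub>M\<^esub> n' \<in> B)" for n'
      using that tr[of x y n'] tr[of y x n'] sy by blast
    then show "\<psi> x = \<psi> y" unfolding \<psi>_def by simp
  qed
  then show ?thesis by blast
qed

text \<open>The module axioms are equations and existence statements that survive a surjection
  compatible with the operations. \<open>N\<close> enters as a bare record, so this one check serves
  transported modules, quotients and Hom modules.\<close>

lemma epimorphic_image_module:
  fixes R (structure)
  assumes M: "module R M"
    and im: "f ` carrier M = carrier N" and z: "f \<zero>\<^bsub>M\<^esub> = \<zero>\<^bsub>N\<^esub>"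
    and add: "\<And>x y. \<lbrakk>x \<in> carrier M; y \<in> carrier M\<rbrakk> \<Longrightarrow> f (x \<oplus>\<^bsub>M\<^esub> y) = f x \<oplus>\<^bsub>N\<^esub> f y"
    and smult: "\<And>r x. \<lbrakk>r \<in> carrier R; x \<in> carrier M\<rbrakk> \<Longrightarrow> f (r \<odot>\<^bsub>M\<^esub> x) = r \<odot>\<^bsub>N\<^esub> f x"
  shows "module R N"
proof -
  interpret module R M by fact
  have *: "(\<forall>y\<in>carrier N. P y) \<longleftrightarrow> (\<forall>x\<in>carrier M. P (f x))" for P
    unfolding im[symmetric] by blast
  have cl: "f x \<in> carrier N" if "x \<in> carrier M" for x using im that by auto
  show ?thesis
  proof (rule moduleI)
    show "cring R" by (rule R.is_cring)
    show "abelian_group N"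
    proof (rule abelian_groupI)
      show "\<zero>\<^bsub>N\<^esub> \<in> carrier N" using cl[of "\<zero>\<^bsub>M\<^esub>"] z by simp
      have "\<forall>x\<in>carrier N. \<forall>y\<in>carrier N. x \<oplus>\<^bsub>N\<^esub> y \<in> carrier N"
        unfolding * by (simp add: add[symmetric] cl)
      then show "\<And>x y. x \<in> carrier N \<Longrightarrow> y \<in> carrier N \<Longrightarrow> x \<oplus>\<^bsub>N\<^esub> y \<in> carrier N" by blast
      have "\<forall>x\<in>carrier N. \<forall>y\<in>carrier N. \<forall>z\<in>carrier N. x \<oplus>\<^bsub>N\<^esub> y \<oplus>\<^bsub>N\<^esub> z = x \<oplus>\<^bsub>N\<^esub> (y \<oplus>\<^bsub>N\<^esub> z)"
        unfolding * by (simp add: add[symmetric] M.a_assoc)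
      then show "\<And>x y z. x \<in> carrier N \<Longrightarrow> y \<in> carrier N \<Longrightarrow> z \<in> carrier N \<Longrightarrow>
          x \<oplus>\<^bsub>N\<^esub> y \<oplus>\<^bsub>N\<^esub> z = x \<oplus>\<^bsub>N\<^esub> (y \<oplus>\<^bsub>N\<^esub> z)" by blast
      have "\<forall>x\<in>carrier N. \<forall>y\<in>carrier N. x \<oplus>\<^bsub>N\<^esub> y = y \<oplus>\<^bsub>N\<^esub> x"
        unfolding * by (simp add: add[symmetric] M.a_comm)
      then show "\<And>x y. x \<in> carrier N \<Longrightarrow> y \<in> carrier N \<Longrightarrow> x \<oplus>\<^bsub>N\<^esub> y = y \<oplus>\<^bsub>N\<^esub> x" by blast
      have "\<forall>x\<in>carrier N. \<zero>\<^bsub>N\<^esub> \<oplus>\<^bsub>N\<^esub> x = x"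
        unfolding * z[symmetric] by (simp add: add[symmetric])
      then show "\<And>x. x \<in> carrier N \<Longrightarrow> \<zero>\<^bsub>N\<^esub> \<oplus>\<^bsub>N\<^esub> x = x" by blast
      have "f (\<ominus>\<^bsub>M\<^esub> x) \<oplus>\<^bsub>N\<^esub> f x = \<zero>\<^bsub>N\<^esub>" if "x \<in> carrier M" for x
        using that by (simp add: add[symmetric] z[symmetric] M.l_neg)
      then have "\<forall>x\<in>carrier N. \<exists>y\<in>carrier N. y \<oplus>\<^bsub>N\<^esub> x = \<zero>\<^bsub>N\<^esub>"
        unfolding * using cl M.a_inv_closed by blast
      then show "\<And>x. x \<in> carrier N \<Longrightarrow> \<exists>y\<in>carrier N. y \<oplus>\<^bsub>N\<^esub> x = \<zero>\<^bsub>N\<^esub>" by blast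
    qed
    have "\<forall>a\<in>carrier R. \<forall>x\<in>carrier N. a \<odot>\<^bsub>N\<^esub> x \<in> carrier N"
      unfolding * by (simp add: smult[symmetric] cl)
    then show "\<And>a x. a \<in> carrier R \<Longrightarrow> x \<in> carrier N \<Longrightarrow> a \<odot>\<^bsub>N\<^esub> x \<in> carrier N" by blast
    have "\<forall>a\<in>carrier R. \<forall>b\<in>carrier R. \<forall>x\<in>carrier N. (a \<oplus> b) \<odot>\<^bsub>N\<^esub> x = a \<odot>\<^bsub>N\<^esub> x \<oplus>\<^bsub>N\<^esub> b \<odot>\<^bsub>N\<^esub> x"
      unfolding * by (simp add: smult[symmetric] add[symmetric] smult_l_distr)
    then show "\<And>a b x. a \<in> carrier R \<Longrightarrow> b \<in> carrier R \<Longrightarrow> x \<in> carrier N \<Longrightarrow>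
      (a \<oplus> b) \<odot>\<^bsub>N\<^esub> x = a \<odot>\<^bsub>N\<^esub> x \<oplus>\<^bsub>N\<^esub> b \<odot>\<^bsub>N\<^esub> x" by blast
    have "\<forall>a\<in>carrier R. \<forall>x\<in>carrier N. \<forall>y\<in>carrier N. a \<odot>\<^bsub>N\<^esub> (x \<oplus>\<^bsub>N\<^esub> y) = a \<odot>\<^bsub>N\<^esub> x \<oplus>\<^bsub>N\<^esub> a \<odot>\<^bsub>N\<^esub> y"
      unfolding * by (simp add: smult[symmetric] add[symmetric] smult_r_distr)
    then show "\<And>a x y. a \<in> carrier R \<Longrightarrow> x \<in> carrier N \<Longrightarrow> y \<in> carrier N \<Longrightarrow>
      a \<odot>\<^bsub>N\<^esub> (x \<oplus>\<^bsub>N\<^esub> y) = a \<odot>\<^bsub>N\<^esub> x \<oplus>\<^bsub>N\<^esub> a \<odot>\<^bsub>N\<^esub> y" by blast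
    have "\<forall>a\<in>carrier R. \<forall>b\<in>carrier R. \<forall>x\<in>carrier N. (a \<otimes> b) \<odot>\<^bsub>N\<^esub> x = a \<odot>\<^bsub>N\<^esub> (b \<odot>\<^bsub>N\<^esub> x)"
      unfolding * by (simp add: smult[symmetric] smult_assoc1)
    then show "\<And>a b x. a \<in> carrier R \<Longrightarrow> b \<in> carrier R \<Longrightarrow> x \<in> carrier N \<Longrightarrow>
      (a \<otimes> b) \<odot>\<^bsub>N\<^esub> x = a \<odot>\<^bsub>N\<^esub> (b \<odot>\<^bsub>N\<^esub> x)" by blast
    have "\<forall>x\<in>carrier N. \<one> \<odot>\<^bsub>N\<^esub> x = x"
      unfolding * by (simp add: smult[symmetric])
    then show "\<And>x. x \<in> carrier N \<Longrightarrow> \<one> \<odot>\<^bsub>N\<^esub> x = x" by blast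
  qed
qed

text \<open>In contrast to \<open>module_hom\<close>, the domain is a subset \<open>Z\<close> and
  values outside it are free, so submodules need no records of their own and a function can be
  restricted without being changed.\<close>

definition linear_on ::
    "('r, 'k) ring_scheme \<Rightarrow> ('r, 'm) module \<Rightarrow> ('r, 'n) module \<Rightarrow> 'm set \<Rightarrow> ('m \<Rightarrow> 'n) \<Rightarrow> bool" where
  "linear_on R M N Z f \<longleftrightarrow> f \<in> Z \<rightarrow> carrier N \<and>
     (\<forall>x\<in>Z. \<forall>y\<in>Z. f (x \<oplus>\<^bsub>M\<^esub> y) = f x \<oplus>\<^bsub>N\<^esub> f y) \<and>
     (\<forall>r\<in>carrier R. \<forall>x\<in>Z. f (r \<odot>\<^bsub>M\<^esub> x) = r \<odot>\<^bsub>N\<^esub> f x)"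

lemma linear_onI:
  assumes "\<And>x. x \<in> Z \<Longrightarrow> f x \<in> carrier N"
    "\<And>x y. \<lbrakk>x \<in> Z; y \<in> Z\<rbrakk> \<Longrightarrow> f (x \<oplus>\<^bsub>M\<^esub> y) = f x \<oplus>\<^bsub>N\<^esub> f y"
    "\<And>r x. \<lbrakk>r \<in> carrier R; x \<in> Z\<rbrakk> \<Longrightarrow> f (r \<odot>\<^bsub>M\<^esub> x) = r \<odot>\<^bsub>N\<^esub> f x"
  shows "linear_on R M N Z f"
  using assms unfolding linear_on_def by auto

lemma linear_onD:
  assumes "linear_on R M N Z f"
  shows "\<And>x. x \<in> Z \<Longrightarrow> f x \<in> carrier N"
    "\<And>x y. \<lbrakk>x \<in> Z; y \<in> Z\<rbrakk> \<Longrightarrow> f (x \<oplus>\<^bsub>M\<^esub> y) = f x \<oplus>\<^bsub>N\<^esub> f y"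
    "\<And>r x. \<lbrakk>r \<in> carrier R; x \<in> Z\<rbrakk> \<Longrightarrow> f (r \<odot>\<^bsub>M\<^esub> x) = r \<odot>\<^bsub>N\<^esub> f x"
  using assms unfolding linear_on_def by auto

lemma linear_on_mono: "linear_on R M N Z f \<Longrightarrow> Z' \<subseteq> Z \<Longrightarrow> linear_on R M N Z' f"
  unfolding linear_on_def by blast

lemma linear_on_submodule_facts:
  assumes "module R M" "module R N" and Z: "submodule Z R M" and f: "linear_on R M N Z f"
  shows linear_on_zero: "f \<zero>\<^bsub>M\<^esub> = \<zero>\<^bsub>N\<^esub>"
    and linear_on_diff: "\<And>x y. \<lbrakk>x \<in> Z; y \<in> Z\<rbrakk> \<Longrightarrow> f (x \<ominus>\<^bsub>M\<^esub> y) = f x \<ominus>\<^bsub>N\<^esub> f y"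
    and linear_on_image: "submodule (f ` Z) R N"
    and linear_on_kernel: "submodule {x \<in> Z. f x = \<zero>\<^bsub>N\<^esub>} R M"
    and linear_on_vimage: "\<And>H. submodule H R N \<Longrightarrow> submodule {x \<in> Z. f x \<in> H} R M"
proof -
  interpret M: module R M by fact
  interpret N: module R N by fact
  note ZD = M.submoduleD[OF Z] and fD = linear_onD[OF f]
  have "f (\<zero>\<^bsub>R\<^esub> \<odot>\<^bsub>M\<^esub> \<zero>\<^bsub>M\<^esub>) = \<zero>\<^bsub>R\<^esub> \<odot>\<^bsub>N\<^esub> f \<zero>\<^bsub>M\<^esub>"
    by (rule fD) (auto simp: ZD)
  then show 0: "f \<zero>\<^bsub>M\<^esub> = \<zero>\<^bsub>N\<^esub>" using fD(1)[OF ZD(1)] by simp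
  have um: "f (\<ominus>\<^bsub>M\<^esub> x) = \<ominus>\<^bsub>N\<^esub> f x" if "x \<in> Z" for x
  proof -
    have "f (\<ominus>\<^bsub>M\<^esub> x) \<oplus>\<^bsub>N\<^esub> f x = \<zero>\<^bsub>N\<^esub>"
      using fD(2)[of "\<ominus>\<^bsub>M\<^esub> x" x] that ZD 0 by (simp add: M.l_neg)
    then show ?thesis using that ZD fD by (metis N.minus_equality)
  qed
  show "f (x \<ominus>\<^bsub>M\<^esub> y) = f x \<ominus>\<^bsub>N\<^esub> f y" if "x \<in> Z" "y \<in> Z" for x y
    using that ZD fD um by (simp add: a_minus_def)
  show "submodule (f ` Z) R N"
  proof (rule N.submodule_criterion)
    show "\<zero>\<^bsub>N\<^esub> \<in> f ` Z" using 0 ZD(1) by (metis imageI)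
  qed (use fD ZD in \<open>auto simp: fD(2,3)[symmetric]\<close>)
  show *: "submodule {x \<in> Z. f x \<in> H} R M" if "submodule H R N" for H
    by (rule M.submodule_criterion) (use that 0 fD ZD N.submoduleD[OF that] in auto)
  show "submodule {x \<in> Z. f x = \<zero>\<^bsub>N\<^esub>} R M"
    using *[OF N.submodule_zero] by simp
qed

text \<open>Operations are carried out on preimages chosen by \<open>\<sigma>\<close>; they are well
  defined because two preimages of one value differ by an element of \<open>B\<close>. In this way Z
  / B can be realised on any type that is able to name its cosets.\<close>

lemma transport_module:
  fixes M :: "('r, 'm) module" and \<psi> :: "'m \<Rightarrow> 'w"
  assumes M: "module R M" and Z: "submodule Z R M" and B: "submodule B R M"
    and fib: "\<And>x y. \<lbrakk>x \<in> Z; y \<in> Z\<rbrakk> \<Longrightarrow> \<psi> x = \<psi> y \<longleftrightarrow> x \<ominus>\<^bsub>M\<^esub> y \<in> B"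
  obtains N :: "('r, 'w) module" where "module R N" "linear_on R M N Z \<psi>" "\<psi> ` Z = carrier N"
    "\<And>x. x \<in> Z \<Longrightarrow> \<psi> x = \<zero>\<^bsub>N\<^esub> \<longleftrightarrow> x \<in> B"
proof -
  interpret M: module R M by fact
  note ZD = M.submoduleD[OF Z] and BD = M.submoduleD[OF B]
  define \<sigma> where "\<sigma> w = (SOME x. x \<in> Z \<and> \<psi> x = w)" for w
  have \<sigma>: "\<sigma> (\<psi> x) \<in> Z \<and> \<psi> (\<sigma> (\<psi> x)) = \<psi> x" if "x \<in> Z" for x
    unfolding \<sigma>_def by (rule someI_ex) (use that in blast)
  then have \<sigma>B: "\<sigma> (\<psi> x) \<ominus>\<^bsub>M\<^esub> x \<in> B" if "x \<in> Z" for x using fib that by blast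
  define N :: "('r, 'w) module" where
    "N = \<lparr>carrier = \<psi> ` Z, monoid.mult = undefined, one = undefined, ring.zero = \<psi> \<zero>\<^bsub>M\<^esub>,
      ring.add = (\<lambda>a b. \<psi> (\<sigma> a \<oplus>\<^bsub>M\<^esub> \<sigma> b)), smult = (\<lambda>r a. \<psi> (r \<odot>\<^bsub>M\<^esub> \<sigma> a))\<rparr>"
  have add: "\<psi> (x \<oplus>\<^bsub>M\<^esub> y) = \<psi> x \<oplus>\<^bsub>N\<^esub> \<psi> y" if "x \<in> Z" "y \<in> Z" for x y
  proof -
    have "(x \<oplus>\<^bsub>M\<^esub> y) \<ominus>\<^bsub>M\<^esub> (\<sigma> (\<psi> x) \<oplus>\<^bsub>M\<^esub> \<sigma> (\<psi> y)) = \<ominus>\<^bsub>M\<^esub> ((\<sigma> (\<psi> x) \<ominus>\<^bsub>M\<^esub> x) \<oplus>\<^bsub>M\<^esub> (\<sigma> (\<psi> y) \<ominus>\<^bsub>M\<^esub> y))"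
      using that \<sigma> ZD(2) by (simp add: a_minus_def M.minus_add M.a_ac)
    then show ?thesis using fib that \<sigma> \<sigma>B BD ZD by (simp add: N_def)
  qed
  have smult: "\<psi> (r \<odot>\<^bsub>M\<^esub> x) = r \<odot>\<^bsub>N\<^esub> \<psi> x" if "r \<in> carrier R" "x \<in> Z" for r x
  proof -
    have "r \<odot>\<^bsub>M\<^esub> x \<ominus>\<^bsub>M\<^esub> r \<odot>\<^bsub>M\<^esub> \<sigma> (\<psi> x) = \<ominus>\<^bsub>M\<^esub> (r \<odot>\<^bsub>M\<^esub> (\<sigma> (\<psi> x) \<ominus>\<^bsub>M\<^esub> x))"
      using that \<sigma>[OF that(2)] ZD(2)
      by (simp add: a_minus_def M.minus_add M.smult_r_distr M.smult_r_minus M.a_ac)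
    then show ?thesis using fib that \<sigma> \<sigma>B BD ZD by (simp add: N_def)
  qed
  have im: "\<psi> ` Z = carrier N" by (simp add: N_def)
  show thesis
  proof (rule that[of N])
    show "module R N"
      by (rule epimorphic_image_module[OF submodule.submodule_is_module[OF Z M], of \<psi>])
        (use im add smult in \<open>auto simp: N_def\<close>)
    show "linear_on R M N Z \<psi>"
      by (rule linear_onI) (use im add smult in auto)
    show "\<psi> x = \<zero>\<^bsub>N\<^esub> \<longleftrightarrow> x \<in> B" if "x \<in> Z" for x
      using fib[of x "\<zero>\<^bsub>M\<^esub>"] that ZD(1,2) by (simp add: N_def M.diff_zero)
  qed (rule im)
qed

lemma module_homD:
  assumes "f \<in> module_hom R M N"
  shows "\<And>x. x \<in> carrier M \<Longrightarrow> f x \<in> carrier N"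
    "\<And>x y. \<lbrakk>x \<in> carrier M; y \<in> carrier M\<rbrakk> \<Longrightarrow> f (x \<oplus>\<^bsub>M\<^esub> y) = f x \<oplus>\<^bsub>N\<^esub> f y"
    "\<And>r x. \<lbrakk>r \<in> carrier R; x \<in> carrier M\<rbrakk> \<Longrightarrow> f (r \<odot>\<^bsub>M\<^esub> x) = r \<odot>\<^bsub>N\<^esub> f x"
    "f \<in> extensional (carrier M)" "linear_on R M N (carrier M) f"
  using assms by (auto simp: module_hom_def PiE_def linear_on_def)

lemma restrict_module_hom:
  assumes "module R M" "linear_on R M N (carrier M) f"
  shows "restrict f (carrier M) \<in> module_hom R M N"
proof -
  interpret module R M by fact
  show ?thesis using linear_onD[OF assms(2)] by (auto simp: module_hom_def)
qed

lemma restrict_module_hom_submodule: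
  assumes "module R M" "submodule Z R M" "linear_on R M N Z f"
  shows "restrict f Z \<in> module_hom R (M\<lparr>carrier := Z\<rparr>) N"
  using restrict_module_hom[OF submodule.submodule_is_module[OF assms(2,1)], of N f] assms(3)
  by (simp add: linear_on_def)

text \<open>Membership of \<open>Z / B\<close> in the Serre class, whatever the carrier type; an epimorphism with
  kernel \<open>B\<close> onto a member replaces the isomorphism, so that no cosets occur.\<close>

definition subquotient_in ::
    "('r, 'k) ring_scheme \<Rightarrow> ('r, 'u) module set \<Rightarrow> ('r, 'm) module \<Rightarrow> 'm set \<Rightarrow> 'm set \<Rightarrow> bool" where
  "subquotient_in R S M Z B \<longleftrightarrow>
    (\<exists>N\<in>S. \<exists>\<phi>. linear_on R M N Z \<phi> \<and> \<phi> ` Z = carrier N \<and> (\<forall>x\<in>Z. \<phi> x = \<zero>\<^bsub>N\<^esub> \<longleftrightarrow> x \<in> B))"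

text \<open>Totality and single-valuedness are left out on purpose: where a relation is used, they
  are demanded only modulo the submodules divided out. A connecting homomorphism, for instance,
  becomes a relation without any choice of lifts.\<close>

definition linear_relation ::
  "('r, 'k) ring_scheme \<Rightarrow> ('r, 'm) module \<Rightarrow> ('r, 'n) module \<Rightarrow> ('m \<Rightarrow> 'n \<Rightarrow> bool) \<Rightarrow> bool" where
  "linear_relation R M N \<rho> \<longleftrightarrow>
    (\<forall>x y x' y'. \<rho> x y \<and> \<rho> x' y' \<and> x \<in> carrier M \<and> x' \<in> carrier M \<and> y \<in> carrier N \<and> y' \<in> carrier N \<longrightarrow>
       \<rho> (x \<oplus>\<^bsub>M\<^esub> x') (y \<oplus>\<^bsub>N\<^esub> y')) \<and>
    (\<forall>r\<in>carrier R. \<forall>x\<in>carrier M. \<forall>y\<in>carrier N. \<rho> x y \<longrightarrow> \<rho> (r \<odot>\<^bsub>M\<^esub> x) (r \<odot>\<^bsub>N\<^esub> y))"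

lemma linear_relationI:
  assumes "\<And>x y x' y'. \<lbrakk>\<rho> x y; \<rho> x' y'; x \<in> carrier M; x' \<in> carrier M; y \<in> carrier N; y' \<in> carrier N\<rbrakk> \<Longrightarrow>
       \<rho> (x \<oplus>\<^bsub>M\<^esub> x') (y \<oplus>\<^bsub>N\<^esub> y')"
    "\<And>r x y. \<lbrakk>r \<in> carrier R; x \<in> carrier M; y \<in> carrier N; \<rho> x y\<rbrakk> \<Longrightarrow> \<rho> (r \<odot>\<^bsub>M\<^esub> x) (r \<odot>\<^bsub>N\<^esub> y)"
  shows "linear_relation R M N \<rho>"
  using assms unfolding linear_relation_def by blast

lemma linear_relationD:
  assumes "linear_relation R M N \<rho>"
  shows "\<lbrakk>\<rho> x y; \<rho> x' y'; x \<in> carrier M; x' \<in> carrier M; y \<in> carrier N; y' \<in> carrier N\<rbrakk> \<Longrightarrow>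
       \<rho> (x \<oplus>\<^bsub>M\<^esub> x') (y \<oplus>\<^bsub>N\<^esub> y')"
    "\<lbrakk>\<rho> x y; r \<in> carrier R; x \<in> carrier M; y \<in> carrier N\<rbrakk> \<Longrightarrow> \<rho> (r \<odot>\<^bsub>M\<^esub> x) (r \<odot>\<^bsub>N\<^esub> y)"
  using assms by (simp_all add: linear_relation_def)

section \<open>Closure properties of a Serre class, transferred to subquotients over arbitrary
  types\<close>

locale serre =
  fixes R :: "('r, 'k) ring_scheme" and S :: "('r, 'u::infinite) module set"
  assumes cring: "cring R" and serre: "serre_class R S"
begin

lemma S_module: "N \<in> S \<Longrightarrow> module R N"
  using serre[unfolded serre_class_def, THEN conjunct2, THEN conjunct1] by (rule bspec)

lemma S_mono:
  assumes "N \<in> S" "module R A" "f \<in> module_hom R A N" "inj_on f (carrier A)"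
  shows "A \<in> S"
  using serre[unfolded serre_class_def, THEN conjunct2, THEN conjunct2, THEN conjunct1] assms
  by blast

lemma S_epi:
  assumes "N \<in> S" "module R C" "f \<in> module_hom R N C" "f ` carrier N = carrier C"
  shows "C \<in> S"
  using serre[unfolded serre_class_def, THEN conjunct2, THEN conjunct2, THEN conjunct2, THEN conjunct1]
    assms by blast

lemma S_ext:
  assumes "A \<in> S" "C \<in> S" "module R B" "f \<in> module_hom R A B" "g \<in> module_hom R B C"
    "inj_on f (carrier A)" "f ` carrier A = a_kernel B C g" "g ` carrier B = carrier C"
  shows "B \<in> S"
  using serre[unfolded serre_class_def, THEN conjunct2, THEN conjunct2, THEN conjunct2, THEN conjunct2]
    assms by blast

lemma S_submodule:
  assumes "N \<in> S" "submodule T R N"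
  shows "N\<lparr>carrier := T\<rparr> \<in> S"
proof (rule S_mono[OF assms(1)])
  interpret module R N using S_module[OF assms(1)] .
  show "module R (N\<lparr>carrier := T\<rparr>)"
    using submodule.submodule_is_module[OF assms(2)] module_axioms .
  show "restrict (\<lambda>x. x) T \<in> module_hom R (N\<lparr>carrier := T\<rparr>) N"
    by (rule restrict_module_hom_submodule)
      (use submoduleD[OF assms(2)] assms(2) module_axioms in \<open>auto intro!: linear_onI\<close>)
qed (auto simp: inj_on_def)

text \<open>Two partners of the same \<open>z\<close> differ by a partner of 0, which
  \<open>ker\<close> puts into \<open>B'\<close> because 0 lies in \<open>B\<close>. So
  \<open>\<rho>\<close> induces a well-defined map from Z / B to Z' / B', and \<open>ker\<close>
  also makes it injective; closure of the class under submodules finishes the argument.\<close>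

lemma subquotient_embed:
  assumes M: "module R M" and M': "module R M'"
    and Z: "submodule Z R M" and Z': "submodule Z' R M'"
    and \<rho>: "linear_relation R M M' \<rho>"
    and tot: "\<And>z. z \<in> Z \<Longrightarrow> \<exists>y\<in>Z'. \<rho> z y"
    and ker: "\<And>z y. \<lbrakk>z \<in> Z; y \<in> Z'; \<rho> z y\<rbrakk> \<Longrightarrow> y \<in> B' \<longleftrightarrow> z \<in> B"
    and "\<zero>\<^bsub>M\<^esub> \<in> B"
    and sq: "subquotient_in R S M' Z' B'"
  shows "subquotient_in R S M Z B"
proof -
  interpret M: module R M by fact
  interpret M': module R M' by fact
  obtain N \<phi> where N: "N \<in> S" and \<phi>: "linear_on R M' N Z' \<phi>" "\<phi> ` Z' = carrier N"
    and \<phi>B: "\<And>x. x \<in> Z' \<Longrightarrow> \<phi> x = \<zero>\<^bsub>N\<^esub> \<longleftrightarrow> x \<in> B'"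
    using sq unfolding subquotient_in_def by blast
  interpret N: module R N using S_module[OF N] .
  note Z'D = M'.submoduleD[OF Z'] and ZD = M.submoduleD[OF Z] and \<phi>D = linear_onD[OF \<phi>(1)]
  note pdiff = linear_on_diff[OF M' N.module_axioms Z' \<phi>(1)]
  have \<rho>add: "\<rho> (x \<oplus>\<^bsub>M\<^esub> x') (y \<oplus>\<^bsub>M'\<^esub> y')"
    if "\<rho> x y" "\<rho> x' y'" "x \<in> Z" "x' \<in> Z" "y \<in> Z'" "y' \<in> Z'" for x y x' y'
    using that ZD(2) Z'D(2) by (intro linear_relationD(1)[OF \<rho>])
  have \<rho>sm: "\<rho> (r \<odot>\<^bsub>M\<^esub> x) (r \<odot>\<^bsub>M'\<^esub> y)"
    if "\<rho> x y" "x \<in> Z" "y \<in> Z'" "r \<in> carrier R" for x y r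
    using that ZD(2) Z'D(2) by (intro linear_relationD(2)[OF \<rho>])
  have rdiff: "\<rho> (x \<ominus>\<^bsub>M\<^esub> x') (y \<ominus>\<^bsub>M'\<^esub> y')"
    if "\<rho> x y" "\<rho> x' y'" "x \<in> Z" "x' \<in> Z" "y \<in> Z'" "y' \<in> Z'" for x y x' y'
  proof -
    have "\<rho> ((\<ominus>\<^bsub>R\<^esub> \<one>\<^bsub>R\<^esub>) \<odot>\<^bsub>M\<^esub> x') ((\<ominus>\<^bsub>R\<^esub> \<one>\<^bsub>R\<^esub>) \<odot>\<^bsub>M'\<^esub> y')" using that by (intro \<rho>sm) auto
    then have "\<rho> (\<ominus>\<^bsub>M\<^esub> x') (\<ominus>\<^bsub>M'\<^esub> y')" using that ZD Z'D
      by (simp add: M.smult_l_minus M'.smult_l_minus)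
    then show ?thesis unfolding a_minus_def using that ZD Z'D by (intro \<rho>add) auto
  qed
  have uniq: "\<phi> y = \<phi> y'" if "\<rho> z y" "\<rho> z y'" "z \<in> Z" "y \<in> Z'" "y' \<in> Z'" for z y y'
  proof -
    have "\<rho> \<zero>\<^bsub>M\<^esub> (y \<ominus>\<^bsub>M'\<^esub> y')"
      using rdiff[OF that(1,2)] that ZD by (simp add: a_minus_def M.r_neg)
    then have "y \<ominus>\<^bsub>M'\<^esub> y' \<in> B'" using ker[OF ZD(1)] that Z'D(4) assms(8) by blast
    then have "\<phi> y \<ominus>\<^bsub>N\<^esub> \<phi> y' = \<zero>\<^bsub>N\<^esub>" using \<phi>B pdiff Z'D(4) that by metis
    then show ?thesis using that \<phi>D(1) N.diff_eq_zero_iff by blast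
  qed
  define \<psi> where "\<psi> z = \<phi> (SOME y. y \<in> Z' \<and> \<rho> z y)" for z
  have \<psi>: "\<psi> z = \<phi> y" if "z \<in> Z" "y \<in> Z'" "\<rho> z y" for z y
  proof -
    have "(SOME y. y \<in> Z' \<and> \<rho> z y) \<in> Z' \<and> \<rho> z (SOME y. y \<in> Z' \<and> \<rho> z y)"
      by (rule someI_ex) (use that in blast)
    then show ?thesis unfolding \<psi>_def using uniq that by blast
  qed
  have lin: "linear_on R M N Z \<psi>"
  proof (rule linear_onI)
    show "\<psi> x \<in> carrier N" if "x \<in> Z" for x using tot[OF that] \<psi>[OF that] \<phi>D(1) by metis
    show "\<psi> (x \<oplus>\<^bsub>M\<^esub> x') = \<psi> x \<oplus>\<^bsub>N\<^esub> \<psi> x'" if x: "x \<in> Z" "x' \<in> Z" for x x'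
    proof -
      obtain y y' where y: "y \<in> Z'" "\<rho> x y" "y' \<in> Z'" "\<rho> x' y'" using tot x by metis
      then show ?thesis using \<psi>[of "x \<oplus>\<^bsub>M\<^esub> x'" "y \<oplus>\<^bsub>M'\<^esub> y'"] \<psi>[of x y] \<psi>[of x' y'] x ZD Z'D \<rho>add \<phi>D(2)
        by simp
    qed
    show "\<psi> (r \<odot>\<^bsub>M\<^esub> x) = r \<odot>\<^bsub>N\<^esub> \<psi> x" if x: "r \<in> carrier R" "x \<in> Z" for r x
    proof -
      obtain y where y: "y \<in> Z'" "\<rho> x y" using tot x by metis
      then show ?thesis using \<psi>[of "r \<odot>\<^bsub>M\<^esub> x" "r \<odot>\<^bsub>M'\<^esub> y"] \<psi>[of x y] x ZD Z'D \<rho>sm \<phi>D(3)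
        by simp
    qed
  qed
  show ?thesis unfolding subquotient_in_def
  proof (intro bexI exI conjI)
    \<comment> \<open>\<open>subquotient_in\<close> asks for a map onto a member, so
      \<open>N\<close> is cut down to the image.\<close>
    show "N\<lparr>carrier := \<psi> ` Z\<rparr> \<in> S"
      by (rule S_submodule[OF N linear_on_image[OF M N.module_axioms Z lin]])
    show "linear_on R M (N\<lparr>carrier := \<psi> ` Z\<rparr>) Z \<psi>"
      using lin by (auto simp: linear_on_def)
    show "\<forall>x\<in>Z. \<psi> x = \<zero>\<^bsub>N\<lparr>carrier := \<psi> ` Z\<rparr>\<^esub> \<longleftrightarrow> x \<in> B"
    proof
      fix x assume x: "x \<in> Z"
      then obtain y where "y \<in> Z'" "\<rho> x y" using tot by metis
      then show "\<psi> x = \<zero>\<^bsub>N\<lparr>carrier := \<psi> ` Z\<rparr>\<^esub> \<longleftrightarrow> x \<in> B"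
        using \<psi> x \<phi>B ker by simp
    qed
  qed simp
qed

text \<open>The image of \<open>B\<close> in the member that represents Z / A is divided out; coset
  representatives keep the result on the type \<open>'u\<close> of the class.\<close>

lemma subquotient_quotient:
  assumes M: "module R M" and Z: "submodule Z R M" and B: "submodule B R M" and "B \<subseteq> Z"
    and "A \<subseteq> B" and sq: "subquotient_in R S M Z A"
  shows "subquotient_in R S M Z B"
proof -
  interpret M: module R M by fact
  obtain N \<phi> where N: "N \<in> S" and \<phi>: "linear_on R M N Z \<phi>" "\<phi> ` Z = carrier N"
    and \<phi>B: "\<And>x. x \<in> Z \<Longrightarrow> \<phi> x = \<zero>\<^bsub>N\<^esub> \<longleftrightarrow> x \<in> A"
    using sq unfolding subquotient_in_def by blast
  interpret N: module R N using S_module[OF N] .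
  note ZD = M.submoduleD[OF Z] and BD = M.submoduleD[OF B] and \<phi>D = linear_onD[OF \<phi>(1)]
  note pdiff = linear_on_diff[OF M N.module_axioms Z \<phi>(1)]
  have L: "submodule (\<phi> ` B) R N"
    by (rule linear_on_image[OF M N.module_axioms B linear_on_mono[OF \<phi>(1) \<open>B \<subseteq> Z\<close>]])
  obtain \<psi> :: "'u \<Rightarrow> 'u" where fib: "\<And>x y. \<lbrakk>x \<in> carrier N; y \<in> carrier N\<rbrakk> \<Longrightarrow>
      \<psi> x = \<psi> y \<longleftrightarrow> x \<ominus>\<^bsub>N\<^esub> y \<in> \<phi> ` B"
    using N.coset_representatives[OF L] by blast
  obtain N' :: "('r, 'u) module" where N': "module R N'" "linear_on R N N' (carrier N) \<psi>"
    "\<psi> ` carrier N = carrier N'" "\<And>x. x \<in> carrier N \<Longrightarrow> \<psi> x = \<zero>\<^bsub>N'\<^esub> \<longleftrightarrow> x \<in> \<phi> ` B"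
    by (rule transport_module[OF N.module_axioms N.carrier_is_submodule L fib]) auto
  have "N' \<in> S"
    by (rule S_epi[OF N N'(1) restrict_module_hom[OF N.module_axioms N'(2)]]) (simp add: N'(3))
  moreover have "linear_on R M N' Z (\<psi> \<circ> \<phi>)"
    by (rule linear_onI) (use \<phi>D linear_onD[OF N'(2)] in auto)
  moreover have "(\<psi> \<circ> \<phi>) ` Z = carrier N'" by (metis image_comp \<phi>(2) N'(3))
  moreover have "(\<psi> \<circ> \<phi>) x = \<zero>\<^bsub>N'\<^esub> \<longleftrightarrow> x \<in> B" if x: "x \<in> Z" for x
  proof -
    have "x \<in> B" if im: "\<phi> x \<in> \<phi> ` B"
    proof -
      obtain b where b: "b \<in> B" "\<phi> x = \<phi> b" using im by blast
      then have "\<phi> (x \<ominus>\<^bsub>M\<^esub> b) = \<zero>\<^bsub>N\<^esub>" using pdiff[OF x, of b] x \<open>B \<subseteq> Z\<close> \<phi>D(1) N.diff_eq_zero_iff by (metis subsetD)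
      then have "x \<ominus>\<^bsub>M\<^esub> b \<in> B" using \<phi>B x b ZD(4) \<open>B \<subseteq> Z\<close> \<open>A \<subseteq> B\<close> by blast
      then have "(x \<ominus>\<^bsub>M\<^esub> b) \<oplus>\<^bsub>M\<^esub> b \<in> B" using b BD by blast
      then show ?thesis using x b ZD BD M.diff_add_cancel(1) by simp
    qed
    then show ?thesis using N'(4)[OF \<phi>D(1)[OF x]] by auto
  qed
  ultimately show ?thesis unfolding subquotient_in_def by blast
qed

text \<open>To apply \<open>S_ext\<close>, the quotient Z / B must first be built on the type
  \<open>'u\<close>. A class modulo \<open>B\<close> is named by its class modulo \<open>K\<close>
  together with its displacement, in K / B, from a base point of that class.\<close>

lemma subquotient_extension:
  assumes M: "module R M" and Z: "submodule Z R M" and K: "submodule K R M" and B: "submodule B R M"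
    and "B \<subseteq> K" "K \<subseteq> Z"
    and sq1: "subquotient_in R S M K B" and sq2: "subquotient_in R S M Z K"
  shows "subquotient_in R S M Z B"
proof -
  interpret M: module R M by fact
  obtain A \<alpha> where A: "A \<in> S" and \<alpha>: "linear_on R M A K \<alpha>" "\<alpha> ` K = carrier A"
    and \<alpha>B: "\<And>x. x \<in> K \<Longrightarrow> \<alpha> x = \<zero>\<^bsub>A\<^esub> \<longleftrightarrow> x \<in> B"
    using sq1 unfolding subquotient_in_def by blast
  obtain C \<gamma> where C: "C \<in> S" and \<gamma>: "linear_on R M C Z \<gamma>" "\<gamma> ` Z = carrier C"
    and \<gamma>B: "\<And>x. x \<in> Z \<Longrightarrow> \<gamma> x = \<zero>\<^bsub>C\<^esub> \<longleftrightarrow> x \<in> K"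
    using sq2 unfolding subquotient_in_def by blast
  interpret A: module R A using S_module[OF A] .
  interpret C: module R C using S_module[OF C] .
  note ZD = M.submoduleD[OF Z] and KD = M.submoduleD[OF K]
  note \<alpha>D = linear_onD[OF \<alpha>(1)] and \<gamma>D = linear_onD[OF \<gamma>(1)]
  note adiff = linear_on_diff[OF M A.module_axioms K \<alpha>(1)]
    and gdiff = linear_on_diff[OF M C.module_axioms Z \<gamma>(1)]
  \<comment> \<open>Here the infinity of \<open>'u\<close> enters: pairs over \<open>'u\<close> can
    be encoded in \<open>'u\<close>.\<close>
  have "(card_of (UNIV :: ('u \<times> 'u) set), card_of (UNIV :: 'u set)) \<in> ordLeq"
    using card_of_Times_same_infinite[OF infinite_UNIV] ordIso_imp_ordLeq by auto
  then obtain \<iota> :: "'u \<times> 'u \<Rightarrow> 'u" where \<iota>: "inj \<iota>"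
    using card_of_ordLeq[of "UNIV :: ('u \<times> 'u) set" "UNIV :: 'u set"] by blast
  define \<sigma> where "\<sigma> c = (SOME z. z \<in> Z \<and> \<gamma> z = c)" for c
  have \<sigma>: "\<sigma> (\<gamma> z) \<in> Z \<and> \<gamma> (\<sigma> (\<gamma> z)) = \<gamma> z" if "z \<in> Z" for z
    unfolding \<sigma>_def by (rule someI_ex) (use that in blast)
  have sK: "x \<ominus>\<^bsub>M\<^esub> y \<in> K \<longleftrightarrow> \<gamma> x = \<gamma> y" if "x \<in> Z" "y \<in> Z" for x y
    using \<gamma>B[OF ZD(4)[OF that]] gdiff[OF that] C.diff_eq_zero_iff \<gamma>D(1) that by auto
  define \<psi> where "\<psi> z = \<iota> (\<gamma> z, \<alpha> (z \<ominus>\<^bsub>M\<^esub> \<sigma> (\<gamma> z)))" for z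
  have fib: "\<psi> x = \<psi> y \<longleftrightarrow> x \<ominus>\<^bsub>M\<^esub> y \<in> B" if "x \<in> Z" "y \<in> Z" for x y
  proof (cases "\<gamma> x = \<gamma> y")
    case False
    then have "x \<ominus>\<^bsub>M\<^esub> y \<notin> B" using sK that \<open>B \<subseteq> K\<close> by blast
    then show ?thesis using False \<iota> by (auto simp: \<psi>_def inj_eq)
  next
    case True
    define s where "s = \<sigma> (\<gamma> y)"
    have s: "s \<in> Z" "\<gamma> s = \<gamma> y" using \<sigma> that s_def by auto
    have k: "x \<ominus>\<^bsub>M\<^esub> s \<in> K" "y \<ominus>\<^bsub>M\<^esub> s \<in> K" using sK that s True by auto
    have "\<psi> x = \<psi> y \<longleftrightarrow> \<alpha> (x \<ominus>\<^bsub>M\<^esub> s) = \<alpha> (y \<ominus>\<^bsub>M\<^esub> s)"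
      using True \<iota> by (auto simp: \<psi>_def s_def inj_eq)
    also have "\<dots> \<longleftrightarrow> \<alpha> ((x \<ominus>\<^bsub>M\<^esub> s) \<ominus>\<^bsub>M\<^esub> (y \<ominus>\<^bsub>M\<^esub> s)) = \<zero>\<^bsub>A\<^esub>"
      using adiff[OF k] A.diff_eq_zero_iff \<alpha>D(1) k by auto
    also have "(x \<ominus>\<^bsub>M\<^esub> s) \<ominus>\<^bsub>M\<^esub> (y \<ominus>\<^bsub>M\<^esub> s) = x \<ominus>\<^bsub>M\<^esub> y"
      using that s ZD(2) by (simp add: M.diff_telescope)
    also have "\<alpha> (x \<ominus>\<^bsub>M\<^esub> y) = \<zero>\<^bsub>A\<^esub> \<longleftrightarrow> x \<ominus>\<^bsub>M\<^esub> y \<in> B"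
      using \<alpha>B sK[OF that] True by blast
    finally show ?thesis .
  qed
  obtain N :: "('r, 'u) module" where N: "module R N" "linear_on R M N Z \<psi>"
    "\<psi> ` Z = carrier N" "\<And>x. x \<in> Z \<Longrightarrow> \<psi> x = \<zero>\<^bsub>N\<^esub> \<longleftrightarrow> x \<in> B"
    by (rule transport_module[OF M Z B fib]) auto
  interpret N: module R N by fact
  note ND = linear_onD[OF N(2)]
  \<comment> \<open>\<open>f\<close> and, further below, \<open>g\<close> are the maps K / B -> Z /
    B -> Z / K, read off from preimages in \<open>M\<close> because the three modules are known only
    through \<open>\<alpha>\<close>, \<open>\<psi>\<close> and \<open>\<gamma>\<close>.\<close>
  define f where "f a = \<psi> (SOME k. k \<in> K \<and> \<alpha> k = a)" for a
  have \<psi>eq: "\<psi> x = \<psi> y" if "x \<in> Z" "y \<in> Z" "x \<ominus>\<^bsub>M\<^esub> y \<in> B" for x y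
    using fib that by blast
  have \<alpha>eq: "\<alpha> x = \<alpha> y \<longleftrightarrow> \<psi> x = \<psi> y" if "x \<in> K" "y \<in> K" for x y
  proof -
    have "\<alpha> x = \<alpha> y \<longleftrightarrow> x \<ominus>\<^bsub>M\<^esub> y \<in> B"
      using \<alpha>B[OF KD(4)[OF that]] adiff[OF that] A.diff_eq_zero_iff \<alpha>D(1) that by auto
    then show ?thesis using fib that \<open>K \<subseteq> Z\<close> by blast
  qed
  have f: "f (\<alpha> k) = \<psi> k" if "k \<in> K" for k
  proof -
    have "(SOME k'. k' \<in> K \<and> \<alpha> k' = \<alpha> k) \<in> K \<and> \<alpha> (SOME k'. k' \<in> K \<and> \<alpha> k' = \<alpha> k) = \<alpha> k"
      by (rule someI_ex) (use that in blast)
    then show ?thesis unfolding f_def using \<alpha>eq that by blast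
  qed
  have A_all: "(\<forall>a\<in>carrier A. P a) \<longleftrightarrow> (\<forall>k\<in>K. P (\<alpha> k))" for P unfolding \<alpha>(2)[symmetric] by blast
  have f_lin: "linear_on R A N (carrier A) f"
    unfolding linear_on_def Pi_iff A_all
    using f \<alpha>D(2)[symmetric] \<alpha>D(3)[symmetric] KD \<open>K \<subseteq> Z\<close> ND by (auto simp: subset_iff)
  define g where "g n = \<gamma> (SOME z. z \<in> Z \<and> \<psi> z = n)" for n
  have g: "g (\<psi> z) = \<gamma> z" if "z \<in> Z" for z
  proof -
    have *: "(SOME k'. k' \<in> Z \<and> \<psi> k' = \<psi> z) \<in> Z \<and> \<psi> (SOME k'. k' \<in> Z \<and> \<psi> k' = \<psi> z) = \<psi> z"
      by (rule someI_ex) (use that in blast)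
    then show ?thesis unfolding g_def using fib sK that \<open>B \<subseteq> K\<close> by blast
  qed
  have N_all: "(\<forall>a\<in>carrier N. P a) \<longleftrightarrow> (\<forall>k\<in>Z. P (\<psi> k))" for P unfolding N(3)[symmetric] by blast
  have g_lin: "linear_on R N C (carrier N) g"
    unfolding linear_on_def Pi_iff N_all
    using g ND(2)[symmetric] ND(3)[symmetric] ZD \<gamma>D by auto
  have "N \<in> S"
  proof (rule S_ext[OF A C N(1) restrict_module_hom[OF A.module_axioms f_lin]
        restrict_module_hom[OF N(1) g_lin]])
    show "inj_on (restrict f (carrier A)) (carrier A)"
      unfolding inj_on_def A_all using \<alpha>eq f \<alpha>D(1) by simp
    have "f ` carrier A = \<psi> ` K" using f \<alpha>(2) by (metis (no_types, lifting) image_cong image_image)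
    moreover have "{x \<in> carrier N. g x = \<zero>\<^bsub>C\<^esub>} = \<psi> ` K"
      unfolding N(3)[symmetric] using g \<gamma>B \<open>K \<subseteq> Z\<close> by (auto simp: subset_iff)
    ultimately show "restrict f (carrier A) ` carrier A = a_kernel N C (restrict g (carrier N))"
      by (auto simp: a_kernel_def')
    show "restrict g (carrier N) ` carrier N = carrier C"
      using N(3) g \<gamma>(2) by (metis (no_types, lifting) image_cong image_image image_restrict_eq)
  qed
  then show ?thesis unfolding subquotient_in_def using N by blast
qed

text \<open>A Serre class is nonempty, and cutting a member down to its zero submodule produces a
  zero module in the class.\<close>

lemma subquotient_refl:
  assumes M: "module R M" and Z: "submodule Z R M"
  shows "subquotient_in R S M Z Z"
proof -
  obtain N where N: "N \<in> S" using serre[unfolded serre_class_def, THEN conjunct1] by blast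
  interpret N: module R N using S_module[OF N] .
  have "linear_on R M (N\<lparr>carrier := {\<zero>\<^bsub>N\<^esub>}\<rparr>) Z (\<lambda>_. \<zero>\<^bsub>N\<^esub>)"
    by (rule linear_onI) auto
  moreover have "Z \<noteq> {}" using module.submoduleE(2)[OF M Z] .
  ultimately show ?thesis unfolding subquotient_in_def
    by (intro bexI[OF _ S_submodule[OF N N.submodule_zero]] exI[of _ "\<lambda>_. \<zero>\<^bsub>N\<^esub>"]) auto
qed

end

section \<open>Subquotients compared with modules of cosets\<close>

lemma (in module) submodule_restrict:
  assumes "submodule B R M" "submodule Z R M" "B \<subseteq> Z"
  shows "submodule B R (M\<lparr>carrier := Z\<rparr>)"
proof -
  interpret Z: module R "M\<lparr>carrier := Z\<rparr>"
    by (rule submodule.submodule_is_module[OF assms(2) module_axioms])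
  show ?thesis
    by (rule Z.submodule_criterion) (use assms submoduleD[OF assms(1)] in auto)
qed

lemma linear_on_carrier_update [simp]:
  "linear_on R (M\<lparr>carrier := X\<rparr>) N Z f \<longleftrightarrow> linear_on R M N Z f"
  by (simp add: linear_on_def)

lemma subquotient_in_carrier_update [simp]:
  "subquotient_in R S (M\<lparr>carrier := X\<rparr>) Z B \<longleftrightarrow> subquotient_in R S M Z B"
  by (simp add: subquotient_in_def)

lemma quotient_module_projection:
  fixes M :: "('r, 'm) module"
  assumes M: "module R M" and B: "submodule B R M"
  shows "linear_on R M (quotient_module M B) (carrier M) (\<lambda>x. B +>\<^bsub>M\<^esub> x)"
    and "(\<lambda>x. B +>\<^bsub>M\<^esub> x) ` carrier M = carrier (quotient_module M B)"
    and "\<And>x y. \<lbrakk>x \<in> carrier M; y \<in> carrier M\<rbrakk> \<Longrightarrow> B +>\<^bsub>M\<^esub> x = B +>\<^bsub>M\<^esub> y \<longleftrightarrow> x \<ominus>\<^bsub>M\<^esub> y \<in> B"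
    and "\<And>x. x \<in> carrier M \<Longrightarrow> B +>\<^bsub>M\<^esub> x = \<zero>\<^bsub>quotient_module M B\<^esub> \<longleftrightarrow> x \<in> B"
    and "module R (quotient_module M B)"
proof -
  interpret M: module R M by fact
  note BD = M.submoduleD[OF B]
  let ?Q = "quotient_module M B"
  have "additive_subgroup B M"
    by (rule additive_subgroup.intro[OF submodule.axioms(1)[OF B]])
  then interpret B: abelian_subgroup B M
    by (rule abelian_subgroupI3[OF _ M.abelian_group_axioms])
  have rm: "x' \<in> B +>\<^bsub>M\<^esub> x \<longleftrightarrow> x' \<ominus>\<^bsub>M\<^esub> x \<in> B" if "x \<in> carrier M" "x' \<in> carrier M" for x x'
    using B.a_rcos_module[OF that] by (simp add: a_minus_def)
  show eq: "B +>\<^bsub>M\<^esub> x = B +>\<^bsub>M\<^esub> y \<longleftrightarrow> x \<ominus>\<^bsub>M\<^esub> y \<in> B" if "x \<in> carrier M" "y \<in> carrier M" for x y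
  proof
    assume "B +>\<^bsub>M\<^esub> x = B +>\<^bsub>M\<^esub> y"
    then show "x \<ominus>\<^bsub>M\<^esub> y \<in> B"
      using B.a_rcos_self[OF that(1)] rm[OF that(2,1)] by simp
  next
    assume "x \<ominus>\<^bsub>M\<^esub> y \<in> B"
    then have "x \<in> B +>\<^bsub>M\<^esub> y" using rm[OF that(2,1)] by simp
    then show "B +>\<^bsub>M\<^esub> x = B +>\<^bsub>M\<^esub> y"
      using B.a_repr_independence'[OF _ that(2)] by simp
  qed
  show im: "(\<lambda>x. B +>\<^bsub>M\<^esub> x) ` carrier M = carrier ?Q"
    by (auto simp: quotient_module_def A_RCOSETS_def')
  have add: "B +>\<^bsub>M\<^esub> (x \<oplus>\<^bsub>M\<^esub> y) = (B +>\<^bsub>M\<^esub> x) \<oplus>\<^bsub>?Q\<^esub> (B +>\<^bsub>M\<^esub> y)"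
    if "x \<in> carrier M" "y \<in> carrier M" for x y
    using that by (simp add: quotient_module_def B.a_rcos_sum)
  have sm: "B +>\<^bsub>M\<^esub> (r \<odot>\<^bsub>M\<^esub> x) = r \<odot>\<^bsub>?Q\<^esub> (B +>\<^bsub>M\<^esub> x)"
    if r: "r \<in> carrier R" and x: "x \<in> carrier M" for r x
  proof -
    have *: "B +>\<^bsub>M\<^esub> (r \<odot>\<^bsub>M\<^esub> y) = B +>\<^bsub>M\<^esub> (r \<odot>\<^bsub>M\<^esub> x)" if "y \<in> B +>\<^bsub>M\<^esub> x" for y
    proof -
      have y: "y \<in> carrier M" by (rule B.a_elemrcos_carrier[OF x that])
      then have "y \<ominus>\<^bsub>M\<^esub> x \<in> B" using that rm[OF x y] by simp
      then show ?thesis using eq[of "r \<odot>\<^bsub>M\<^esub> y" "r \<odot>\<^bsub>M\<^esub> x"] r x y BD(6)[OF r, of "y \<ominus>\<^bsub>M\<^esub> x"]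
        by (simp add: M.smult_r_diff)
    qed
    have "x \<in> B +>\<^bsub>M\<^esub> x" by (rule B.a_rcos_self[OF x])
    then have "(\<Union>y\<in>B +>\<^bsub>M\<^esub> x. B +>\<^bsub>M\<^esub> (r \<odot>\<^bsub>M\<^esub> y)) = B +>\<^bsub>M\<^esub> (r \<odot>\<^bsub>M\<^esub> x)"
      using * by blast
    then show ?thesis by (simp add: quotient_module_def)
  qed
  have z: "B +>\<^bsub>M\<^esub> \<zero>\<^bsub>M\<^esub> = \<zero>\<^bsub>?Q\<^esub>"
    using B.a_subset by (simp add: quotient_module_def M.a_coset_add_zero)
  show "module R ?Q"
    by (rule epimorphic_image_module[OF M im z add sm])
  show "linear_on R M ?Q (carrier M) (\<lambda>x. B +>\<^bsub>M\<^esub> x)"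
    by (rule linear_onI) (use im add sm in auto)
  show "B +>\<^bsub>M\<^esub> x = \<zero>\<^bsub>?Q\<^esub> \<longleftrightarrow> x \<in> B" if "x \<in> carrier M" for x
    using eq[of x "\<zero>\<^bsub>M\<^esub>"] that z by (simp add: M.diff_zero)
qed

lemma linear_on_relation:
  assumes "linear_on R M N Z f" "Z = carrier M"
  shows "linear_relation R M N (\<lambda>x y. y = f x)" "linear_relation R N M (\<lambda>y x. y = f x)"
  using linear_onD[OF assms(1)] assms(2) by (auto intro!: linear_relationI)

context serre
begin

text \<open>This is \<open>subquotient_embed\<close> applied to the relation and to its
  converse.\<close>

lemma subquotient_iso:
  assumes M: "module R M" and M': "module R M'"
    and Z: "submodule Z R M" and Z': "submodule Z' R M'"
    and \<rho>: "linear_relation R M M' \<rho>"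
    and tot: "\<And>z. z \<in> Z \<Longrightarrow> \<exists>y\<in>Z'. \<rho> z y" and tot': "\<And>y. y \<in> Z' \<Longrightarrow> \<exists>z\<in>Z. \<rho> z y"
    and ker: "\<And>z y. \<lbrakk>z \<in> Z; y \<in> Z'; \<rho> z y\<rbrakk> \<Longrightarrow> y \<in> B' \<longleftrightarrow> z \<in> B"
    and "\<zero>\<^bsub>M\<^esub> \<in> B" "\<zero>\<^bsub>M'\<^esub> \<in> B'"
  shows "subquotient_in R S M Z B \<longleftrightarrow> subquotient_in R S M' Z' B'"
proof
  have \<rho>': "linear_relation R M' M (\<lambda>y x. \<rho> x y)"
    using \<rho> unfolding linear_relation_def by blast
  show "subquotient_in R S M Z B" if "subquotient_in R S M' Z' B'"
    using subquotient_embed[OF M M' Z Z' \<rho> tot ker _ that] assms(9) by blast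
  show "subquotient_in R S M' Z' B'" if "subquotient_in R S M Z B"
    using subquotient_embed[OF M' M Z' Z \<rho>' tot' _ _ that, of B'] ker assms(10) by blast
qed

text \<open>When only 0 is divided out, the epimorphism in \<open>subquotient_in\<close> is
  injective, hence an isomorphism.\<close>

lemma belongs_to_iff:
  assumes M: "module R M"
  shows "belongs_to R M S \<longleftrightarrow> subquotient_in R S M (carrier M) {\<zero>\<^bsub>M\<^esub>}"
proof
  interpret M: module R M by fact
  assume "belongs_to R M S"
  then obtain N f where N: "N \<in> S" and f: "f \<in> module_hom R M N" "bij_betw f (carrier M) (carrier N)"
    unfolding belongs_to_def module_isomorphic_def by blast
  note lin = module_homD(5)[OF f(1)]
  have "f \<zero>\<^bsub>M\<^esub> = \<zero>\<^bsub>N\<^esub>"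
    by (rule linear_on_zero[OF M S_module[OF N] M.carrier_is_submodule lin])
  then have "f x = \<zero>\<^bsub>N\<^esub> \<longleftrightarrow> x = \<zero>\<^bsub>M\<^esub>" if "x \<in> carrier M" for x
    using f(2) that inj_onD[of f "carrier M" x "\<zero>\<^bsub>M\<^esub>"] by (auto simp: bij_betw_def)
  then show "subquotient_in R S M (carrier M) {\<zero>\<^bsub>M\<^esub>}"
    unfolding subquotient_in_def using N lin f(2) by (auto simp: bij_betw_def)
next
  interpret M: module R M by fact
  assume "subquotient_in R S M (carrier M) {\<zero>\<^bsub>M\<^esub>}"
  then obtain N \<phi> where N: "N \<in> S" and \<phi>: "linear_on R M N (carrier M) \<phi>" "\<phi> ` carrier M = carrier N"
    and \<phi>0: "\<And>x. x \<in> carrier M \<Longrightarrow> \<phi> x = \<zero>\<^bsub>N\<^esub> \<longleftrightarrow> x = \<zero>\<^bsub>M\<^esub>"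
    unfolding subquotient_in_def by auto
  interpret N: module R N using S_module[OF N] .
  have "inj_on \<phi> (carrier M)"
  proof (rule inj_onI)
    fix x y assume xy: "x \<in> carrier M" "y \<in> carrier M" "\<phi> x = \<phi> y"
    then have "\<phi> (x \<ominus>\<^bsub>M\<^esub> y) = \<zero>\<^bsub>N\<^esub>"
      using linear_on_diff[OF M N.module_axioms M.carrier_is_submodule \<phi>(1), of x y]
        linear_onD(1)[OF \<phi>(1), of y] N.diff_eq_zero_iff by simp
    then show "x = y" using \<phi>0[of "x \<ominus>\<^bsub>M\<^esub> y"] xy M.diff_eq_zero_iff by simp
  qed
  then have "bij_betw (restrict \<phi> (carrier M)) (carrier M) (carrier N)"
    using \<phi>(2) by (simp add: bij_betw_def inj_on_def)
  then show "belongs_to R M S"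
    unfolding belongs_to_def module_isomorphic_def
    using N restrict_module_hom[OF M \<phi>(1)] by blast
qed

lemma belongs_to_quotient_module:
  fixes M :: "('r, 'm) module"
  assumes M: "module R M" and B: "submodule B R M"
  shows "belongs_to R (quotient_module M B) S \<longleftrightarrow> subquotient_in R S M (carrier M) B"
proof -
  note Q = quotient_module_projection[OF M B]
  interpret M: module R M by fact
  interpret Q: module R "quotient_module M B" by (rule Q(5))
  have "subquotient_in R S M (carrier M) B \<longleftrightarrow>
    subquotient_in R S (quotient_module M B) (carrier (quotient_module M B)) {\<zero>\<^bsub>quotient_module M B\<^esub>}"
  proof (rule subquotient_iso[OF M Q.module_axioms M.carrier_is_submodule Q.carrier_is_submodule
        linear_on_relation(1)[OF Q(1) refl]])
    show "\<exists>z\<in>carrier M. y = B +>\<^bsub>M\<^esub> z" if "y \<in> carrier (quotient_module M B)" for y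
      using that unfolding Q(2)[symmetric] by blast
  qed (use Q(4) linear_onD(1)[OF Q(1)] M.submoduleD[OF B] in auto)
  then show ?thesis by (simp add: belongs_to_iff[OF Q.module_axioms])
qed

text \<open>This is the shape in which \<open>cohomology\<close> presents its modules: cocycles as
  an updated carrier, coboundaries divided out by cosets.\<close>

lemma belongs_to_subquotient:
  fixes M :: "('r, 'm) module"
  assumes M: "module R M" and Z: "submodule Z R M" and B: "submodule B R M" "B \<subseteq> Z"
  shows "belongs_to R (quotient_module (M\<lparr>carrier := Z\<rparr>) B) S \<longleftrightarrow> subquotient_in R S M Z B"
  using belongs_to_quotient_module[OF submodule.submodule_is_module[OF Z M]
      module.submodule_restrict[OF M B(1) Z B(2)]] by simp

end

section \<open>Linear systems and free resolutions\<close>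

text \<open>Coefficients and vectors are total functions on \<open>nat\<close> of which only the
  first \<open>n\<close> entries count, so that one type serves vectors of every length and matrices
  of every size.\<close>

primrec lincomb :: "('r, 'm, 'c) module_scheme \<Rightarrow> nat \<Rightarrow> (nat \<Rightarrow> 'r) \<Rightarrow> (nat \<Rightarrow> 'm) \<Rightarrow> 'm" where
  "lincomb M 0 a x = \<zero>\<^bsub>M\<^esub>"
| "lincomb M (Suc n) a x = lincomb M n a x \<oplus>\<^bsub>M\<^esub> a n \<odot>\<^bsub>M\<^esub> x n"

lemma lincomb_cong:
  "(\<And>i. i < n \<Longrightarrow> a i = a' i) \<Longrightarrow> (\<And>i. i < n \<Longrightarrow> x i = x' i) \<Longrightarrow> lincomb M n a x = lincomb M n a' x'"
  by (induction n) auto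

lemma lincomb_in_submodule:
  assumes "module R M" "submodule H R M" "\<And>i. a i \<in> carrier R" "\<And>i. x i \<in> H"
  shows "lincomb M n a x \<in> H"
  using module.submoduleD[OF assms(1,2)] assms(3,4) by (induction n) auto

lemma (in cring) module_regular: "module R (regular_module R)"
proof (rule moduleI)
  show "abelian_group (regular_module R)"
  proof (rule abelian_groupI)
    fix x assume "x \<in> carrier (regular_module R)"
    then show "\<exists>y\<in>carrier (regular_module R). y \<oplus>\<^bsub>regular_module R\<^esub> x = \<zero>\<^bsub>regular_module R\<^esub>"
      by (intro bexI[of _ "\<ominus> x"]) (auto simp: regular_module_def l_neg)
  qed (auto simp: regular_module_def a_ac)
qed (auto simp: regular_module_def is_cring l_distr r_distr m_assoc)

lemma regular_module_simps:
  "carrier (regular_module R) = carrier R" "\<zero>\<^bsub>regular_module R\<^esub> = \<zero>\<^bsub>R\<^esub>"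
  "x \<oplus>\<^bsub>regular_module R\<^esub> y = x \<oplus>\<^bsub>R\<^esub> y" "x \<odot>\<^bsub>regular_module R\<^esub> y = x \<otimes>\<^bsub>R\<^esub> y"
  by (simp_all add: regular_module_def)

lemma (in cring) regular_module_minus:
  assumes "x \<in> carrier R" "y \<in> carrier R"
  shows "\<ominus>\<^bsub>regular_module R\<^esub> x = \<ominus> x" "y \<ominus>\<^bsub>regular_module R\<^esub> x = y \<ominus> x"
proof -
  interpret RR: module R "regular_module R" by (rule module_regular)
  show "\<ominus>\<^bsub>regular_module R\<^esub> x = \<ominus> x"
    using RR.minus_equality[of "\<ominus> x" x] assms by (simp add: regular_module_simps l_neg)
  then show "y \<ominus>\<^bsub>regular_module R\<^esub> x = y \<ominus> x"
    by (simp add: a_minus_def regular_module_simps)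
qed

section \<open>Calculus of linear combinations\<close>

context module
begin

lemma lincomb_closed:
  "(\<And>i. a i \<in> carrier R) \<Longrightarrow> (\<And>i. x i \<in> carrier M) \<Longrightarrow> lincomb M n a x \<in> carrier M"
  by (induction n) auto

lemma lincomb_add:
  "(\<And>i. a i \<in> carrier R) \<Longrightarrow> (\<And>i. x i \<in> carrier M) \<Longrightarrow> (\<And>i. y i \<in> carrier M) \<Longrightarrow>
   lincomb M n a (\<lambda>i. x i \<oplus>\<^bsub>M\<^esub> y i) = lincomb M n a x \<oplus>\<^bsub>M\<^esub> lincomb M n a y"
  by (induction n) (simp_all add: smult_r_distr lincomb_closed M.a_ac)

lemma lincomb_add_left:
  "(\<And>i. a i \<in> carrier R) \<Longrightarrow> (\<And>i. b i \<in> carrier R) \<Longrightarrow> (\<And>i. x i \<in> carrier M) \<Longrightarrow>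
   lincomb M n (\<lambda>i. a i \<oplus> b i) x = lincomb M n a x \<oplus>\<^bsub>M\<^esub> lincomb M n b x"
  by (induction n) (simp_all add: smult_l_distr lincomb_closed M.a_ac)

lemma lincomb_smult:
  "r \<in> carrier R \<Longrightarrow> (\<And>i. a i \<in> carrier R) \<Longrightarrow> (\<And>i. x i \<in> carrier M) \<Longrightarrow>
   lincomb M n a (\<lambda>i. r \<odot>\<^bsub>M\<^esub> x i) = r \<odot>\<^bsub>M\<^esub> lincomb M n a x"
  by (induction n) (simp_all add: smult_r_distr lincomb_closed smult_assoc1[symmetric] R.m_comm)

lemma lincomb_smult_left:
  "r \<in> carrier R \<Longrightarrow> (\<And>i. a i \<in> carrier R) \<Longrightarrow> (\<And>i. x i \<in> carrier M) \<Longrightarrow>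
   lincomb M n (\<lambda>i. r \<otimes> a i) x = r \<odot>\<^bsub>M\<^esub> lincomb M n a x"
  by (induction n) (simp_all add: smult_r_distr lincomb_closed smult_assoc1)

lemma lincomb_diff:
  "(\<And>i. a i \<in> carrier R) \<Longrightarrow> (\<And>i. x i \<in> carrier M) \<Longrightarrow> (\<And>i. y i \<in> carrier M) \<Longrightarrow>
   lincomb M n a (\<lambda>i. x i \<ominus>\<^bsub>M\<^esub> y i) = lincomb M n a x \<ominus>\<^bsub>M\<^esub> lincomb M n a y"
  by (induction n) (simp_all add: smult_r_diff lincomb_closed M.add_diff_add M.diff_zero)

lemma lincomb_zero: "(\<And>i. a i \<in> carrier R) \<Longrightarrow> lincomb M n a (\<lambda>i. \<zero>\<^bsub>M\<^esub>) = \<zero>\<^bsub>M\<^esub>"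
  by (induction n) auto

lemma lincomb_zero_left:
  "(\<And>i. i < n \<Longrightarrow> a i = \<zero>) \<Longrightarrow> (\<And>i. x i \<in> carrier M) \<Longrightarrow> lincomb M n a x = \<zero>\<^bsub>M\<^esub>"
  by (induction n) auto

lemma lincomb_unit:
  "(\<And>i. x i \<in> carrier M) \<Longrightarrow> lincomb M n (\<lambda>i. if i = k then \<one> else \<zero>) x = (if k < n then x k else \<zero>\<^bsub>M\<^esub>)"
  by (induction n) (auto simp: less_Suc_eq)

lemma lincomb_append:
  assumes "\<And>i. c i \<in> carrier R" "\<And>i. c' i \<in> carrier R" "\<And>i. x i \<in> carrier M" "\<And>i. x' i \<in> carrier M"
  shows "lincomb M (n + n') (\<lambda>k. if k < n then c k else c' (k - n)) (\<lambda>k. if k < n then x k else x' (k - n))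
    = lincomb M n c x \<oplus>\<^bsub>M\<^esub> lincomb M n' c' x'"
proof (induction n')
  case 0
  have "lincomb M n (\<lambda>k. if k < n then c k else c' (k - n)) (\<lambda>k. if k < n then x k else x' (k - n))
    = lincomb M n c x" by (rule lincomb_cong) auto
  then show ?case using assms by (simp add: lincomb_closed)
next
  case (Suc n')
  then show ?case using assms by (simp add: lincomb_closed M.a_assoc)
qed

lemma lincomb_smult_vector:
  assumes "\<And>i. a i \<in> carrier R" "\<And>i. c i \<in> carrier R" "y \<in> carrier M"
  shows "lincomb M n a (\<lambda>i. c i \<odot>\<^bsub>M\<^esub> y) = lincomb (regular_module R) n a c \<odot>\<^bsub>M\<^esub> y"
proof (induction n)
  case (Suc n)
  interpret RR: module R "regular_module R" by (rule R.module_regular)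
  have "lincomb (regular_module R) n a c \<in> carrier R"
    using RR.lincomb_closed[of a c n] assms by (simp add: regular_module_simps)
  then show ?case using Suc assms by (simp add: regular_module_simps smult_l_distr smult_assoc1)
qed (use assms in \<open>simp add: regular_module_simps\<close>)

text \<open>Associativity v(Ay) = (vA)y of matrix products, for a row \<open>v\<close>, a matrix
  \<open>A\<close> and a column \<open>y\<close> with entries in the module.\<close>

lemma lincomb_exchange:
  assumes "\<And>i. v i \<in> carrier R" "\<And>i l. A i l \<in> carrier R" "\<And>l. y l \<in> carrier M"
  shows "lincomb M m v (\<lambda>i. lincomb M n (A i) y) =
    lincomb M n (\<lambda>l. lincomb (regular_module R) m v (\<lambda>i. A i l)) y"
proof (induction n)
  case 0
  then show ?case using assms by (simp add: lincomb_zero)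
next
  case (Suc n)
  then show ?case using assms
    by (simp add: lincomb_add lincomb_closed lincomb_smult_vector)
qed

end

lemma lincomb_linear_on:
  assumes M: "module R M" and "module R N" "submodule Z R M" "linear_on R M N Z f"
    and "\<And>i. a i \<in> carrier R" "\<And>i. x i \<in> Z"
  shows "f (lincomb M n a x) = lincomb N n a (\<lambda>i. f (x i))"
proof (induction n)
  case 0
  then show ?case using linear_on_zero[OF assms(1-4)] by simp
next
  case (Suc n)
  then show ?case
    using linear_onD[OF assms(4)] assms(5,6) lincomb_in_submodule[OF M assms(3), of a x]
      module.submoduleD[OF M assms(3)] by simp
qed

text \<open>Infinite sequences stand in for the finite powers of \<open>M\<close> of all lengths at
  once, since a type cannot depend on the length; the surplus entries are ignored or divided
  out.\<close>

definition sequence_module :: "('r, 'm, 'c) module_scheme \<Rightarrow> ('r, nat \<Rightarrow> 'm) module" where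
  "sequence_module M =
    \<lparr>carrier = {x. \<forall>i. x i \<in> carrier M}, monoid.mult = undefined, one = undefined,
     ring.zero = (\<lambda>i. \<zero>\<^bsub>M\<^esub>), ring.add = (\<lambda>x y i. x i \<oplus>\<^bsub>M\<^esub> y i), smult = (\<lambda>r x i. r \<odot>\<^bsub>M\<^esub> x i)\<rparr>"

lemma sequence_module_simps [simp]:
  "x \<in> carrier (sequence_module M) \<longleftrightarrow> (\<forall>i. x i \<in> carrier M)"
  "\<zero>\<^bsub>sequence_module M\<^esub> = (\<lambda>i. \<zero>\<^bsub>M\<^esub>)"
  "x \<oplus>\<^bsub>sequence_module M\<^esub> y = (\<lambda>i. x i \<oplus>\<^bsub>M\<^esub> y i)"
  "r \<odot>\<^bsub>sequence_module M\<^esub> x = (\<lambda>i. r \<odot>\<^bsub>M\<^esub> x i)"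
  by (simp_all add: sequence_module_def)

lemma (in module) module_sequence: "module R (sequence_module M)"
proof (rule moduleI)
  show "abelian_group (sequence_module M)"
  proof (rule abelian_groupI)
    fix x assume "x \<in> carrier (sequence_module M)"
    then show "\<exists>y\<in>carrier (sequence_module M). y \<oplus>\<^bsub>sequence_module M\<^esub> x = \<zero>\<^bsub>sequence_module M\<^esub>"
      by (intro bexI[of _ "\<lambda>i. \<ominus>\<^bsub>M\<^esub> x i"]) (auto simp: M.l_neg)
  qed (auto simp: M.a_ac)
qed (auto simp: R.is_cring smult_l_distr smult_r_distr smult_assoc1)

lemma (in module) sequence_module_diff [simp]:
  assumes "x \<in> carrier (sequence_module M)" "y \<in> carrier (sequence_module M)"
  shows "x \<ominus>\<^bsub>sequence_module M\<^esub> y = (\<lambda>i. x i \<ominus>\<^bsub>M\<^esub> y i)"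
proof -
  interpret Q: module R "sequence_module M" by (rule module_sequence)
  have "(x \<ominus>\<^bsub>sequence_module M\<^esub> y) \<oplus>\<^bsub>sequence_module M\<^esub> y = x"
    using assms by (rule Q.diff_add_cancel)
  then have "(x \<ominus>\<^bsub>sequence_module M\<^esub> y) i \<oplus>\<^bsub>M\<^esub> y i = x i" for i
    by (metis sequence_module_simps(3))
  moreover have "(x \<ominus>\<^bsub>sequence_module M\<^esub> y) i \<in> carrier M" "y i \<in> carrier M" for i
    using Q.minus_closed[OF assms] assms by simp_all
  ultimately have "(x \<ominus>\<^bsub>sequence_module M\<^esub> y) i = x i \<ominus>\<^bsub>M\<^esub> y i" for i
    using M.diff_add_cancel(3)[of "(x \<ominus>\<^bsub>sequence_module M\<^esub> y) i" "y i"] by simp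
  then show ?thesis by blast
qed

lemma lincomb_sequence:
  "lincomb (sequence_module M) n a x i = lincomb M n a (\<lambda>k. x k i)"
  by (induction n) auto

lemma (in cring) submodule_regular_iff: "submodule J R (regular_module R) \<longleftrightarrow> ideal J R"
proof
  interpret RR: module R "regular_module R" by (rule module_regular)
  show "submodule J R (regular_module R)" if "ideal J R"
  proof -
    interpret J: ideal J R by fact
    show ?thesis
      by (rule RR.submodule_criterion) (auto simp: regular_module_simps J.Icarr J.I_l_closed)
  qed
  show "ideal J R" if J: "submodule J R (regular_module R)"
  proof (rule idealI)
    note JD = RR.submoduleD[OF J, unfolded regular_module_simps]
    show "subgroup J (add_monoid R)"
    proof (rule add.subgroupI)
      show "\<ominus> a \<in> J" if "a \<in> J" for a
        using JD(5)[OF that] JD(2)[OF that] by (simp add: regular_module_minus)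
    qed (use JD in auto)
    fix a x assume "a \<in> J" "x \<in> carrier R"
    then show "x \<otimes> a \<in> J" "a \<otimes> x \<in> J" using JD(6) m_comm[OF JD(2), of a x] by auto
  qed (rule ring_axioms)
qed

text \<open>The homomorphism theorem without forming a quotient: the value at
  \<open>\<phi> z\<close> is taken from an arbitrary preimage, and \<open>ker\<close> makes the
  choice immaterial.\<close>

lemma linear_factor:
  fixes V :: "('r, 'v) module" and M :: "('r, 'm) module" and N :: "('r, 'n) module"
  assumes V: "module R V" and M: "module R M" and N: "module R N" and Z: "submodule Z R V"
    and \<phi>: "linear_on R V M Z \<phi>" and \<psi>: "linear_on R V N Z \<psi>"
    and ker: "\<And>z. \<lbrakk>z \<in> Z; \<phi> z = \<zero>\<^bsub>M\<^esub>\<rbrakk> \<Longrightarrow> \<psi> z = \<zero>\<^bsub>N\<^esub>"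
  obtains f where "linear_on R M N (\<phi> ` Z) f" "\<And>z. z \<in> Z \<Longrightarrow> f (\<phi> z) = \<psi> z"
proof -
  interpret V: module R V by fact
  interpret M: module R M by fact
  interpret N: module R N by fact
  note ZD = V.submoduleD[OF Z]
  define f where "f m = \<psi> (SOME z. z \<in> Z \<and> \<phi> z = m)" for m
  have f: "f (\<phi> z) = \<psi> z" if "z \<in> Z" for z
  proof -
    define z' where "z' = (SOME z'. z' \<in> Z \<and> \<phi> z' = \<phi> z)"
    have z': "z' \<in> Z \<and> \<phi> z' = \<phi> z" unfolding z'_def by (rule someI[of _ z]) (use that in simp)
    have "\<phi> (z' \<ominus>\<^bsub>V\<^esub> z) = \<zero>\<^bsub>M\<^esub>"
      using linear_on_diff[OF V M Z \<phi>, of z' z] z' that linear_onD(1)[OF \<phi> that] M.diff_eq_zero_iff by simp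
    then have "\<psi> z' \<ominus>\<^bsub>N\<^esub> \<psi> z = \<zero>\<^bsub>N\<^esub>"
      using ker[OF ZD(4)] linear_on_diff[OF V N Z \<psi>, of z' z] z' that by metis
    then show ?thesis
      using N.diff_eq_zero_iff linear_onD(1)[OF \<psi>] that z' by (metis f_def z'_def)
  qed
  show thesis
  proof (rule that[OF _ f])
    show "linear_on R M N (\<phi> ` Z) f"
      unfolding linear_on_def Pi_iff ball_simps
      using f ZD linear_onD[OF \<psi>] by (simp add: linear_onD(2,3)[OF \<phi>, symmetric])
  qed
qed

text \<open>Baer's criterion for the submodule \<open>U\<close>, with the extension to the whole
  ring recorded by the image \<open>e\<close> of 1. With \<open>E\<close> kept as ambient module,
  the same notion applies to an injective module and to its torsion part.\<close>

definition baer_property :: "('r, 'k) ring_scheme \<Rightarrow> ('r, 'm) module \<Rightarrow> 'm set \<Rightarrow> bool" where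
  "baer_property R E U \<longleftrightarrow>
    (\<forall>J f. submodule J R (regular_module R) \<and> linear_on R (regular_module R) E J f \<and> f ` J \<subseteq> U \<longrightarrow>
       (\<exists>e\<in>U. \<forall>r\<in>J. f r = r \<odot>\<^bsub>E\<^esub> e))"

text \<open>The inclusion of an ideal into the ring is one of the test maps in the definition of
  injectivity, since both carriers lie in the type of ring elements; \<open>e\<close> is the value
  of the extension at 1.\<close>

lemma injective_module_baer:
  assumes "injective_module R E"
  shows "baer_property R E (carrier E)"
  unfolding baer_property_def
proof (intro allI impI, elim conjE)
  fix J f
  assume J: "submodule J R (regular_module R)" and f: "linear_on R (regular_module R) E J f"
  have E: "module R E" using assms by (simp add: injective_module_def)
  interpret E: module R E by fact
  have RR: "module R (regular_module R)" by (rule E.R.module_regular)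
  interpret RR: module R "regular_module R" by (rule RR)
  let ?A = "(regular_module R)\<lparr>carrier := J\<rparr>"
  have incl: "restrict (\<lambda>x. x) J \<in> module_hom R ?A (regular_module R)"
    by (rule restrict_module_hom_submodule[OF RR J])
      (use RR.submoduleD[OF J] in \<open>auto intro!: linear_onI\<close>)
  have fhom: "restrict f J \<in> module_hom R ?A E"
    by (rule restrict_module_hom_submodule[OF RR J f])
  have ext: "\<exists>h\<in>module_hom R B E. \<forall>x\<in>carrier A. h (i x) = g x"
    if "i \<in> module_hom R A B" "g \<in> module_hom R A E" "module R A" "module R B" "inj_on i (carrier A)"
    for A B :: "('a, 'a) module" and i g
    using assms that unfolding injective_module_def by blast
  obtain h where h: "h \<in> module_hom R (regular_module R) E"
    and hf: "\<And>x. x \<in> J \<Longrightarrow> h x = f x"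
    using ext[OF incl fhom submodule.submodule_is_module[OF J RR] RR] by (auto simp: inj_on_def)
  note hD = module_homD[OF h, unfolded regular_module_simps]
  show "\<exists>e\<in>carrier E. \<forall>r\<in>J. f r = r \<odot>\<^bsub>E\<^esub> e"
  proof (intro bexI[of _ "h \<one>\<^bsub>R\<^esub>"] ballI)
    fix r assume r: "r \<in> J"
    then have "r \<in> carrier R" using RR.submoduleD(2)[OF J] by (simp add: regular_module_simps)
    then show "f r = r \<odot>\<^bsub>E\<^esub> h \<one>\<^bsub>R\<^esub>" using hD(3)[of r "\<one>\<^bsub>R\<^esub>"] hf[OF r] by simp
  qed (simp add: hD(1))
qed

text \<open>The unknowns are eliminated one at a time: the last one is supplied by Baer's property for the
  ideal of its coefficients in those combinations of the equations that contain no other unknown.\<close>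

lemma baer_linear_system:
  fixes E :: "('r, 'm) module"
  assumes E: "module R E" and U: "submodule U R E" and baer: "baer_property R E U"
    and A: "\<And>i l. A i l \<in> carrier R" and x: "\<And>i. x i \<in> U"
    and compat: "\<And>v. \<lbrakk>\<And>i. v i \<in> carrier R;
        \<And>l. l < n \<Longrightarrow> lincomb (regular_module R) m v (\<lambda>i. A i l) = \<zero>\<^bsub>R\<^esub>\<rbrakk> \<Longrightarrow> lincomb E m v x = \<zero>\<^bsub>E\<^esub>"
  shows "\<exists>y. (\<forall>l. y l \<in> U) \<and> (\<forall>i<m. x i = lincomb E n (A i) y)"
  using x compat
proof (induction n arbitrary: x)
  interpret E: module R E by fact
  note UD = E.submoduleD[OF U]
  case 0
  \<comment> \<open>Without unknowns the condition on the columns is vacuous, so the unit rows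
    already force every right-hand side to vanish.\<close>
  have "x i = \<zero>\<^bsub>E\<^esub>" if "i < m" for i
    using 0(2)[of "\<lambda>j. if j = i then \<one>\<^bsub>R\<^esub> else \<zero>\<^bsub>R\<^esub>"] E.lincomb_unit[of x m i] 0(1) UD that by auto
  then show ?case using UD by (intro exI[of _ "\<lambda>_. \<zero>\<^bsub>E\<^esub>"]) auto
next
  interpret E: module R E by fact
  note UD = E.submoduleD[OF U]
  case (Suc n)
  let ?RR = "regular_module R"
  have RR: "module R ?RR" by (rule E.R.module_regular)
  interpret RR: module R ?RR by (rule RR)
  interpret VV: module R "sequence_module ?RR" by (rule RR.module_sequence)
  note x = Suc.prems(1) and compat = Suc.prems(2)
  have xE: "x i \<in> carrier E" for i using x UD by blast
  \<comment> \<open>A row in \<open>V\<close> combines the equations so that the first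
    \<open>n\<close> unknowns cancel; \<open>\<phi>\<close> is the remaining coefficient and
    \<open>\<psi>\<close> the resulting right-hand side.\<close>
  define V where "V = {v. (\<forall>i. v i \<in> carrier R) \<and> (\<forall>l<n. lincomb ?RR m v (\<lambda>i. A i l) = \<zero>\<^bsub>R\<^esub>)}"
  define \<phi> where "\<phi> v = lincomb ?RR m v (\<lambda>i. A i n)" for v
  define \<psi> where "\<psi> v = lincomb E m v x" for v
  note RRl = RR.lincomb_add_left[unfolded regular_module_simps] RR.lincomb_smult_left[unfolded regular_module_simps]
    RR.lincomb_closed[unfolded regular_module_simps]
  have V: "submodule V R (sequence_module ?RR)"
    by (rule VV.submodule_criterion)
      (auto simp: V_def regular_module_simps RRl A RR.lincomb_zero_left[unfolded regular_module_simps])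
  have \<phi>: "linear_on R (sequence_module ?RR) ?RR V \<phi>"
    by (rule linear_onI) (auto simp: V_def \<phi>_def regular_module_simps RRl A)
  have \<psi>: "linear_on R (sequence_module ?RR) E V \<psi>"
    by (rule linear_onI)
      (auto simp: V_def \<psi>_def regular_module_simps E.lincomb_closed E.lincomb_add_left E.lincomb_smult_left xE)
  have ker: "\<psi> v = \<zero>\<^bsub>E\<^esub>" if "v \<in> V" "\<phi> v = \<zero>\<^bsub>?RR\<^esub>" for v
    using compat[of v] that by (auto simp: V_def \<phi>_def \<psi>_def less_Suc_eq regular_module_simps)
  obtain f where f: "linear_on R ?RR E (\<phi> ` V) f" "\<And>v. v \<in> V \<Longrightarrow> f (\<phi> v) = \<psi> v"
    using linear_factor[OF VV.module_axioms RR E V \<phi> \<psi> ker] by blast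
  have "\<psi> v \<in> U" if "v \<in> V" for v
    unfolding \<psi>_def by (rule lincomb_in_submodule[OF E U]) (use that x in \<open>auto simp: V_def\<close>)
  then have "f ` \<phi> ` V \<subseteq> U" using f(2) by auto
  then obtain e where e: "e \<in> U" "\<And>v. v \<in> V \<Longrightarrow> \<psi> v = \<phi> v \<odot>\<^bsub>E\<^esub> e"
    using baer linear_on_image[OF VV.module_axioms RR V \<phi>] f unfolding baer_property_def by (metis imageI)
  \<comment> \<open>These are the right-hand sides once the value \<open>e\<close> of the last
    unknown has been substituted.\<close>
  define x' where "x' i = x i \<ominus>\<^bsub>E\<^esub> A i n \<odot>\<^bsub>E\<^esub> e" for i
  have eE: "e \<in> carrier E" using e UD by blast
  have "\<exists>y. (\<forall>l. y l \<in> U) \<and> (\<forall>i<m. x' i = lincomb E n (A i) y)"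
  proof (rule Suc.IH)
    show "x' i \<in> U" for i
      using UD(4)[OF x[of i] UD(6)[OF A[of i n] e(1)]] by (simp add: x'_def)
    fix v assume v: "\<And>i. v i \<in> carrier R" "\<And>l. l < n \<Longrightarrow> lincomb ?RR m v (\<lambda>i. A i l) = \<zero>\<^bsub>R\<^esub>"
    then have vV: "v \<in> V" by (simp add: V_def)
    have "lincomb E m v x' = \<psi> v \<ominus>\<^bsub>E\<^esub> \<phi> v \<odot>\<^bsub>E\<^esub> e"
      unfolding x'_def \<psi>_def \<phi>_def
      using v A xE eE by (subst E.lincomb_diff) (auto simp: E.lincomb_smult_vector)
    then show "lincomb E m v x' = \<zero>\<^bsub>E\<^esub>"
      using e(2)[OF vV] linear_onD(1)[OF \<psi> vV] E.diff_eq_zero_iff by simp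
  qed
  then obtain y where y: "\<And>l. y l \<in> U" "\<And>i. i < m \<Longrightarrow> x' i = lincomb E n (A i) y" by blast
  define y' where "y' l = (if l = n then e else y l)" for l
  have "x i = lincomb E (Suc n) (A i) y'" if "i < m" for i
  proof -
    have "lincomb E (Suc n) (A i) y' = x' i \<oplus>\<^bsub>E\<^esub> A i n \<odot>\<^bsub>E\<^esub> e"
      using y(2)[OF that] lincomb_cong[of n "A i" "A i" y' y E] by (simp add: y'_def)
    then show ?thesis using xE A eE by (simp add: x'_def E.diff_add_cancel)
  qed
  moreover have "y' l \<in> U" for l using y(1) e(1) by (simp add: y'_def)
  ultimately show ?case by blast
qed

section \<open>Finite generation over a Noetherian ring\<close>

locale noetherian_cring = noetherian_ring R + cring R for R :: "('r, 'k) ring_scheme" (structure)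
begin

abbreviation RR :: "('r, 'r) module" where "RR \<equiv> regular_module R"

text \<open>A finite generating set is enumerated and continued by 0. Its linear combinations form
  an ideal \<open>H\<close> containing it, hence containing all of \<open>J\<close>.\<close>

lemma ideal_finitely_generated:
  assumes "submodule J R RR"
  shows "\<exists>n g. (\<forall>k. g k \<in> J) \<and> (\<forall>x\<in>J. \<exists>c. (\<forall>k. c k \<in> carrier R) \<and> x = lincomb RR n c g)"
proof -
  interpret RR: module R RR by (rule module_regular)
  interpret VV: module R "sequence_module RR" by (rule RR.module_sequence)
  have J: "ideal J R" using assms by (simp add: submodule_regular_iff)
  obtain A where A: "A \<subseteq> carrier R" "finite A" "J = Idl A" using finetely_gen[OF J] by blast
  obtain h where h: "bij_betw h {0..<card A} A"
    using ex_bij_betw_nat_finite[OF A(2)] by blast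
  define g where "g k = (if k < card A then h k else \<zero>)" for k
  have AJ: "A \<subseteq> J" using genideal_self[OF A(1)] A(3) by simp
  have gJ: "g k \<in> J" for k
    using h AJ RR.submoduleD(1)[OF assms] by (auto simp: g_def bij_betw_def regular_module_simps)
  then have gR: "g k \<in> carrier R" for k
    using RR.submoduleD(2)[OF assms] by (auto simp: regular_module_simps)
  define H where "H = (\<lambda>c. lincomb RR (card A) c g) ` carrier (sequence_module RR)"
  have lin: "linear_on R (sequence_module RR) RR (carrier (sequence_module RR)) (\<lambda>c. lincomb RR (card A) c g)"
    by (rule linear_onI)
      (auto simp: regular_module_simps RR.lincomb_add_left[unfolded regular_module_simps]
        RR.lincomb_smult_left[unfolded regular_module_simps] RR.lincomb_closed[unfolded regular_module_simps] gR)
  have H: "ideal H R"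
    unfolding submodule_regular_iff[symmetric] H_def
    by (rule linear_on_image[OF VV.module_axioms RR.module_axioms VV.carrier_is_submodule lin])
  have "A \<subseteq> H"
  proof
    fix a assume "a \<in> A"
    then obtain k where k: "k < card A" "h k = a" using h unfolding bij_betw_def by (metis imageE atLeastLessThan_iff)
    then have "a = lincomb RR (card A) (\<lambda>i. if i = k then \<one> else \<zero>) g"
      using RR.lincomb_unit[of g "card A" k] gR by (simp add: g_def regular_module_simps)
    then show "a \<in> H" unfolding H_def by (intro image_eqI) (auto simp: regular_module_simps)
  qed
  then have "J \<subseteq> H" using genideal_minimal[OF H] A(3) by simp
  show ?thesis
  proof (rule exI[of _ "card A"], rule exI[of _ g], intro conjI allI ballI)
    show "g k \<in> J" for k by (rule gJ)
    fix x assume "x \<in> J"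
    then have "x \<in> H" using \<open>J \<subseteq> H\<close> by blast
    then obtain c where "x = lincomb RR (card A) c g" "c \<in> carrier (sequence_module RR)"
      unfolding H_def by (rule imageE)
    then show "\<exists>c. (\<forall>k. c k \<in> carrier R) \<and> x = lincomb RR (card A) c g"
      by (auto simp: regular_module_simps)
  qed
qed

text \<open>Induction on the number of coordinates: the last coordinates of \<open>K\<close> form an
  ideal, and elements with last coordinate 0 fall under the induction hypothesis. Generation is
  claimed only for the truncations to \<open>m\<close> entries, since \<open>K\<close> lies in an
  infinite product.\<close>

lemma sequence_submodule_finitely_generated:
  assumes "submodule K R (sequence_module RR)"
  shows "\<exists>n w. (\<forall>k. w k \<in> K) \<and>
    (\<forall>v\<in>K. \<exists>c. (\<forall>k. c k \<in> carrier R) \<and> (\<forall>i<m. v i = lincomb RR n c (\<lambda>k. w k i)))"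
  using assms
proof (induction m arbitrary: K)
  interpret RR: module R RR by (rule module_regular)
  interpret VV: module R "sequence_module RR" by (rule RR.module_sequence)
  case 0
  note KD = VV.submoduleD[OF 0]
  show ?case using KD(1) by (intro exI[of _ 0] exI[of _ "\<lambda>_. \<zero>\<^bsub>sequence_module RR\<^esub>"]) auto
next
  interpret RR: module R RR by (rule module_regular)
  interpret VV: module R "sequence_module RR" by (rule RR.module_sequence)
  case (Suc m)
  note K = Suc.prems and KD = VV.submoduleD[OF Suc.prems]
  have KR: "v i \<in> carrier R" if "v \<in> K" for v i using KD(2)[OF that] by (simp add: regular_module_simps)
  have lin: "linear_on R (sequence_module RR) RR K (\<lambda>v. v m)"
    by (rule linear_onI) (auto simp: KR regular_module_simps)
  define K' where "K' = {v \<in> K. v m = \<zero>}"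
  have K': "submodule K' R (sequence_module RR)"
    using linear_on_kernel[OF VV.module_axioms RR.module_axioms K lin]
    by (simp add: K'_def regular_module_simps)
  obtain n' w' where w': "\<And>k. w' k \<in> K'" and gen': "\<And>v. v \<in> K' \<Longrightarrow>
      \<exists>c. (\<forall>k. c k \<in> carrier R) \<and> (\<forall>i<m. v i = lincomb RR n' c (\<lambda>k. w' k i))"
    using Suc.IH[OF K'] by blast
  define I where "I = (\<lambda>v. v m) ` K"
  have I: "submodule I R RR"
    unfolding I_def
    by (rule linear_on_image[OF VV.module_axioms RR.module_axioms K lin])
  obtain g n where g: "\<And>k. g k \<in> I"
    and gen: "\<And>x. x \<in> I \<Longrightarrow> \<exists>c. (\<forall>k. c k \<in> carrier R) \<and> x = lincomb RR n c g"
    using ideal_finitely_generated[OF I] by blast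
  have "\<forall>k. \<exists>u. u \<in> K \<and> g k = u m" using g by (auto simp: I_def)
  then obtain u where u: "\<And>k. u k \<in> K" "\<And>k. g k = u k m" by metis
  define w where "w k = (if k < n then u k else w' (k - n))" for k
  have w'K: "w' k \<in> K" "w' k m = \<zero>" for k using w'[of k] by (auto simp: K'_def)
  have "\<exists>c. (\<forall>k. c k \<in> carrier R) \<and> (\<forall>i<Suc m. v i = lincomb RR (n + n') c (\<lambda>k. w k i))"
    if v: "v \<in> K" for v
  proof -
    have "v m \<in> I" using v by (simp add: I_def)
    from gen[OF this] obtain c where c: "\<And>k. c k \<in> carrier R" "v m = lincomb RR n c g" by blast
    \<comment> \<open>\<open>z\<close> agrees with \<open>v\<close> in the last coordinate, so that
      their difference lies in \<open>K'\<close>.\<close>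
    define z where "z = lincomb (sequence_module RR) n c u"
    have zK: "z \<in> K" unfolding z_def by (rule lincomb_in_submodule[OF VV.module_axioms K c(1) u(1)])
    have zi: "z i = lincomb RR n c (\<lambda>k. u k i)" for i by (simp add: z_def lincomb_sequence)
    have vz: "v \<ominus>\<^bsub>sequence_module RR\<^esub> z = (\<lambda>i. v i \<ominus> z i)"
      using KD(2)[OF v] KD(2)[OF zK] KR[OF v] KR[OF zK] by (simp add: regular_module_minus)
    have vzm: "v m = z m" using c(2) zi[of m] u(2) by (metis lincomb_cong)
    have "(\<lambda>i. v i \<ominus> z i) \<in> K"
      using KD(4)[OF v zK] vz by simp
    then have "(\<lambda>i. v i \<ominus> z i) \<in> K'"
      unfolding K'_def using vzm KR[OF zK, of m] by (simp add: a_minus_def r_neg)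
    then obtain c' where c': "\<And>k. c' k \<in> carrier R"
      "\<And>i. i < m \<Longrightarrow> v i \<ominus> z i = lincomb RR n' c' (\<lambda>k. w' k i)" using gen' by blast
    have c'm: "v i \<ominus> z i = lincomb RR n' c' (\<lambda>k. w' k i)" if "i < Suc m" for i
    proof (cases "i = m")
      case True
      have "lincomb RR n' c' (\<lambda>k. w' k m) = \<zero>"
        using RR.lincomb_zero[of c' n'] c'(1) w'K(2) by (simp add: regular_module_simps)
      then show ?thesis using True vzm KR[OF zK, of m] by (simp add: a_minus_def r_neg)
    qed (use that c'(2) in simp)
    define d where "d k = (if k < n then c k else c' (k - n))" for k
    have "v i = lincomb RR (n + n') d (\<lambda>k. w k i)" if "i < Suc m" for i
    proof -
      have "lincomb RR (n + n') d (\<lambda>k. w k i) =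
        lincomb RR (n + n') (\<lambda>k. if k < n then c k else c' (k - n)) (\<lambda>k. if k < n then u k i else w' (k - n) i)"
        by (rule lincomb_cong) (auto simp: d_def w_def)
      also have "\<dots> = z i \<oplus> lincomb RR n' c' (\<lambda>k. w' k i)"
        using RR.lincomb_append[of c c' "\<lambda>k. u k i" "\<lambda>k. w' k i" n n'] c(1) c'(1) u(1) w'K(1) KR
        by (simp add: zi regular_module_simps)
      also have "\<dots> = v i"
        using c'm[OF that] KR[OF v] KR[OF zK] diff_add_cancel(2) by metis
      finally show ?thesis ..
    qed
    then show ?thesis using c(1) c'(1) by (intro exI[of _ d]) (auto simp: d_def)
  qed
  moreover have "w k \<in> K" for k using u(1) w'K(1) by (simp add: w_def)
  ultimately show ?case by blast
qed

end

text \<open>Matrices \<open>D p\<close> of size \<open>b (p + 1) \<times> b p\<close> whose rows describe a resolution of \<open>R / I\<close> by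
  finitely generated free modules; indices are shifted so that \<open>D 1\<close> is the column of generators
  of \<open>I\<close> and \<open>b 0 = 0\<close>.\<close>

definition free_resolution ::
    "('r, 'k) ring_scheme \<Rightarrow> 'r set \<Rightarrow> (nat \<Rightarrow> nat) \<Rightarrow> (nat \<Rightarrow> nat \<Rightarrow> nat \<Rightarrow> 'r) \<Rightarrow> bool" where
  "free_resolution R I b D \<longleftrightarrow> b 0 = 0 \<and> b 1 = 1 \<and> (\<forall>p k i. D p k i \<in> carrier R) \<and>
    I = {lincomb (regular_module R) (b 2) w (\<lambda>k. D 1 k 0) |w. \<forall>k. w k \<in> carrier R} \<and>
    (\<forall>p. \<forall>k<b (Suc (Suc p)). \<forall>l<b p.
       lincomb (regular_module R) (b (Suc p)) (D (Suc p) k) (\<lambda>i. D p i l) = \<zero>\<^bsub>R\<^esub>) \<and>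
    (\<forall>p\<ge>1. \<forall>v. (\<forall>i. v i \<in> carrier R) \<and>
       (\<forall>l<b p. lincomb (regular_module R) (b (Suc p)) v (\<lambda>i. D p i l) = \<zero>\<^bsub>R\<^esub>) \<longrightarrow>
       (\<exists>w. (\<forall>k. w k \<in> carrier R) \<and>
         (\<forall>i<b (Suc p). v i = lincomb (regular_module R) (b (Suc (Suc p))) w (\<lambda>k. D (Suc p) k i))))"

context noetherian_cring
begin

text \<open>Rows \<open>v\<close> with vA = 0 form a submodule of sequences; generators of its
  truncation are the rows of the next matrix of a resolution.\<close>

lemma syzygies:
  assumes A: "\<And>i l. A i l \<in> carrier R"
  shows "\<exists>m' A'. (\<forall>k i. A' k i \<in> carrier R) \<and>
    (\<forall>k. \<forall>l<n. lincomb RR m (A' k) (\<lambda>i. A i l) = \<zero>) \<and>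
    (\<forall>v. (\<forall>i. v i \<in> carrier R) \<and> (\<forall>l<n. lincomb RR m v (\<lambda>i. A i l) = \<zero>) \<longrightarrow>
       (\<exists>w. (\<forall>k. w k \<in> carrier R) \<and> (\<forall>i<m. v i = lincomb RR m' w (\<lambda>k. A' k i))))"
proof -
  interpret RR: module R RR by (rule module_regular)
  interpret VV: module R "sequence_module RR" by (rule RR.module_sequence)
  note RRl = RR.lincomb_add_left[unfolded regular_module_simps] RR.lincomb_smult_left[unfolded regular_module_simps]
    RR.lincomb_closed[unfolded regular_module_simps]
  define V where "V = {v. (\<forall>i. v i \<in> carrier R) \<and> (\<forall>l<n. lincomb RR m v (\<lambda>i. A i l) = \<zero>)}"
  have V: "submodule V R (sequence_module RR)"
    by (rule VV.submodule_criterion)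
      (auto simp: V_def regular_module_simps RRl A RR.lincomb_zero_left[unfolded regular_module_simps])
  obtain n' w where w: "\<And>k. w k \<in> V" "\<And>v. v \<in> V \<Longrightarrow>
      \<exists>c. (\<forall>k. c k \<in> carrier R) \<and> (\<forall>i<m. v i = lincomb RR n' c (\<lambda>k. w k i))"
    using sequence_submodule_finitely_generated[OF V, of m] by blast
  show ?thesis
    by (intro exI[of _ n'] exI[of _ w]) (use w in \<open>simp add: V_def\<close>)
qed

text \<open>Syzygies are iterated, starting from the single column of generators of the
  ideal.\<close>

lemma free_resolution_exists:
  assumes I: "ideal I R"
  obtains b D where "free_resolution R I b D"
proof -
  interpret RR: module R RR by (rule module_regular)
  have I': "submodule I R RR" using I by (simp add: submodule_regular_iff)
  obtain g n where g: "\<And>k. g k \<in> I" "\<And>x. x \<in> I \<Longrightarrow> \<exists>c. (\<forall>k. c k \<in> carrier R) \<and> x = lincomb RR n c g"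
    using ideal_finitely_generated[OF I'] by blast
  have gR: "g k \<in> carrier R" for k using g(1) ideal.Icarr[OF I] by blast
  define Z where "Z n m A m' A' \<longleftrightarrow> (\<forall>k i. A' k i \<in> carrier R) \<and>
    (\<forall>k. \<forall>l<n. lincomb RR m (A' k) (\<lambda>i. A i l) = \<zero>) \<and>
    (\<forall>v. (\<forall>i. v i \<in> carrier R) \<and> (\<forall>l<n. lincomb RR m v (\<lambda>i. A i l) = \<zero>) \<longrightarrow>
       (\<exists>w. (\<forall>k. w k \<in> carrier R) \<and> (\<forall>i<m. v i = lincomb RR m' w (\<lambda>k. A' k i))))"
    for n m m' :: nat and A A' :: "nat \<Rightarrow> nat \<Rightarrow> 'r"
  have syz: "\<exists>m' A'. Z n m A m' A'" if "\<And>i l. A i l \<in> carrier R" for n m A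
    unfolding Z_def by (rule syzygies) (rule that)
  \<comment> \<open>A state \<open>X\<close> consists of the number of columns, the number of rows
    and the matrix; \<open>Q\<close> turns the row indices of one matrix into the column indices of
    the next.\<close>
  define P where "P = (\<lambda>X :: nat \<times> nat \<times> (nat \<Rightarrow> nat \<Rightarrow> 'r).
    \<forall>i l. snd (snd X) i l \<in> carrier R)"
  define Q where "Q = (\<lambda>(X :: nat \<times> nat \<times> (nat \<Rightarrow> nat \<Rightarrow> 'r)) (Y :: nat \<times> nat \<times> (nat \<Rightarrow> nat \<Rightarrow> 'r)).
    fst Y = fst (snd X) \<and> Z (fst X) (fst (snd X)) (snd (snd X)) (fst (snd Y)) (snd (snd Y)))"
  have "\<exists>F. F 0 = (1, n, \<lambda>k l. g k) \<and> (\<forall>p. P (F p)) \<and> (\<forall>p. Q (F p) (F (Suc p)))"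
  proof -
    have "\<exists>Y. P Y \<and> Q X Y" if "P X" for X
    proof -
      obtain m' A' where Z: "Z (fst X) (fst (snd X)) (snd (snd X)) m' A'"
        using syz[of "snd (snd X)" "fst X" "fst (snd X)"] \<open>P X\<close> unfolding P_def by blast
      then have "\<forall>k i. A' k i \<in> carrier R" unfolding Z_def by (rule conjunct1)
      with Z show ?thesis
        unfolding P_def Q_def by (intro exI[of _ "(fst (snd X), m', A')"]) simp
    qed
    then have "\<exists>G. \<forall>X. P X \<longrightarrow> P (G X) \<and> Q X (G X)" by (intro choice) blast
    then obtain G where G: "P X \<Longrightarrow> P (G X)" "P X \<Longrightarrow> Q X (G X)" for X by blast
    define F where "F p = (G ^^ p) (1, n, \<lambda>k l. g k)" for p
    have "P (F p)" for p
      by (induction p) (use gR G(1) in \<open>auto simp: F_def P_def\<close>)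
    moreover have "Q (F p) (F (Suc p))" for p
      using G(2)[OF calculation, of p] by (simp add: F_def)
    ultimately show ?thesis by (intro exI[of _ F]) (simp add: F_def)
  qed
  then obtain F where F: "F 0 = (1, n, \<lambda>k l. g k)" "\<And>p. P (F p)" "\<And>p. Q (F p) (F (Suc p))" by blast
  \<comment> \<open>The shift by one makes room for a matrix \<open>D 0\<close> without columns,
    which saves a special case for coboundaries in degree 0.\<close>
  define b where "b p = (case p of 0 \<Rightarrow> 0 | Suc q \<Rightarrow> fst (F q))" for p
  define D where "D p = (case p of 0 \<Rightarrow> (\<lambda>_ _. \<zero>) | Suc q \<Rightarrow> snd (snd (F q)))" for p
  have b: "b 0 = 0" "b (Suc q) = fst (F q)" "b (Suc (Suc q)) = fst (snd (F q))" for q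
    using F(3)[of q] by (simp_all add: b_def Q_def)
  have D: "D (Suc q) = snd (snd (F q))" for q by (simp add: D_def)
  have "free_resolution R I b D"
    unfolding free_resolution_def
  proof (intro conjI allI impI)
    show "b 0 = 0" "b 1 = 1" using b(1) b(2)[of 0] F(1) by simp_all
    show "D p k i \<in> carrier R" for p k i
      using F(2)[of "p - 1"] by (cases p) (simp_all add: D_def P_def)
    have D1: "D 1 k 0 = g k" for k using D[of 0] F(1) by simp
    have b2: "b 2 = n" using b(3)[of 0] F(1) by (simp add: numeral_2_eq_2)
    show "I = {lincomb RR (b 2) w (\<lambda>k. D 1 k 0) |w. \<forall>k. w k \<in> carrier R}"
      unfolding D1 b2
    proof (intro subset_antisym subsetI)
      fix x assume "x \<in> I"
      from g(2)[OF this] show "x \<in> {lincomb RR n w g |w. \<forall>k. w k \<in> carrier R}" by auto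
    next
      fix x assume "x \<in> {lincomb RR n w g |w. \<forall>k. w k \<in> carrier R}"
      then obtain w where w: "\<And>k. w k \<in> carrier R" "x = lincomb RR n w g" by auto
      then show "x \<in> I" using lincomb_in_submodule[OF RR.module_axioms I' w(1) g(1)] by simp
    qed
    have Z: "Z (b p) (b (Suc p)) (D p) (b (Suc (Suc p))) (D (Suc p))" if p: "1 \<le> p" for p
    proof -
      obtain q where q: "p = Suc q" using p by (cases p) auto
      show ?thesis using F(3)[of q] b(3)[of "Suc q"] unfolding Q_def q b(2,3) D by simp
    qed
    \<comment> \<open>For \<open>p = 0\<close> there is no column \<open>l < b 0\<close>.\<close>
    show "lincomb RR (b (Suc p)) (D (Suc p) k) (\<lambda>i. D p i l) = \<zero>"
      if "k < b (Suc (Suc p))" "l < b p" for p k l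
      using that Z[of p] b(1) unfolding Z_def by (cases "p = 0") auto
    show "\<exists>w. (\<forall>k. w k \<in> carrier R) \<and> (\<forall>i<b (Suc p). v i = lincomb RR (b (Suc (Suc p))) w (\<lambda>k. D (Suc p) k i))"
      if "1 \<le> p" "(\<forall>i. v i \<in> carrier R) \<and> (\<forall>l<b p. lincomb RR (b (Suc p)) v (\<lambda>i. D p i l) = \<zero>)" for p v
      using Z[OF that(1)] that(2) unfolding Z_def by blast
  qed
  then show thesis by (rule that)
qed

end

section \<open>Torsion submodules of injective modules\<close>

lemma (in abelian_group) diff_diff_cancel:
  assumes "a \<in> carrier G" "b \<in> carrier G" "c \<in> carrier G"
  shows "(a \<ominus> b) \<ominus> (a \<ominus> c) = c \<ominus> b"
proof -
  have "\<ominus> (a \<ominus> c) = c \<ominus> a" using assms by (simp add: a_minus_def minus_add a_comm)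
  then have "(a \<ominus> b) \<ominus> (a \<ominus> c) = (c \<ominus> a) \<oplus> (a \<ominus> b)"
    using assms a_comm[of "a \<ominus> b" "c \<ominus> a"] by (simp add: a_minus_def[of _ "a \<ominus> b"])
  then show ?thesis using assms by (simp add: diff_telescope)
qed

lemma lincomb_in_submodule_lessThan:
  assumes "module R M" "submodule H R M" "\<And>i. i < n \<Longrightarrow> a i \<in> carrier R" "\<And>i. i < n \<Longrightarrow> x i \<in> H"
  shows "lincomb M n a x \<in> H"
  using assms(3,4) module.submoduleD[OF assms(1,2)] by (induction n) auto

text \<open>Evaluation at the class of 1 identifies Hom(R/I, M) with this submodule; computations
  with Hom modules are reduced to it.\<close>

definition annihilated :: "('r, 'm) module \<Rightarrow> 'r set \<Rightarrow> 'm set" where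
  "annihilated M I = {x \<in> carrier M. \<forall>r\<in>I. r \<odot>\<^bsub>M\<^esub> x = \<zero>\<^bsub>M\<^esub>}"

lemma submodule_annihilated:
  assumes "module R M" "I \<subseteq> carrier R"
  shows "submodule (annihilated M I) R M"
proof -
  interpret module R M by fact
  show ?thesis
  proof (rule submodule_criterion)
    fix s x assume s: "s \<in> carrier R" and x: "x \<in> annihilated M I"
    have "r \<odot>\<^bsub>M\<^esub> (s \<odot>\<^bsub>M\<^esub> x) = \<zero>\<^bsub>M\<^esub>" if "r \<in> I" for r
    proof -
      have "r \<odot>\<^bsub>M\<^esub> (s \<odot>\<^bsub>M\<^esub> x) = s \<odot>\<^bsub>M\<^esub> (r \<odot>\<^bsub>M\<^esub> x)"
        using s x that assms(2) smult_assoc1[of r s x] smult_assoc1[of s r x] R.m_comm[of r s]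
        by (auto simp: annihilated_def)
      then show ?thesis using s x that by (simp add: annihilated_def)
    qed
    then show "s \<odot>\<^bsub>M\<^esub> x \<in> annihilated M I" using s x by (simp add: annihilated_def)
  qed (use assms(2) in \<open>auto simp: annihilated_def smult_r_distr\<close>)
qed

lemma annihilated_antimono: "I \<subseteq> J \<Longrightarrow> annihilated M J \<subseteq> annihilated M I"
  by (auto simp: annihilated_def)

lemma torsion_eq_annihilated:
  "carrier (torsion R I M) = (\<Union>n. annihilated M (I [^]\<^bsub>ideals_set R\<^esub> (n::nat)))"
  by (auto simp: torsion_def annihilated_def)

section \<open>Powers of an ideal and torsion\<close>

context cring
begin

lemma ideal_power_0: "I [^]\<^bsub>ideals_set R\<^esub> (0::nat) = carrier R"
  by (simp add: ideals_set_def)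

lemma ideal_power_Suc: "I [^]\<^bsub>ideals_set R\<^esub> Suc n = (I [^]\<^bsub>ideals_set R\<^esub> n) \<cdot> I"
proof -
  have "x \<otimes>\<^bsub>ideals_set R\<^esub> y = x \<cdot> y" for x y by (simp add: ideals_set_def)
  then show ?thesis by (simp only: Group.nat_pow_Suc)
qed

lemma ideal_power_ideal: "ideal I R \<Longrightarrow> ideal (I [^]\<^bsub>ideals_set R\<^esub> (n::nat)) R"
proof (induction n)
  case (Suc n)
  then show ?case using ideal_prod_is_ideal unfolding ideal_power_Suc by blast
qed (simp only: ideal_power_0 oneideal)

lemma ideal_power_antimono:
  assumes "ideal I R" "n \<le> m"
  shows "I [^]\<^bsub>ideals_set R\<^esub> (m::nat) \<subseteq> I [^]\<^bsub>ideals_set R\<^esub> n"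
  using assms(2)
proof (induction m rule: dec_induct)
  case (step m)
  then show ?case
    using ideal_prod_inter[OF ideal_power_ideal[OF assms(1), of m] assms(1)] unfolding ideal_power_Suc by blast
qed simp

lemma ideal_power_subset: "ideal I R \<Longrightarrow> I [^]\<^bsub>ideals_set R\<^esub> (1::nat) \<subseteq> I"
  using ideal_prod_inter[OF oneideal, of I] unfolding One_nat_def ideal_power_Suc ideal_power_0 by blast

lemma power_in_ideal_power:
  assumes "ideal I R" "x \<in> I"
  shows "x [^] n \<in> I [^]\<^bsub>ideals_set R\<^esub> (n::nat)"
proof (induction n)
  case 0
  then show ?case unfolding ideal_power_0 by simp
next
  case (Suc n)
  then show ?case unfolding ideal_power_Suc nat_pow_Suc using assms(2) by (rule ideal_prod.prod)
qed

text \<open>The sum of the individual exponents bounds each of them, and the powers of an ideal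
  decrease.\<close>

lemma torsion_uniform:
  assumes I: "ideal I R" and "\<And>k. k < (t::nat) \<Longrightarrow> y k \<in> carrier (torsion R I E)"
  obtains n :: nat where "\<And>k. k < t \<Longrightarrow> y k \<in> annihilated E (I [^]\<^bsub>ideals_set R\<^esub> n)"
proof -
  have "\<forall>k. \<exists>n::nat. k < t \<longrightarrow> y k \<in> annihilated E (I [^]\<^bsub>ideals_set R\<^esub> n)"
    using assms(2) unfolding torsion_eq_annihilated by blast
  then obtain n where n: "\<And>k. k < t \<Longrightarrow> y k \<in> annihilated E (I [^]\<^bsub>ideals_set R\<^esub> (n k :: nat))" by metis
  show thesis
  proof (rule that)
    fix k assume k: "k < t"
    have le: "n k \<le> (\<Sum>k<t. n k)" using k by (intro member_le_sum) auto
    show "y k \<in> annihilated E (I [^]\<^bsub>ideals_set R\<^esub> (\<Sum>k<t. n k))"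
      by (rule subsetD[OF annihilated_antimono[OF ideal_power_antimono[OF I le]] n[OF k]])
  qed
qed

lemma submodule_torsion:
  assumes I: "ideal I R" and E: "module R E"
  shows "submodule (carrier (torsion R I E)) R E"
proof -
  interpret E: module R E by fact
  have sub: "submodule (annihilated E (I [^]\<^bsub>ideals_set R\<^esub> n)) R E" for n :: nat
    by (rule submodule_annihilated[OF E]) (use ideal.Icarr[OF ideal_power_ideal[OF I]] in blast)
  show ?thesis
  proof (rule E.submodule_criterion)
    fix x y assume x: "x \<in> carrier (torsion R I E)" and y: "y \<in> carrier (torsion R I E)"
    obtain n :: nat where "\<And>k. k < (2::nat) \<Longrightarrow> (if k = 0 then x else y) \<in> annihilated E (I [^]\<^bsub>ideals_set R\<^esub> n)"
      by (rule torsion_uniform[OF I, of 2 "\<lambda>k. if k = 0 then x else y" E]) (use x y in auto)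
    from this[of 0] this[of 1] show "x \<oplus>\<^bsub>E\<^esub> y \<in> carrier (torsion R I E)"
      using E.submoduleD(3)[OF sub[of n]] unfolding torsion_eq_annihilated by auto
  next
    fix r x assume "r \<in> carrier R" "x \<in> carrier (torsion R I E)"
    then show "r \<odot>\<^bsub>E\<^esub> x \<in> carrier (torsion R I E)"
      using E.submoduleD(6)[OF sub] unfolding torsion_eq_annihilated by blast
  qed (use E.submoduleD(1,2)[OF sub] in \<open>auto simp: torsion_eq_annihilated\<close>)
qed

lemma linear_on_torsion:
  assumes E: "module R E" and F: "module R F" and f: "linear_on R E F (carrier E) f"
    and x: "x \<in> carrier (torsion R I E)" and I: "ideal I R"
  shows "f x \<in> carrier (torsion R I F)"
proof -
  interpret E: module R E by fact
  note f0 = linear_on_zero[OF E F E.carrier_is_submodule f]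
  obtain n :: nat where n: "x \<in> annihilated E (I [^]\<^bsub>ideals_set R\<^esub> n)"
    using x unfolding torsion_eq_annihilated by blast
  have "r \<odot>\<^bsub>F\<^esub> f x = \<zero>\<^bsub>F\<^esub>" if "r \<in> I [^]\<^bsub>ideals_set R\<^esub> n" for r
    using n that linear_onD(3)[OF f, of r x] f0 ideal.Icarr[OF ideal_power_ideal[OF I] that]
    by (simp add: annihilated_def)
  then have "f x \<in> annihilated F (I [^]\<^bsub>ideals_set R\<^esub> n)"
    using n linear_onD(1)[OF f] by (simp add: annihilated_def)
  then show ?thesis unfolding torsion_eq_annihilated by blast
qed

text \<open>An element killed by \<open>I\<close> is killed by the first power of \<open>I\<close>.
  This is why Hom(R/I, -) does not distinguish a module from its torsion part.\<close>

lemma annihilated_subset_torsion: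
  assumes "ideal I R"
  shows "annihilated E I \<subseteq> carrier (torsion R I E)"
  using annihilated_antimono[OF ideal_power_subset[OF assms], of E] unfolding torsion_eq_annihilated by blast

text \<open>The induction is on the sum of the nilpotency exponents.\<close>

lemma torsion_by_generators:
  fixes E :: "('a, 'm) module"
  assumes I: "ideal I R" and E: "module R E"
    and g: "\<And>k. g k \<in> I" "\<And>x. x \<in> I \<Longrightarrow> \<exists>c. (\<forall>k. c k \<in> carrier R) \<and> x = lincomb (regular_module R) t c g"
    and "z \<in> carrier E" "\<And>k. k < t \<Longrightarrow> g k [^] (m k :: nat) \<odot>\<^bsub>E\<^esub> z = \<zero>\<^bsub>E\<^esub>"
  shows "z \<in> carrier (torsion R I E)"
  using assms(5,6)
proof (induction "\<Sum>k<t. m k" arbitrary: m z rule: less_induct)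
  case less
  interpret E: module R E by fact
  have gR: "g k \<in> carrier R" for k using g(1) ideal.Icarr[OF I] by blast
  note z = less.prems(1)
  have zero: "\<zero>\<^bsub>E\<^esub> \<in> carrier (torsion R I E)"
    by (rule E.submoduleD(1)[OF submodule_torsion[OF I E]])
  \<comment> \<open>If \<open>m k\<close> is 0, then \<open>z\<close> itself vanishes. Otherwise
    multiplication by \<open>g k\<close> allows the exponent at \<open>k\<close> to be lowered by
    one, which decreases the sum.\<close>
  have gz: "g k \<odot>\<^bsub>E\<^esub> z \<in> carrier (torsion R I E)" if k: "k < t" for k
  proof (cases "m k")
    case 0
    then have "z = \<zero>\<^bsub>E\<^esub>" using less.prems(2)[OF k] z by simp
    then show ?thesis using zero gR by simp
  next
    case (Suc q)
    show ?thesis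
    proof (rule less.hyps[of "m(k := q)"])
      have "sum (m(k := q)) ({..<t} - {k}) = sum m ({..<t} - {k})" by (rule sum.cong) auto
      then show "(\<Sum>j<t. (m(k := q)) j) < (\<Sum>j<t. m j)"
        using k Suc by (simp add: sum.remove[of "{..<t}" k])
      show "g k \<odot>\<^bsub>E\<^esub> z \<in> carrier E" using gR z by simp
      fix j assume j: "j < t"
      show "g j [^] (m(k := q)) j \<odot>\<^bsub>E\<^esub> (g k \<odot>\<^bsub>E\<^esub> z) = \<zero>\<^bsub>E\<^esub>"
      proof (cases "j = k")
        case True
        then show ?thesis using less.prems(2)[OF k] Suc gR z by (simp add: E.smult_assoc1[symmetric])
      next
        case False
        then have "g j [^] (m(k := q)) j \<odot>\<^bsub>E\<^esub> (g k \<odot>\<^bsub>E\<^esub> z) = g k \<odot>\<^bsub>E\<^esub> (g j [^] m j \<odot>\<^bsub>E\<^esub> z)"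
          using gR z by (simp add: E.smult_assoc1[symmetric] m_comm)
        then show ?thesis using less.prems(2)[OF j] gR by simp
      qed
    qed
  qed
  obtain n :: nat where n: "\<And>k. k < t \<Longrightarrow> g k \<odot>\<^bsub>E\<^esub> z \<in> annihilated E (I [^]\<^bsub>ideals_set R\<^esub> n)"
    using torsion_uniform[OF I, of t "\<lambda>k. g k \<odot>\<^bsub>E\<^esub> z" E] gz by blast
  have sub: "submodule (annihilated E (I [^]\<^bsub>ideals_set R\<^esub> n)) R E"
    by (rule submodule_annihilated[OF E]) (use ideal.Icarr[OF ideal_power_ideal[OF I]] in blast)
  have Iz: "x \<odot>\<^bsub>E\<^esub> z \<in> annihilated E (I [^]\<^bsub>ideals_set R\<^esub> n)" if x: "x \<in> I" for x
  proof -
    obtain c where c: "\<And>k. c k \<in> carrier R" "x = lincomb (regular_module R) t c g" using g(2)[OF x] by blast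
    have "x \<odot>\<^bsub>E\<^esub> z = lincomb E t c (\<lambda>k. g k \<odot>\<^bsub>E\<^esub> z)"
      unfolding c(2) using c(1) gR z by (simp add: E.lincomb_smult_vector)
    also have "\<dots> \<in> annihilated E (I [^]\<^bsub>ideals_set R\<^esub> n)"
      by (rule lincomb_in_submodule_lessThan[OF E sub]) (use c(1) n in auto)
    finally show ?thesis .
  qed
  have "p \<odot>\<^bsub>E\<^esub> z = \<zero>\<^bsub>E\<^esub>" if "p \<in> (I [^]\<^bsub>ideals_set R\<^esub> n) \<cdot> I" for p
    using that
  proof (induction rule: ideal_prod.induct)
    case (prod i j)
    then have "i \<in> carrier R" "j \<in> carrier R"
      using ideal.Icarr[OF ideal_power_ideal[OF I]] ideal.Icarr[OF I] by auto
    then show ?case using Iz[OF prod(2)] prod(1) z by (simp add: E.smult_assoc1 annihilated_def)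
  next
    case (sum p q)
    then have "p \<in> carrier R" "q \<in> carrier R"
      using ideal_prod_in_carrier[OF ideal_power_ideal[OF I] I] by blast+
    then show ?case using sum z by (simp add: E.smult_l_distr)
  qed
  then have "z \<in> annihilated E (I [^]\<^bsub>ideals_set R\<^esub> Suc n)"
    unfolding annihilated_def ideal_power_Suc using z by simp
  then show ?case unfolding torsion_eq_annihilated by blast
qed

end

context noetherian_cring
begin

text \<open>An Artin--Rees argument: \<open>Q\<close> is chosen maximal with \<open>Q \<inter> J = ker f\<close>, and then a power of
  \<open>I\<close> turns out to lie in \<open>Q\<close>, so that \<open>f\<close> extends to \<open>J + Q\<close> by zero on \<open>Q\<close>.\<close>

lemma torsion_baer:
  fixes E :: "('r, 'm) module"
  assumes I: "ideal I R" and E: "module R E" and baer: "baer_property R E (carrier E)"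
  shows "baer_property R E (carrier (torsion R I E))"
  unfolding baer_property_def
proof (intro allI impI, elim conjE)
  fix J f
  let ?\<Gamma> = "carrier (torsion R I E)"
  assume J: "submodule J R RR" and f: "linear_on R RR E J f" and f\<Gamma>: "f ` J \<subseteq> ?\<Gamma>"
  interpret E: module R E by fact
  interpret RR: module R RR by (rule module_regular)
  have RRm: "module R RR" by (rule module_regular)
  note JD = RR.submoduleD[OF J, unfolded regular_module_simps] and fD = linear_onD[OF f, unfolded regular_module_simps]
  note fdiff = linear_on_diff[OF RRm E J f]
  define L where "L = {r \<in> J. f r = \<zero>\<^bsub>E\<^esub>}"
  have L: "submodule L R RR" unfolding L_def by (rule linear_on_kernel[OF RRm E J f])

  obtain N g where g: "\<forall>k. g k \<in> J" "\<forall>x\<in>J. \<exists>c. (\<forall>k. c k \<in> carrier R) \<and> x = lincomb RR N c g"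
    using ideal_finitely_generated[OF J] by blast
  \<comment> \<open>As \<open>J\<close> has finitely many generators, a single power I^n kills every
    value of \<open>f\<close>; hence \<open>x [^] n\<close> maps \<open>J\<close> into the kernel
    \<open>L\<close> for each \<open>x\<close> in \<open>I\<close>.\<close>
  obtain n :: nat where n: "\<And>k. k < N \<Longrightarrow> f (g k) \<in> annihilated E (I [^]\<^bsub>ideals_set R\<^esub> n)"
    using torsion_uniform[OF I, of N "\<lambda>k. f (g k)" E] g(1) f\<Gamma> by blast
  have sub: "submodule (annihilated E (I [^]\<^bsub>ideals_set R\<^esub> n)) R E"
    by (rule submodule_annihilated[OF E]) (use ideal.Icarr[OF ideal_power_ideal[OF I]] in blast)
  have fJ: "f r \<in> annihilated E (I [^]\<^bsub>ideals_set R\<^esub> n)" if r: "r \<in> J" for r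
  proof -
    obtain c where c: "\<And>k. c k \<in> carrier R" "r = lincomb RR N c g" using g(2) r by blast
    have "f r = lincomb E N c (\<lambda>k. f (g k))"
      unfolding c(2) by (rule lincomb_linear_on[OF RRm E J f]) (use c(1) g(1) in auto)
    also have "\<dots> \<in> annihilated E (I [^]\<^bsub>ideals_set R\<^esub> n)"
      by (rule lincomb_in_submodule_lessThan[OF E sub]) (use c(1) n in auto)
    finally show ?thesis .
  qed
  have xnL: "x [^] n \<otimes> r \<in> L" if "x \<in> I" "r \<in> J" for x r
  proof -
    have "x [^] n \<in> I [^]\<^bsub>ideals_set R\<^esub> n" "x [^] n \<in> carrier R"
      using power_in_ideal_power[OF I that(1)] ideal.Icarr[OF I that(1)] by auto
    then show ?thesis using fJ[OF that(2)] fD(3)[of "x [^] n" r] JD(6)[of "x [^] n" r] that(2)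
      by (simp add: L_def annihilated_def)
  qed

  define \<F> where "\<F> = {Q. ideal Q R \<and> L \<subseteq> Q \<and> Q \<inter> J \<subseteq> L}"
  have "\<exists>Q\<in>\<F>. \<forall>X\<in>\<F>. Q \<subseteq> X \<longrightarrow> X = Q"
  proof (rule subset_Zorn_nonempty)
    show "\<F> \<noteq> {}" using L by (auto simp: \<F>_def submodule_regular_iff)
    fix C assume C: "C \<noteq> {}" "subset.chain \<F> C"
    then have "subset.chain {I. ideal I R} C" by (auto simp: subset_chain_def \<F>_def)
    \<comment> \<open>In a Noetherian ring a nonempty chain of ideals contains its union.\<close>
    then have "\<Union>C \<in> C" using ideal_chain_is_trivial[OF C(1)] by blast
    then show "\<Union>C \<in> \<F>" using C(2) by (auto simp: subset_chain_def)
  qed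
  then obtain Q where QF: "Q \<in> \<F>" and Qmax: "\<And>X. X \<in> \<F> \<Longrightarrow> Q \<subseteq> X \<Longrightarrow> X = Q" by blast
  have LQ: "L \<subseteq> Q" and QJ: "Q \<inter> J \<subseteq> L" and Qi: "ideal Q R" using QF by (auto simp: \<F>_def)
  have Q: "submodule Q R RR" using Qi by (simp add: submodule_regular_iff)
  note QD = RR.submoduleD[OF Q, unfolded regular_module_simps]
  have Qminus: "a \<ominus> b \<in> Q" if "a \<in> Q" "b \<in> Q" for a b
    using QD(4)[OF that] QD(2)[OF that(1)] QD(2)[OF that(2)] by (simp add: regular_module_minus)
  have Jminus: "a \<ominus> b \<in> J" if "a \<in> J" "b \<in> J" for a b
    using JD(4)[OF that] JD(2)[OF that(1)] JD(2)[OF that(2)] by (simp add: regular_module_minus)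

  \<comment> \<open>The colon ideals (Q : x^k) ascend and become stationary at some
    \<open>k\<close>. Then T = Q + Rx^k still meets \<open>J\<close> inside \<open>L\<close>: if t =
    q + rx^k lies in \<open>J\<close>, then x^n t lies in \<open>L\<close> and so in
    \<open>Q\<close>, which puts r into (Q : x^(n+k)) = (Q : x^k) and t into \<open>Q\<close>.
    Maximality gives T = Q.\<close>
  have nil: "\<exists>k::nat. x [^] k \<in> Q" if x: "x \<in> I" for x
  proof -
    have xR: "x \<in> carrier R" using ideal.Icarr[OF I x] .
    define col where "col k = {r \<in> carrier R. r \<otimes> x [^] k \<in> Q}" for k :: nat
    have col: "ideal (col k) R" for k
      unfolding submodule_regular_iff[symmetric]
      by (rule RR.submodule_criterion)
        (use QD xR in \<open>auto simp: col_def regular_module_simps l_distr m_assoc\<close>)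
    have colS: "col k \<subseteq> col (Suc k)" for k
    proof
      fix r assume r: "r \<in> col k"
      then have "x \<otimes> (r \<otimes> x [^] k) \<in> Q" using QD(6) xR by (simp add: col_def)
      then show "r \<in> col (Suc k)" using r xR by (simp add: col_def m_ac)
    qed
    have colmono: "col k \<subseteq> col l" if "k \<le> l" for k l
      by (rule lift_Suc_mono_le[of col, OF colS that])
    have "subset.chain {I. ideal I R} (range col)"
      unfolding subset_chain_def using col colmono by (auto, metis nat_le_linear subsetD)
    then have "\<Union>(range col) \<in> range col" by (intro ideal_chain_is_trivial) auto
    then obtain k where k: "\<Union>(range col) = col k" by blast
    define T where "T = {t \<in> carrier R. \<exists>r\<in>carrier R. t \<ominus> r \<otimes> x [^] k \<in> Q}"
    have T: "ideal T R"
      unfolding submodule_regular_iff[symmetric]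
    proof (rule RR.submodule_criterion)
      show "\<zero>\<^bsub>RR\<^esub> \<in> T" unfolding T_def regular_module_simps
        using xR QD(1) by (auto intro!: bexI[of _ \<zero>] simp: a_minus_def)
      fix a b assume "a \<in> T" "b \<in> T"
      then obtain r r' where r: "a \<in> carrier R" "r \<in> carrier R" "a \<ominus> r \<otimes> x [^] k \<in> Q"
        "b \<in> carrier R" "r' \<in> carrier R" "b \<ominus> r' \<otimes> x [^] k \<in> Q" by (auto simp: T_def)
      have "(a \<oplus> b) \<ominus> (r \<oplus> r') \<otimes> x [^] k = (a \<ominus> r \<otimes> x [^] k) \<oplus> (b \<ominus> r' \<otimes> x [^] k)"
        using r xR by (simp add: l_distr add_diff_add)
      then show "a \<oplus>\<^bsub>RR\<^esub> b \<in> T" using r QD(3)[OF r(3,6)] unfolding T_def regular_module_simps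
        by (auto intro!: bexI[of _ "r \<oplus> r'"])
    next
      fix s a assume s: "s \<in> carrier R" and "a \<in> T"
      then obtain r where r: "a \<in> carrier R" "r \<in> carrier R" "a \<ominus> r \<otimes> x [^] k \<in> Q" by (auto simp: T_def)
      have "s \<otimes> a \<ominus> (s \<otimes> r) \<otimes> x [^] k = s \<otimes> (a \<ominus> r \<otimes> x [^] k)"
        using r s xR by (simp add: a_minus_def r_distr r_minus m_assoc)
      then show "s \<odot>\<^bsub>RR\<^esub> a \<in> T" using r s QD(6)[OF s r(3)] unfolding T_def regular_module_simps
        by (auto intro!: bexI[of _ "s \<otimes> r"])
    qed (auto simp: T_def regular_module_simps)
    have QT: "Q \<subseteq> T"
      using QD(2) xR by (auto simp: T_def diff_zero intro!: bexI[of _ \<zero>])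
    have "T \<inter> J \<subseteq> L"
    proof
      fix t assume "t \<in> T \<inter> J"
      then obtain r where t: "t \<in> J" "t \<in> carrier R" and r: "r \<in> carrier R" "t \<ominus> r \<otimes> x [^] k \<in> Q"
        by (auto simp: T_def)
      have "x [^] n \<otimes> t \<in> Q" using xnL[OF x t(1)] LQ by blast
      moreover have "x [^] n \<otimes> (t \<ominus> r \<otimes> x [^] k) \<in> Q" using QD(6) r(2) xR by simp
      ultimately have "x [^] n \<otimes> t \<ominus> x [^] n \<otimes> (t \<ominus> r \<otimes> x [^] k) \<in> Q" by (rule Qminus)
      also have "x [^] n \<otimes> t \<ominus> x [^] n \<otimes> (t \<ominus> r \<otimes> x [^] k) = x [^] n \<otimes> (r \<otimes> x [^] k)"
        using r(1) t(2) xR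
        by (simp add: a_minus_def r_distr r_minus minus_add r_neg1 r_neg2)
      also have "\<dots> = r \<otimes> x [^] (n + k)" using r(1) xR by (simp add: nat_pow_mult[symmetric] m_lcomm)
      finally have "r \<in> col (n + k)" using r(1) by (simp add: col_def)
      then have "r \<otimes> x [^] k \<in> Q" using k by (auto simp: col_def)
      then have "(t \<ominus> r \<otimes> x [^] k) \<oplus> r \<otimes> x [^] k \<in> Q" using QD(3) r(2) by blast
      then have "t \<in> Q" using diff_add_cancel(1)[of t "r \<otimes> x [^] k"] t(2) r(1) xR by simp
      then show "t \<in> L" using QJ t(1) by blast
    qed
    then have "T \<in> \<F>" using T LQ QT by (auto simp: \<F>_def)
    then have "T = Q" using Qmax QT by blast
    moreover have "x [^] k \<in> T"
      using xR QD(1) by (auto simp: T_def r_neg a_minus_def intro!: bexI[of _ \<one>])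
    ultimately show ?thesis by blast
  qed

  \<comment> \<open>Now \<open>T\<close> is J + Q. Two decompositions of \<open>t\<close> differ by
    an element of the intersection of \<open>J\<close> and \<open>Q\<close>, where \<open>f\<close>
    vanishes, so \<open>F\<close> is well defined.\<close>
  define T where "T = {t \<in> carrier R. \<exists>i\<in>J. t \<ominus> i \<in> Q}"
  define F where "F t = f (SOME i. i \<in> J \<and> t \<ominus> i \<in> Q)" for t
  have F: "F t = f i" if "t \<in> carrier R" "i \<in> J" "t \<ominus> i \<in> Q" for t i
  proof -
    define i' where "i' = (SOME i. i \<in> J \<and> t \<ominus> i \<in> Q)"
    have i': "i' \<in> J \<and> t \<ominus> i' \<in> Q" unfolding i'_def by (rule someI[of _ i]) (use that in simp)
    have "(t \<ominus> i) \<ominus> (t \<ominus> i') \<in> Q" using Qminus that i' by blast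
    also have "(t \<ominus> i) \<ominus> (t \<ominus> i') = i' \<ominus> i"
      using diff_diff_cancel[of t i i'] that(1) JD(2)[OF that(2)] i' JD(2)[of i'] by simp
    finally have "i' \<ominus> i \<in> L" using QJ Jminus i' that by blast
    then have "f i' \<ominus>\<^bsub>E\<^esub> f i = \<zero>\<^bsub>E\<^esub>"
      using fdiff[of i' i] i' that JD(2)[of i] JD(2)[of i'] by (simp add: L_def regular_module_minus)
    then show ?thesis using E.diff_eq_zero_iff fD(1) i' that by (simp add: F_def i'_def)
  qed
  have T0: "t \<in> carrier R" if "t \<in> T" for t using that by (simp add: T_def)
  have add: "\<exists>i\<in>J. \<exists>j\<in>J. F a = f i \<and> F b = f j \<and> (a \<oplus> b) \<ominus> (i \<oplus> j) \<in> Q" if ab: "a \<in> T" "b \<in> T" for a b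
  proof -
    obtain i j where ij: "i \<in> J" "a \<ominus> i \<in> Q" "j \<in> J" "b \<ominus> j \<in> Q" using ab by (auto simp: T_def)
    then have "(a \<oplus> b) \<ominus> (i \<oplus> j) \<in> Q"
      using add_diff_add[of a b i j] QD(3)[OF ij(2,4)] T0 ab JD(2) by simp
    then show ?thesis using F ij T0 ab by blast
  qed
  have smul: "\<exists>i\<in>J. F a = f i \<and> s \<otimes> a \<ominus> s \<otimes> i \<in> Q" if as: "a \<in> T" "s \<in> carrier R" for a s
  proof -
    obtain i where i: "i \<in> J" "a \<ominus> i \<in> Q" using as by (auto simp: T_def)
    have "s \<otimes> a \<ominus> s \<otimes> i = s \<otimes> (a \<ominus> i)"
      using T0[OF as(1)] JD(2)[OF i(1)] as(2) by (simp add: a_minus_def r_distr r_minus)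
    then have "s \<otimes> a \<ominus> s \<otimes> i \<in> Q" using QD(6)[OF as(2) i(2)] by simp
    then show ?thesis using F[OF T0[OF as(1)] i] i by blast
  qed
  have T: "submodule T R RR"
  proof (rule RR.submodule_criterion)
    show "\<zero>\<^bsub>RR\<^esub> \<in> T" unfolding T_def regular_module_simps
      using JD(1) QD(1) by (auto intro!: bexI[of _ \<zero>] simp: a_minus_def)
    show "a \<oplus>\<^bsub>RR\<^esub> b \<in> T" if "a \<in> T" "b \<in> T" for a b
      using add[OF that] JD(3) T0 that unfolding T_def regular_module_simps by blast
    show "s \<odot>\<^bsub>RR\<^esub> a \<in> T" if "s \<in> carrier R" "a \<in> T" for a s
      using smul[OF that(2,1)] JD(6) T0 that unfolding T_def regular_module_simps by blast
  qed (auto simp: T_def regular_module_simps)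
  have lin: "linear_on R RR E T F"
  proof (rule linear_onI)
    show "F t \<in> carrier E" if "t \<in> T" for t
      using add[OF that that] fD(1) by auto
    show "F (a \<oplus>\<^bsub>RR\<^esub> b) = F a \<oplus>\<^bsub>E\<^esub> F b" if ab: "a \<in> T" "b \<in> T" for a b
    proof -
      obtain i j where "i \<in> J" "j \<in> J" "F a = f i" "F b = f j" "(a \<oplus> b) \<ominus> (i \<oplus> j) \<in> Q"
        using add[OF ab] by blast
      then show ?thesis using F[of "a \<oplus> b" "i \<oplus> j"] JD(3) fD(2) T0 ab by (simp add: regular_module_simps)
    qed
    show "F (s \<odot>\<^bsub>RR\<^esub> a) = s \<odot>\<^bsub>E\<^esub> F a" if sa: "s \<in> carrier R" "a \<in> T" for s a
    proof -
      obtain i where "i \<in> J" "F a = f i" "s \<otimes> a \<ominus> s \<otimes> i \<in> Q"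
        using smul[OF sa(2,1)] by blast
      then show ?thesis using F[of "s \<otimes> a" "s \<otimes> i"] JD(6) fD(3) T0 sa by (simp add: regular_module_simps)
    qed
  qed
  have "F ` T \<subseteq> carrier E" using linear_onD(1)[OF lin] by blast
  then have "\<exists>e\<in>carrier E. \<forall>r\<in>T. F r = r \<odot>\<^bsub>E\<^esub> e"
    using baer[unfolded baer_property_def, THEN spec, of T, THEN spec, of F] T lin by simp
  then obtain e where e: "e \<in> carrier E" "\<And>r. r \<in> T \<Longrightarrow> F r = r \<odot>\<^bsub>E\<^esub> e" by blast
  have eJ: "f r = r \<odot>\<^bsub>E\<^esub> e" if r: "r \<in> J" for r
  proof -
    have "r \<ominus> r \<in> Q" using JD(2)[OF r] QD(1) by (simp add: a_minus_def r_neg)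
    then have "r \<in> T" "F r = f r" using r F[of r r] JD(2)[OF r] by (auto simp: T_def)
    then show ?thesis using e(2) by simp
  qed
  have eQ: "q \<odot>\<^bsub>E\<^esub> e = \<zero>\<^bsub>E\<^esub>" if q: "q \<in> Q" for q
  proof -
    have "q \<ominus> \<zero> \<in> Q" using QD(2)[OF q] q by (simp add: diff_zero)
    then have "q \<in> T" "F q = f \<zero>" using F[of q \<zero>] JD(1) QD(2)[OF q] by (auto simp: T_def)
    then show ?thesis using e(2) linear_on_zero[OF RRm E J f] by (simp add: regular_module_simps)
  qed
  \<comment> \<open>It remains to see that \<open>e\<close> is torsion: every generator of
    \<open>I\<close> has a power in \<open>Q\<close>, and \<open>Q\<close> annihilates
    \<open>e\<close>.\<close>
  have I': "submodule I R RR" using I by (simp add: submodule_regular_iff)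
  obtain t h where h: "\<forall>k. h k \<in> I" "\<forall>x\<in>I. \<exists>c. (\<forall>k. c k \<in> carrier R) \<and> x = lincomb RR t c h"
    using ideal_finitely_generated[OF I'] by blast
  have "\<forall>k. \<exists>m::nat. h k [^] m \<in> Q" using nil h(1) by blast
  then obtain m :: "nat \<Rightarrow> nat" where m: "\<And>k. h k [^] m k \<in> Q" by metis
  have "e \<in> ?\<Gamma>"
    by (rule torsion_by_generators[OF I E, of h t e m]) (use h e(1) eQ m in auto)
  then show "\<exists>e\<in>?\<Gamma>. \<forall>r\<in>J. f r = r \<odot>\<^bsub>E\<^esub> e" using eJ by blast
qed

end

section \<open>Ext computed from a free resolution\<close>

locale ext_setup = serre R S for R :: "('r, 'k) ring_scheme" and S :: "('r, 'u::infinite) module set" +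
  fixes I :: "'r set" and b :: "nat \<Rightarrow> nat" and D :: "nat \<Rightarrow> nat \<Rightarrow> nat \<Rightarrow> 'r"
  assumes noetherian: "noetherian_ring R" and ideal: "ideal I R" and resolution: "free_resolution R I b D"
begin

lemma noetherian_cring: "noetherian_cring R"
  by (intro noetherian_cring.intro noetherian cring)

lemma b_0: "b 0 = 0" and b_1: "b (Suc 0) = 1" and D_closed: "D p k i \<in> carrier R"
  using resolution by (simp_all add: free_resolution_def)

definition del :: "nat \<Rightarrow> ('r, 'm) module \<Rightarrow> (nat \<Rightarrow> 'm) \<Rightarrow> nat \<Rightarrow> 'm" where
  "del p M y i = lincomb M (b p) (D p i) y"

text \<open>\<open>del\<close> is the differential of \<open>Hom(P, K)\<close>, where \<open>P\<close> is the resolution of \<open>R / I\<close>. A cochain of degree \<open>p\<close> is a sequence of which only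
  the first \<open>b (p + 1)\<close> entries matter; the remaining ones are arbitrary, and are divided out by
  the coboundaries.\<close>

definition cocycles :: "nat \<Rightarrow> ('r, 'm) module \<Rightarrow> 'm set \<Rightarrow> (nat \<Rightarrow> 'm) set" where
  "cocycles p M K = {x. (\<forall>i. x i \<in> K) \<and> (\<forall>k<b (Suc (Suc p)). del (Suc p) M x k = \<zero>\<^bsub>M\<^esub>)}"

definition coboundaries :: "nat \<Rightarrow> ('r, 'm) module \<Rightarrow> 'm set \<Rightarrow> (nat \<Rightarrow> 'm) set" where
  "coboundaries p M K = {x. (\<forall>i. x i \<in> K) \<and> (\<exists>y. (\<forall>l. y l \<in> K) \<and> (\<forall>i<b (Suc p). x i = del p M y i))}"

text \<open>Stands for Ext^p(R/I, K) belonging to the class. \<open>K\<close> is kept inside an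
  ambient module \<open>M\<close>, so that exact sequences of submodules need no new
  records.\<close>

definition ext_in :: "nat \<Rightarrow> ('r, 'm) module \<Rightarrow> 'm set \<Rightarrow> bool" where
  "ext_in p M K \<longleftrightarrow> subquotient_in R S (sequence_module M) (cocycles p M K) (coboundaries p M K)"

lemma cocyclesD:
  "x \<in> cocycles p M K \<Longrightarrow> x i \<in> K" "x \<in> cocycles p M K \<Longrightarrow> k < b (Suc (Suc p)) \<Longrightarrow> del (Suc p) M x k = \<zero>\<^bsub>M\<^esub>"
  by (simp_all add: cocycles_def)

lemma cocyclesI:
  "(\<And>i. x i \<in> K) \<Longrightarrow> (\<And>k. k < b (Suc (Suc p)) \<Longrightarrow> del (Suc p) M x k = \<zero>\<^bsub>M\<^esub>) \<Longrightarrow> x \<in> cocycles p M K"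
  by (simp add: cocycles_def)

lemma coboundariesI:
  "(\<And>i. x i \<in> K) \<Longrightarrow> (\<And>l. y l \<in> K) \<Longrightarrow> (\<And>i. i < b (Suc p) \<Longrightarrow> x i = del p M y i) \<Longrightarrow> x \<in> coboundaries p M K"
  by (auto simp: coboundaries_def)

lemma coboundariesE:
  assumes "x \<in> coboundaries p M K"
  obtains y where "\<And>i. x i \<in> K" "\<And>l. y l \<in> K" "\<And>i. i < b (Suc p) \<Longrightarrow> x i = del p M y i"
  using assms unfolding coboundaries_def by blast

lemma del_cong: "(\<And>l. l < b p \<Longrightarrow> y l = y' l) \<Longrightarrow> del p M y i = del p M y' i"
  unfolding del_def by (rule lincomb_cong) auto

context
  fixes M :: "('r, 'm) module"
  assumes M: "module R M"
begin

interpretation M: module R M by (rule M)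

lemma del_closed: "(\<And>l. y l \<in> carrier M) \<Longrightarrow> del p M y i \<in> carrier M"
  unfolding del_def by (rule M.lincomb_closed[OF D_closed])

lemma del_in_submodule: "submodule K R M \<Longrightarrow> (\<And>l. y l \<in> K) \<Longrightarrow> del p M y i \<in> K"
  unfolding del_def by (rule lincomb_in_submodule[OF M _ D_closed])

lemma del_add: "(\<And>l. y l \<in> carrier M) \<Longrightarrow> (\<And>l. y' l \<in> carrier M) \<Longrightarrow>
    del p M (\<lambda>l. y l \<oplus>\<^bsub>M\<^esub> y' l) i = del p M y i \<oplus>\<^bsub>M\<^esub> del p M y' i"
  unfolding del_def by (rule M.lincomb_add[OF D_closed])

lemma del_diff: "(\<And>l. y l \<in> carrier M) \<Longrightarrow> (\<And>l. y' l \<in> carrier M) \<Longrightarrow>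
    del p M (\<lambda>l. y l \<ominus>\<^bsub>M\<^esub> y' l) i = del p M y i \<ominus>\<^bsub>M\<^esub> del p M y' i"
  unfolding del_def by (rule M.lincomb_diff[OF D_closed])

lemma del_smult: "r \<in> carrier R \<Longrightarrow> (\<And>l. y l \<in> carrier M) \<Longrightarrow>
    del p M (\<lambda>l. r \<odot>\<^bsub>M\<^esub> y l) i = r \<odot>\<^bsub>M\<^esub> del p M y i"
  unfolding del_def by (rule M.lincomb_smult[OF _ D_closed])

lemma del_zero: "del p M (\<lambda>l. \<zero>\<^bsub>M\<^esub>) i = \<zero>\<^bsub>M\<^esub>"
  unfolding del_def by (rule M.lincomb_zero[OF D_closed])

text \<open>Consecutive matrices multiply to zero, and \<open>lincomb_exchange\<close> brings their
  product together. The sequence \<open>x\<close> is tied to the coboundary only in the entries that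
  \<open>del (Suc p)\<close> reads, because the others are arbitrary.\<close>

lemma del_del:
  assumes "\<And>l. y l \<in> carrier M" "k < b (Suc (Suc p))" "\<And>i. i < b (Suc p) \<Longrightarrow> x i = del p M y i"
  shows "del (Suc p) M x k = \<zero>\<^bsub>M\<^esub>"
proof -
  have "del (Suc p) M x k = del (Suc p) M (del p M y) k"
    by (rule del_cong) (rule assms(3))
  also have "\<dots> = lincomb M (b p) (\<lambda>l. lincomb (regular_module R) (b (Suc p)) (D (Suc p) k) (\<lambda>i. D p i l)) y"
    unfolding del_def by (rule M.lincomb_exchange) (use D_closed assms(1) in auto)
  also have "\<dots> = \<zero>\<^bsub>M\<^esub>"
    by (rule M.lincomb_zero_left)
      (use resolution assms(1,2) in \<open>auto simp: free_resolution_def\<close>)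
  finally show ?thesis .
qed

lemma del_linear_on:
  assumes "module R N" "submodule Z R M" "linear_on R M N Z f" "\<And>l. y l \<in> Z"
  shows "f (del p M y i) = del p N (\<lambda>l. f (y l)) i"
  unfolding del_def by (rule lincomb_linear_on[OF M assms(1-3) D_closed assms(4)])

lemma submodule_cocycles:
  assumes K: "submodule K R M"
  shows "submodule (cocycles p M K) R (sequence_module M)"
proof (rule module.submodule_criterion[OF M.module_sequence])
  note KD = M.submoduleD[OF K]
  show "cocycles p M K \<subseteq> carrier (sequence_module M)"
    using KD(2) by (auto simp: cocycles_def)
  show "\<zero>\<^bsub>sequence_module M\<^esub> \<in> cocycles p M K"
    using KD(1) by (auto intro: cocyclesI simp: del_zero)
  show "x \<oplus>\<^bsub>sequence_module M\<^esub> y \<in> cocycles p M K" if "x \<in> cocycles p M K" "y \<in> cocycles p M K" for x y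
    using cocyclesD[OF that(1)] cocyclesD[OF that(2)] KD
    by (auto intro!: cocyclesI simp: del_add)
  show "r \<odot>\<^bsub>sequence_module M\<^esub> x \<in> cocycles p M K" if "r \<in> carrier R" "x \<in> cocycles p M K" for r x
    using cocyclesD[OF that(2)] that(1) KD
    by (auto intro!: cocyclesI simp: del_smult)
qed

lemma submodule_coboundaries:
  assumes K: "submodule K R M"
  shows "submodule (coboundaries p M K) R (sequence_module M)"
proof (rule module.submodule_criterion[OF M.module_sequence])
  note KD = M.submoduleD[OF K]
  show "coboundaries p M K \<subseteq> carrier (sequence_module M)"
    using KD(2) by (auto simp: coboundaries_def)
  show "\<zero>\<^bsub>sequence_module M\<^esub> \<in> coboundaries p M K"
    by (rule coboundariesI[of _ _ "\<lambda>_. \<zero>\<^bsub>M\<^esub>"]) (use KD(1) in \<open>auto simp: del_zero\<close>)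
  show "x \<oplus>\<^bsub>sequence_module M\<^esub> y \<in> coboundaries p M K"
    if x: "x \<in> coboundaries p M K" and y: "y \<in> coboundaries p M K" for x y
  proof -
    obtain u where u: "\<And>i. x i \<in> K" "\<And>l. u l \<in> K" "\<And>i. i < b (Suc p) \<Longrightarrow> x i = del p M u i"
      using x by (rule coboundariesE) blast
    obtain v where v: "\<And>i. y i \<in> K" "\<And>l. v l \<in> K" "\<And>i. i < b (Suc p) \<Longrightarrow> y i = del p M v i"
      using y by (rule coboundariesE) blast
    show ?thesis
      by (rule coboundariesI[of _ _ "\<lambda>l. u l \<oplus>\<^bsub>M\<^esub> v l"]) (use u v KD in \<open>auto simp: del_add\<close>)
  qed
  show "r \<odot>\<^bsub>sequence_module M\<^esub> x \<in> coboundaries p M K"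
    if r: "r \<in> carrier R" and x: "x \<in> coboundaries p M K" for r x
  proof -
    obtain u where u: "\<And>i. x i \<in> K" "\<And>l. u l \<in> K" "\<And>i. i < b (Suc p) \<Longrightarrow> x i = del p M u i"
      using x by (rule coboundariesE) blast
    show ?thesis
      by (rule coboundariesI[of _ _ "\<lambda>l. r \<odot>\<^bsub>M\<^esub> u l"]) (use u r KD in \<open>auto simp: del_smult\<close>)
  qed
qed

lemma coboundaries_subset_cocycles:
  assumes K: "submodule K R M"
  shows "coboundaries p M K \<subseteq> cocycles p M K"
proof
  fix x assume "x \<in> coboundaries p M K"
  then obtain u where u: "\<And>i. x i \<in> K" "\<And>l. u l \<in> K" "\<And>i. i < b (Suc p) \<Longrightarrow> x i = del p M u i"
    by (rule coboundariesE) blast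
  show "x \<in> cocycles p M K"
    by (rule cocyclesI[OF u(1)], rule del_del[of u]) (use u M.submoduleD(2)[OF K] in auto)
qed

text \<open>To be a coboundary means to solve a linear system with matrix \<open>D p\<close>. By
  exactness of the resolution, every relation between its rows is a combination of rows of
  \<open>D (Suc p)\<close>, and these annihilate a cocycle; so the system is compatible and
  \<open>baer_linear_system\<close> solves it.\<close>

lemma baer_acyclic:
  assumes K: "submodule K R M" and "baer_property R M K" and p: "1 \<le> p"
  shows "cocycles p M K \<subseteq> coboundaries p M K"
proof
  fix x assume x: "x \<in> cocycles p M K"
  have xM: "x i \<in> carrier M" for i using cocyclesD(1)[OF x] M.submoduleD(2)[OF K] by blast
  have "\<exists>y. (\<forall>l. y l \<in> K) \<and> (\<forall>i<b (Suc p). x i = lincomb M (b p) (D p i) y)"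
  proof (rule baer_linear_system[OF M K assms(2) D_closed cocyclesD(1)[OF x]])
    fix v assume v: "\<And>i. v i \<in> carrier R"
      "\<And>l. l < b p \<Longrightarrow> lincomb (regular_module R) (b (Suc p)) v (\<lambda>i. D p i l) = \<zero>\<^bsub>R\<^esub>"
    have "\<exists>w. (\<forall>k. w k \<in> carrier R) \<and>
         (\<forall>i<b (Suc p). v i = lincomb (regular_module R) (b (Suc (Suc p))) w (\<lambda>k. D (Suc p) k i))"
      using resolution p v unfolding free_resolution_def by simp
    then obtain w where w: "\<And>k. w k \<in> carrier R"
      "\<And>i. i < b (Suc p) \<Longrightarrow> v i = lincomb (regular_module R) (b (Suc (Suc p))) w (\<lambda>k. D (Suc p) k i)"
      by blast
    have "lincomb M (b (Suc p)) v x =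
      lincomb M (b (Suc p)) (\<lambda>i. lincomb (regular_module R) (b (Suc (Suc p))) w (\<lambda>k. D (Suc p) k i)) x"
      by (rule lincomb_cong) (use w(2) in auto)
    also have "\<dots> = lincomb M (b (Suc (Suc p))) w (\<lambda>k. lincomb M (b (Suc p)) (D (Suc p) k) x)"
      by (rule M.lincomb_exchange[symmetric]) (use w(1) D_closed xM in auto)
    also have "\<dots> = lincomb M (b (Suc (Suc p))) w (\<lambda>k. \<zero>\<^bsub>M\<^esub>)"
      by (rule lincomb_cong) (use cocyclesD(2)[OF x] in \<open>auto simp: del_def\<close>)
    finally show "lincomb M (b (Suc p)) v x = \<zero>\<^bsub>M\<^esub>" using M.lincomb_zero[OF w(1)] by simp
  qed
  then show "x \<in> coboundaries p M K"
    unfolding coboundaries_def del_def using cocyclesD(1)[OF x] by blast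
qed

end

end

section \<open>The long exact sequence of Ext attached to 0 -> K -> U -> U' -> 0\<close>

locale ext_sequence = ext_setup R S I b D
  for R :: "('r, 'k) ring_scheme" and S :: "('r, 'u::infinite) module set" and I b D +
  fixes E :: "('r, 'm) module" and E' :: "('r, 'n) module" and U :: "'m set" and g :: "'m \<Rightarrow> 'n"
    and K :: "'m set" and U' :: "'n set"
  assumes E: "module R E" and E': "module R E'" and U: "submodule U R E" and g: "linear_on R E E' U g"
    and K_eq: "K = {u \<in> U. g u = \<zero>\<^bsub>E'\<^esub>}" and U'_eq: "U' = g ` U"
begin

interpretation E: module R E by (rule E)
interpretation E': module R E' by (rule E')

lemma U': "submodule U' R E'"
  unfolding U'_eq by (rule linear_on_image[OF E E' U g])

lemma K: "submodule K R E"
  unfolding K_eq by (rule linear_on_kernel[OF E E' U g])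

lemma K_subset: "K \<subseteq> U" by (auto simp: K_eq)

lemmas UD = E.submoduleD[OF U] and KD = E.submoduleD[OF K] and U'D = E'.submoduleD[OF U']
  and gD = linear_onD[OF g] and g_zero = linear_on_zero[OF E E' U g]
  and g_diff = linear_on_diff[OF E E' U g] and g_del = del_linear_on[OF E E' U g]

lemma seqE: "module R (sequence_module E)" and seqE': "module R (sequence_module E')"
  by (rule E.module_sequence, rule E'.module_sequence)

lemma gU: "u \<in> U \<Longrightarrow> g u \<in> U'" by (auto simp: U'_eq)

lemma lift_sequence:
  assumes "\<And>i. z i \<in> U'"
  obtains e where "\<And>i. e i \<in> U" "\<And>i. z i = g (e i)"
proof -
  have "\<forall>i. \<exists>u. u \<in> U \<and> z i = g u" using assms unfolding U'_eq by blast
  then show thesis using that by metis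
qed

text \<open>\<open>lifted p\<close> represents the image of \<open>Ext\<^sup>p(R / I, U)\<close> in \<open>Ext\<^sup>p(R / I, U')\<close>, which is the
  kernel of the connecting homomorphism.\<close>

definition lifted :: "nat \<Rightarrow> (nat \<Rightarrow> 'n) set" where
  "lifted p = {z. (\<forall>i. z i \<in> U') \<and> (\<exists>e\<in>cocycles p E U. \<forall>i<b (Suc p). z i = g (e i))}"

lemma liftedI:
  "(\<And>i. z i \<in> U') \<Longrightarrow> e \<in> cocycles p E U \<Longrightarrow> (\<And>i. i < b (Suc p) \<Longrightarrow> z i = g (e i)) \<Longrightarrow> z \<in> lifted p"
  unfolding lifted_def by blast

lemma liftedE:
  assumes "z \<in> lifted p"
  obtains e where "\<And>i. z i \<in> U'" "e \<in> cocycles p E U" "\<And>i. i < b (Suc p) \<Longrightarrow> z i = g (e i)"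
  using assms unfolding lifted_def by blast

text \<open>The usual recipe for the connecting homomorphism: lift the cocycle entry by entry and
  apply the differential. Since the lift \<open>e\<close> is not unique, the result is a
  relation.\<close>

definition connecting :: "nat \<Rightarrow> (nat \<Rightarrow> 'n) \<Rightarrow> (nat \<Rightarrow> 'm) \<Rightarrow> bool" where
  "connecting p z y \<longleftrightarrow> (\<exists>e. (\<forall>i. e i \<in> U) \<and> (\<forall>i<b (Suc p). z i = g (e i)) \<and>
     (\<forall>k<b (Suc (Suc p)). y k = del (Suc p) E e k))"

lemma connecting_linear: "linear_relation R (sequence_module E') (sequence_module E) (connecting p)"
proof (rule linear_relationI)
  fix z y z' y' assume "connecting p z y" "connecting p z' y'"
  then obtain e e' where e: "\<And>i. e i \<in> U" "\<And>i. i < b (Suc p) \<Longrightarrow> z i = g (e i)"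
     "\<And>k. k < b (Suc (Suc p)) \<Longrightarrow> y k = del (Suc p) E e k"
     and e': "\<And>i. e' i \<in> U" "\<And>i. i < b (Suc p) \<Longrightarrow> z' i = g (e' i)"
     "\<And>k. k < b (Suc (Suc p)) \<Longrightarrow> y' k = del (Suc p) E e' k"
    unfolding connecting_def by blast
  show "connecting p (z \<oplus>\<^bsub>sequence_module E'\<^esub> z') (y \<oplus>\<^bsub>sequence_module E\<^esub> y')"
    unfolding connecting_def
    by (rule exI[of _ "\<lambda>i. e i \<oplus>\<^bsub>E\<^esub> e' i"]) (use e e' UD gD in \<open>simp add: del_add[OF E]\<close>)
next
  fix r z y assume r: "r \<in> carrier R" and "connecting p z y"
  then obtain e where e: "\<And>i. e i \<in> U" "\<And>i. i < b (Suc p) \<Longrightarrow> z i = g (e i)"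
     "\<And>k. k < b (Suc (Suc p)) \<Longrightarrow> y k = del (Suc p) E e k"
    unfolding connecting_def by blast
  show "connecting p (r \<odot>\<^bsub>sequence_module E'\<^esub> z) (r \<odot>\<^bsub>sequence_module E\<^esub> y)"
    unfolding connecting_def
    by (rule exI[of _ "\<lambda>i. r \<odot>\<^bsub>E\<^esub> e i"]) (use e r UD gD in \<open>simp add: del_smult[OF E]\<close>)
qed

text \<open>The differential of a lift of \<open>z\<close> is mapped by \<open>g\<close> to the
  differential of \<open>z\<close>, which is 0; hence it takes values in \<open>K\<close>.\<close>

lemma connecting_total:
  assumes z: "z \<in> cocycles p E' U'"
  shows "\<exists>y\<in>cocycles (Suc p) E K. connecting p z y"
proof -
  obtain e where e: "\<And>i. e i \<in> U" "\<And>i. z i = g (e i)"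
    using lift_sequence[of z] cocyclesD(1)[OF z] by blast
  have eE: "e i \<in> carrier E" for i using e(1) UD(2) by blast
  \<comment> \<open>Surplus entries are set to 0 because a cochain must have all its entries in
    \<open>K\<close>.\<close>
  define y where "y k = (if k < b (Suc (Suc p)) then del (Suc p) E e k else \<zero>\<^bsub>E\<^esub>)" for k
  have "y k \<in> K" for k
  proof (cases "k < b (Suc (Suc p))")
    case True
    have "g (del (Suc p) E e k) = del (Suc p) E' z k"
      using g_del[of e "Suc p" k] e by (simp add: del_cong[of "Suc p" z "\<lambda>i. g (e i)"])
    then show ?thesis using cocyclesD(2)[OF z True] True del_in_submodule[OF E U e(1)]
      by (simp add: y_def K_eq)
  qed (simp add: y_def KD(1))
  moreover have "del (Suc (Suc p)) E y k = \<zero>\<^bsub>E\<^esub>" if "k < b (Suc (Suc (Suc p)))" for k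
    by (rule del_del[OF E eE that]) (simp add: y_def)
  ultimately have "y \<in> cocycles (Suc p) E K" by (rule cocyclesI)
  moreover have "connecting p z y" unfolding connecting_def using e by (auto simp: y_def)
  ultimately show ?thesis by blast
qed

text \<open>If \<open>y\<close> is also the differential of some \<open>u\<close> in
  \<open>K\<close>, then e - u is a cocycle that still lifts \<open>z\<close>. Conversely, a lift
  \<open>e'\<close> that is a cocycle makes \<open>y\<close> the differential of e - e', which has
  entries in \<open>K\<close>.\<close>

lemma connecting_kernel:
  assumes z: "z \<in> cocycles p E' U'" and y: "y \<in> cocycles (Suc p) E K" and "connecting p z y"
  shows "y \<in> coboundaries (Suc p) E K \<longleftrightarrow> z \<in> lifted p"
proof -
  obtain e where e: "\<And>i. e i \<in> U" "\<And>i. i < b (Suc p) \<Longrightarrow> z i = g (e i)"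
     "\<And>k. k < b (Suc (Suc p)) \<Longrightarrow> y k = del (Suc p) E e k"
    using assms(3) unfolding connecting_def by blast
  have eE: "e i \<in> carrier E" for i using e(1) UD(2) by blast
  show ?thesis
  proof
    assume "y \<in> coboundaries (Suc p) E K"
    then obtain u where u: "\<And>i. u i \<in> K" "\<And>k. k < b (Suc (Suc p)) \<Longrightarrow> y k = del (Suc p) E u k"
      by (rule coboundariesE) blast
    have uU: "u i \<in> U" "u i \<in> carrier E" "g (u i) = \<zero>\<^bsub>E'\<^esub>" for i
      using u(1)[of i] KD(2) by (auto simp: K_eq)
    have "(\<lambda>i. e i \<ominus>\<^bsub>E\<^esub> u i) \<in> cocycles p E U"
    proof (rule cocyclesI)
      show "e i \<ominus>\<^bsub>E\<^esub> u i \<in> U" for i using UD(4) e(1) uU(1) by blast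
      show "del (Suc p) E (\<lambda>i. e i \<ominus>\<^bsub>E\<^esub> u i) k = \<zero>\<^bsub>E\<^esub>" if k: "k < b (Suc (Suc p))" for k
        using e(3)[OF k] u(2)[OF k] del_closed[OF E eE] E.diff_eq_zero_iff
        by (simp add: del_diff[OF E eE uU(2)])
    qed
    moreover have "z i = g (e i \<ominus>\<^bsub>E\<^esub> u i)" if "i < b (Suc p)" for i
      using g_diff[OF e(1) uU(1), of i i] uU(3) e(2)[OF that] gD(1)[OF e(1)] by (simp add: E'.diff_zero)
    ultimately show "z \<in> lifted p" by (intro liftedI cocyclesD(1)[OF z])
  next
    assume "z \<in> lifted p"
    then obtain e' where e': "e' \<in> cocycles p E U" "\<And>i. i < b (Suc p) \<Longrightarrow> z i = g (e' i)"
      unfolding lifted_def by blast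
    have e'U: "e' i \<in> U" "e' i \<in> carrier E" for i using cocyclesD(1)[OF e'(1)] UD(2) by blast+
    define u where "u i = (if i < b (Suc p) then e i \<ominus>\<^bsub>E\<^esub> e' i else \<zero>\<^bsub>E\<^esub>)" for i
    have "u i \<in> K" for i
    proof (cases "i < b (Suc p)")
      case True
      then have "g (e i \<ominus>\<^bsub>E\<^esub> e' i) = \<zero>\<^bsub>E'\<^esub>"
        using g_diff[OF e(1) e'U(1), of i i] e(2) e'(2) gD(1)[OF e(1)] E'.diff_eq_zero_iff by metis
      then show ?thesis using True UD(4)[OF e(1) e'U(1)] by (simp add: u_def K_eq)
    qed (simp add: u_def KD(1))
    moreover have "y k = del (Suc p) E u k" if k: "k < b (Suc (Suc p))" for k
    proof -
      have "del (Suc p) E u k = del (Suc p) E (\<lambda>i. e i \<ominus>\<^bsub>E\<^esub> e' i) k"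
        by (rule del_cong) (simp add: u_def)
      also have "\<dots> = del (Suc p) E e k \<ominus>\<^bsub>E\<^esub> del (Suc p) E e' k"
        by (rule del_diff[OF E eE e'U(2)])
      also have "\<dots> = y k"
        using e(3)[OF k] cocyclesD(2)[OF e'(1) k] del_closed[OF E eE] by (simp add: E.diff_zero)
      finally show ?thesis ..
    qed
    ultimately show "y \<in> coboundaries (Suc p) E K"
      using cocyclesD(1)[OF y] by (intro coboundariesI[of y K u]) auto
  qed
qed

text \<open>Lifting a primitive of \<open>z\<close> and taking its differential gives a lift of
  \<open>z\<close> that is itself a coboundary.\<close>

lemma coboundaries_lifted: "coboundaries p E' U' \<subseteq> lifted p"
proof
  fix z assume "z \<in> coboundaries p E' U'"
  then obtain y' where y': "\<And>i. z i \<in> U'" "\<And>l. y' l \<in> U'" "\<And>i. i < b (Suc p) \<Longrightarrow> z i = del p E' y' i"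
    by (rule coboundariesE) blast
  obtain y where y: "\<And>l. y l \<in> U" "\<And>l. y' l = g (y l)"
    using lift_sequence[of y'] y'(2) by blast
  define e where "e i = (if i < b (Suc p) then del p E y i else \<zero>\<^bsub>E\<^esub>)" for i
  have "e \<in> coboundaries p E U"
    by (rule coboundariesI[of e U y])
      (use y(1) del_in_submodule[OF E U y(1)] UD(1) in \<open>auto simp: e_def\<close>)
  then have "e \<in> cocycles p E U" using coboundaries_subset_cocycles[OF E U] by blast
  moreover have "z i = g (e i)" if "i < b (Suc p)" for i
  proof -
    have "y' = (\<lambda>l. g (y l))" using y(2) by blast
    then show ?thesis using g_del[of y p i] y(1) y'(3)[OF that] that by (simp add: e_def)
  qed
  ultimately show "z \<in> lifted p" using y'(1) by (intro liftedI)
qed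

lemma image_cocycle:
  assumes e: "e \<in> cocycles p E U"
  shows "(\<lambda>i. g (e i)) \<in> cocycles p E' U'"
proof (rule cocyclesI)
  show "g (e i) \<in> U'" for i using gU cocyclesD(1)[OF e] by blast
  show "del (Suc p) E' (\<lambda>i. g (e i)) k = \<zero>\<^bsub>E'\<^esub>" if "k < b (Suc (Suc p))" for k
    using g_del[of e "Suc p" k] cocyclesD[OF e] that g_zero by simp
qed

lemma lifted_subset: "lifted p \<subseteq> cocycles p E' U'"
proof
  fix z assume "z \<in> lifted p"
  then obtain e where e: "\<And>i. z i \<in> U'" "e \<in> cocycles p E U" "\<And>i. i < b (Suc p) \<Longrightarrow> z i = g (e i)"
    unfolding lifted_def by blast
  show "z \<in> cocycles p E' U'"
  proof (rule cocyclesI[OF e(1)])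
    show "del (Suc p) E' z k = \<zero>\<^bsub>E'\<^esub>" if "k < b (Suc (Suc p))" for k
      using del_cong[of "Suc p" z "\<lambda>i. g (e i)" E' k] e(3) cocyclesD(2)[OF image_cocycle[OF e(2)] that] by simp
  qed
qed

lemma submodule_lifted: "submodule (lifted p) R (sequence_module E')"
proof (rule module.submodule_criterion[OF seqE'])
  show "lifted p \<subseteq> carrier (sequence_module E')" using U'D(2) by (auto simp: lifted_def)
  show "\<zero>\<^bsub>sequence_module E'\<^esub> \<in> lifted p"
    using coboundaries_lifted module.submoduleD(1)[OF seqE' submodule_coboundaries[OF E' U']] by blast
  note cD = module.submoduleD[OF seqE submodule_cocycles[OF E U, of p]]
  fix z z' assume "z \<in> lifted p" "z' \<in> lifted p"
  then obtain e e' where e: "\<And>i. z i \<in> U'" "e \<in> cocycles p E U" "\<And>i. i < b (Suc p) \<Longrightarrow> z i = g (e i)"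
    and e': "\<And>i. z' i \<in> U'" "e' \<in> cocycles p E U" "\<And>i. i < b (Suc p) \<Longrightarrow> z' i = g (e' i)"
    by (elim liftedE) blast
  have "e \<oplus>\<^bsub>sequence_module E\<^esub> e' \<in> cocycles p E U" by (rule cD(3)[OF e(2) e'(2)])
  moreover have "(z \<oplus>\<^bsub>sequence_module E'\<^esub> z') i = g ((e \<oplus>\<^bsub>sequence_module E\<^esub> e') i)" if "i < b (Suc p)" for i
    using e(3) e'(3) that gD(2) cocyclesD(1)[OF e(2)] cocyclesD(1)[OF e'(2)] by simp
  ultimately show "z \<oplus>\<^bsub>sequence_module E'\<^esub> z' \<in> lifted p"
    unfolding lifted_def using U'D(3) e(1) e'(1) by auto
next
  note cD = module.submoduleD[OF seqE submodule_cocycles[OF E U, of p]]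
  fix r z assume r: "r \<in> carrier R" and "z \<in> lifted p"
  then obtain e where e: "\<And>i. z i \<in> U'" "e \<in> cocycles p E U" "\<And>i. i < b (Suc p) \<Longrightarrow> z i = g (e i)"
    unfolding lifted_def by blast
  have "r \<odot>\<^bsub>sequence_module E\<^esub> e \<in> cocycles p E U" by (rule cD(6)[OF r e(2)])
  moreover have "(r \<odot>\<^bsub>sequence_module E'\<^esub> z) i = g ((r \<odot>\<^bsub>sequence_module E\<^esub> e) i)" if "i < b (Suc p)" for i
    using e(3) that gD(3) r cocyclesD(1)[OF e(2)] by simp
  ultimately show "r \<odot>\<^bsub>sequence_module E'\<^esub> z \<in> lifted p"
    unfolding lifted_def using U'D(6) e(1) r by auto
qed

text \<open>Exactness at Ext^p(R/I, U'): modulo the image of Ext^p(R/I, U), it embeds into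
  Ext^(p+1)(R/I, K).\<close>

lemma shift_embed:
  assumes "ext_in (Suc p) E K"
  shows "subquotient_in R S (sequence_module E') (cocycles p E' U') (lifted p)"
  by (rule subquotient_embed[OF seqE' seqE submodule_cocycles[OF E' U'] submodule_cocycles[OF E K]
        connecting_linear connecting_total connecting_kernel
        module.submoduleD(1)[OF seqE' submodule_lifted] assms[unfolded ext_in_def]])

text \<open>The assumption says Ext^(p+1)(R/I, U) = 0, which makes the connecting homomorphism
  surjective: a cocycle in \<open>K\<close> has a primitive in \<open>U\<close>, and
  \<open>g\<close> sends this primitive to a cocycle in \<open>U'\<close>.\<close>

lemma shift_iff:
  assumes ac: "cocycles (Suc p) E U \<subseteq> coboundaries (Suc p) E U"
  shows "subquotient_in R S (sequence_module E') (cocycles p E' U') (lifted p) \<longleftrightarrow> ext_in (Suc p) E K"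
  unfolding ext_in_def
proof (rule subquotient_iso[OF seqE' seqE submodule_cocycles[OF E' U'] submodule_cocycles[OF E K]
        connecting_linear connecting_total _ connecting_kernel
        module.submoduleD(1)[OF seqE' submodule_lifted]
        module.submoduleD(1)[OF seqE submodule_coboundaries[OF E K]]])
  fix y assume y: "y \<in> cocycles (Suc p) E K"
  then have "y \<in> cocycles (Suc p) E U" using K_subset by (auto simp: cocycles_def)
  then have "y \<in> coboundaries (Suc p) E U" using ac by blast
  then obtain e where e: "\<And>l. e l \<in> U" "\<And>i. i < b (Suc (Suc p)) \<Longrightarrow> y i = del (Suc p) E e i"
    by (rule coboundariesE) blast
  have "(\<lambda>i. g (e i)) \<in> cocycles p E' U'"
  proof (rule cocyclesI)
    show "g (e i) \<in> U'" for i using gU e(1) by blast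
    show "del (Suc p) E' (\<lambda>i. g (e i)) k = \<zero>\<^bsub>E'\<^esub>" if k: "k < b (Suc (Suc p))" for k
      using g_del[of e "Suc p" k] e(1) e(2)[OF k] cocyclesD(1)[OF y, of k] by (simp add: K_eq)
  qed
  moreover have "connecting p (\<lambda>i. g (e i)) y" unfolding connecting_def using e by blast
  ultimately show "\<exists>z\<in>cocycles p E' U'. connecting p z y" by blast
qed

text \<open>If Ext^p(R/I, U) vanishes, so does its image in Ext^p(R/I, U').\<close>

lemma lifted_eq_coboundaries:
  assumes ac: "cocycles p E U \<subseteq> coboundaries p E U"
  shows "lifted p = coboundaries p E' U'"
proof
  show "lifted p \<subseteq> coboundaries p E' U'"
  proof
    fix z assume "z \<in> lifted p"
    then obtain e where e: "\<And>i. z i \<in> U'" "e \<in> cocycles p E U" "\<And>i. i < b (Suc p) \<Longrightarrow> z i = g (e i)"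
      by (rule liftedE) blast
    then have "e \<in> coboundaries p E U" using ac by blast
    then obtain y where y: "\<And>l. y l \<in> U" "\<And>i. i < b (Suc p) \<Longrightarrow> e i = del p E y i"
      by (rule coboundariesE) blast
    show "z \<in> coboundaries p E' U'"
      by (rule coboundariesI[of z U' "\<lambda>l. g (y l)"])
        (use e(1,3) y gU g_del[of y p] in auto)
  qed
qed (rule coboundaries_lifted)

lemma dimension_shift:
  assumes "cocycles (Suc p) E U \<subseteq> coboundaries (Suc p) E U" "cocycles p E U \<subseteq> coboundaries p E U"
  shows "ext_in p E' U' \<longleftrightarrow> ext_in (Suc p) E K"
  using shift_iff[OF assms(1)] unfolding lifted_eq_coboundaries[OF assms(2)] ext_in_def .

text \<open>The kernel of Ext^p(R/I, U) -> Ext^p(R/I, U'), on the level of cocycles.\<close>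

definition preboundaries :: "nat \<Rightarrow> (nat \<Rightarrow> 'm) set" where
  "preboundaries p = {z \<in> cocycles p E U. (\<lambda>i. g (z i)) \<in> coboundaries p E' U'}"

lemma linear_on_sequence:
  "linear_on R (sequence_module E) (sequence_module E') (cocycles p E U) (\<lambda>z i. g (z i))"
proof (rule linear_onI)
  fix x assume x: "x \<in> cocycles p E U"
  then show "(\<lambda>i. g (x i)) \<in> carrier (sequence_module E')" using gD(1) cocyclesD(1)[OF x] by simp
  fix y assume y: "y \<in> cocycles p E U"
  show "(\<lambda>i. g ((x \<oplus>\<^bsub>sequence_module E\<^esub> y) i)) = (\<lambda>i. g (x i)) \<oplus>\<^bsub>sequence_module E'\<^esub> (\<lambda>i. g (y i))"
    using gD(2) cocyclesD(1)[OF x] cocyclesD(1)[OF y] by simp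
next
  fix r x assume r: "r \<in> carrier R" and x: "x \<in> cocycles p E U"
  then show "(\<lambda>i. g ((r \<odot>\<^bsub>sequence_module E\<^esub> x) i)) = r \<odot>\<^bsub>sequence_module E'\<^esub> (\<lambda>i. g (x i))"
    using gD(3) cocyclesD(1)[OF x] by simp
qed

lemma submodule_preboundaries: "submodule (preboundaries p) R (sequence_module E)"
  unfolding preboundaries_def
  by (rule linear_on_vimage[OF seqE seqE' submodule_cocycles[OF E U] linear_on_sequence
        submodule_coboundaries[OF E' U']])

text \<open>Exactness at Ext^p(R/I, U), filtered by the kernel \<open>preboundaries\<close>: the
  part above the kernel embeds into Ext^p(R/I, U'), and the kernel is a quotient of Ext^p(R/I,
  K).\<close>

lemma ext_in_middle:
  assumes extK: "ext_in p E K" and extU': "ext_in p E' U'"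
  shows "ext_in p E U"
proof -
  have 1: "subquotient_in R S (sequence_module E) (cocycles p E U) (preboundaries p)"
  proof (rule subquotient_embed[OF seqE seqE' submodule_cocycles[OF E U] submodule_cocycles[OF E' U']
        _ _ _ _ extU'[unfolded ext_in_def]])
    show "linear_relation R (sequence_module E) (sequence_module E')
        (\<lambda>z y. z \<in> cocycles p E U \<and> y = (\<lambda>i. g (z i)))"
      using linear_onD[OF linear_on_sequence[of p]] module.submoduleD(3,6)[OF seqE submodule_cocycles[OF E U, of p]]
      by (auto intro!: linear_relationI simp del: sequence_module_simps)
  qed (use image_cocycle module.submoduleD(1)[OF seqE submodule_preboundaries[of p]] in \<open>auto simp: preboundaries_def\<close>)
  \<comment> \<open>\<open>L\<close> is the kernel of Ext^p(R/I, K) -> Ext^p(R/I, U) on cocycles: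
    those that acquire a primitive in the larger module \<open>U\<close>.\<close>
  define L where "L = cocycles p E K \<inter> coboundaries p E U"
  have L: "submodule L R (sequence_module E)"
    by (rule module.submodule_criterion[OF seqE])
      (use module.submoduleD[OF seqE submodule_cocycles[OF E K, of p]]
        module.submoduleD[OF seqE submodule_coboundaries[OF E U, of p]] in \<open>auto simp: L_def\<close>)
  have "coboundaries p E K \<subseteq> L"
  proof
    fix x assume x: "x \<in> coboundaries p E K"
    then obtain u where "\<And>i. x i \<in> K" "\<And>l. u l \<in> K" "\<And>i. i < b (Suc p) \<Longrightarrow> x i = del p E u i"
      by (rule coboundariesE) blast
    then have "x \<in> coboundaries p E U" using K_subset by (intro coboundariesI[of x U u]) auto
    then show "x \<in> L" using x coboundaries_subset_cocycles[OF E K, of p] by (auto simp: L_def)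
  qed
  then have sqL: "subquotient_in R S (sequence_module E) (cocycles p E K) L"
    by (intro subquotient_quotient[OF seqE submodule_cocycles[OF E K] L _ _ extK[unfolded ext_in_def]])
      (auto simp: L_def)
  note BD = module.submoduleD[OF seqE submodule_coboundaries[OF E U, of p]]
  interpret SE: module R "sequence_module E" by (rule seqE)
  \<comment> \<open>The relation matches a cocycle of \<open>U\<close> with a cohomologous cocycle
    of \<open>K\<close>; this identifies the kernel with the cocycles of \<open>K\<close> modulo
    \<open>L\<close>.\<close>
  have 2: "subquotient_in R S (sequence_module E) (preboundaries p) (coboundaries p E U)"
  proof (rule subquotient_embed[OF seqE seqE submodule_preboundaries submodule_cocycles[OF E K]
        _ _ _ BD(1) sqL])
    show "linear_relation R (sequence_module E) (sequence_module E)
        (\<lambda>z y. z \<ominus>\<^bsub>sequence_module E\<^esub> y \<in> coboundaries p E U)"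
    proof (rule linear_relationI)
      fix x y x' y' assume "x \<ominus>\<^bsub>sequence_module E\<^esub> y \<in> coboundaries p E U"
        "x' \<ominus>\<^bsub>sequence_module E\<^esub> y' \<in> coboundaries p E U"
        "x \<in> carrier (sequence_module E)" "x' \<in> carrier (sequence_module E)"
        "y \<in> carrier (sequence_module E)" "y' \<in> carrier (sequence_module E)"
      then show "(x \<oplus>\<^bsub>sequence_module E\<^esub> x') \<ominus>\<^bsub>sequence_module E\<^esub> (y \<oplus>\<^bsub>sequence_module E\<^esub> y') \<in> coboundaries p E U"
        using BD(3) SE.add_diff_add by presburger
    next
      fix r x y assume "r \<in> carrier R" "x \<in> carrier (sequence_module E)" "y \<in> carrier (sequence_module E)"
        "x \<ominus>\<^bsub>sequence_module E\<^esub> y \<in> coboundaries p E U"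
      then show "r \<odot>\<^bsub>sequence_module E\<^esub> x \<ominus>\<^bsub>sequence_module E\<^esub> r \<odot>\<^bsub>sequence_module E\<^esub> y \<in> coboundaries p E U"
        using BD(6) SE.smult_r_diff by metis
    qed
  next
    fix z assume z: "z \<in> preboundaries p"
    then have zc: "z \<in> cocycles p E U" and "(\<lambda>i. g (z i)) \<in> coboundaries p E' U'"
      by (auto simp: preboundaries_def)
    from this(2) obtain y' where y': "\<And>l. y' l \<in> U'" "\<And>i. i < b (Suc p) \<Longrightarrow> g (z i) = del p E' y' i"
      by (rule coboundariesE) blast
    obtain y where y: "\<And>l. y l \<in> U" "\<And>l. y' l = g (y l)"
      using lift_sequence[of y'] y'(1) by blast
    have yE: "y l \<in> carrier E" for l using y(1) UD(2) by blast
    have zU: "z i \<in> U" "z i \<in> carrier E" for i using cocyclesD(1)[OF zc] UD(2) by blast+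
    have y'eq: "y' = (\<lambda>l. g (y l))" using y(2) by blast
    have dU: "del p E y i \<in> U" "del p E y i \<in> carrier E" for i
      using del_in_submodule[OF E U y(1), where p = p and i = i] UD(2)[of "del p E y i"] by simp_all
    \<comment> \<open>A primitive of the image of \<open>z\<close> has been lifted to
      \<open>y\<close>; subtracting its differential moves \<open>z\<close> into \<open>K\<close>
      without changing its class.\<close>
    define w where "w i = (if i < b (Suc p) then z i \<ominus>\<^bsub>E\<^esub> del p E y i else \<zero>\<^bsub>E\<^esub>)" for i
    have wK: "w i \<in> K" for i
    proof (cases "i < b (Suc p)")
      case True
      then have "g (z i \<ominus>\<^bsub>E\<^esub> del p E y i) = \<zero>\<^bsub>E'\<^esub>"
        using g_diff[OF zU(1) dU(1), of i i] g_del[of y p i] y(1) y'(2)[OF True] gD(1)[OF zU(1)]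
          E'.diff_eq_zero_iff unfolding y'eq by metis
      then show ?thesis using True UD(4)[OF zU(1) dU(1)] by (simp add: w_def K_eq)
    qed (simp add: w_def KD(1))
    have "w \<in> cocycles p E K"
    proof (rule cocyclesI[OF wK])
      fix k assume k: "k < b (Suc (Suc p))"
      have "del (Suc p) E w k = del (Suc p) E (\<lambda>i. z i \<ominus>\<^bsub>E\<^esub> del p E y i) k"
        by (rule del_cong) (simp add: w_def)
      also have "\<dots> = del (Suc p) E z k \<ominus>\<^bsub>E\<^esub> del (Suc p) E (del p E y) k"
        by (rule del_diff[OF E zU(2) dU(2)])
      also have "\<dots> = \<zero>\<^bsub>E\<^esub>"
        using del_del[OF E yE k refl] cocyclesD(2)[OF zc k] by (simp add: E.diff_zero)
      finally show "del (Suc p) E w k = \<zero>\<^bsub>E\<^esub>" .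
    qed
    moreover have "z \<ominus>\<^bsub>sequence_module E\<^esub> w \<in> coboundaries p E U"
    proof (rule coboundariesI[of _ _ y])
      have eq: "z \<ominus>\<^bsub>sequence_module E\<^esub> w = (\<lambda>i. z i \<ominus>\<^bsub>E\<^esub> w i)"
        by (rule E.sequence_module_diff) (use zU wK KD(2) in auto)
      show "(z \<ominus>\<^bsub>sequence_module E\<^esub> w) i \<in> U" for i
        unfolding eq using UD(4)[OF zU(1)] wK K_subset by blast
      show "y l \<in> U" for l by (rule y(1))
      show "(z \<ominus>\<^bsub>sequence_module E\<^esub> w) i = del p E y i" if "i < b (Suc p)" for i
        unfolding eq using that E.diff_diff_cancel[of "z i" "\<zero>\<^bsub>E\<^esub>" "del p E y i"] zU(2) dU(2)
        by (simp add: w_def E.diff_zero)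
    qed
    ultimately show "\<exists>y\<in>cocycles p E K. z \<ominus>\<^bsub>sequence_module E\<^esub> y \<in> coboundaries p E U" by blast
  next
    fix z y assume z: "z \<in> preboundaries p" and y: "y \<in> cocycles p E K"
      and zy: "z \<ominus>\<^bsub>sequence_module E\<^esub> y \<in> coboundaries p E U"
    have zE: "z \<in> carrier (sequence_module E)" and yE: "y \<in> carrier (sequence_module E)"
      using z y SE.submoduleD(2)[OF submodule_preboundaries] SE.submoduleD(2)[OF submodule_cocycles[OF E K]]
      by blast+
    show "y \<in> L \<longleftrightarrow> z \<in> coboundaries p E U"
    proof
      assume "y \<in> L"
      then have "y \<in> coboundaries p E U" by (simp add: L_def)
      then have "(z \<ominus>\<^bsub>sequence_module E\<^esub> y) \<oplus>\<^bsub>sequence_module E\<^esub> y \<in> coboundaries p E U" using BD(3)[OF zy] by blast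
      then show "z \<in> coboundaries p E U" using SE.diff_add_cancel(1)[OF zE yE] by simp
    next
      assume "z \<in> coboundaries p E U"
      then have "z \<ominus>\<^bsub>sequence_module E\<^esub> (z \<ominus>\<^bsub>sequence_module E\<^esub> y) \<in> coboundaries p E U" using BD(4) zy by blast
      also have "z \<ominus>\<^bsub>sequence_module E\<^esub> (z \<ominus>\<^bsub>sequence_module E\<^esub> y) = y"
        using SE.diff_diff_cancel[OF zE SE.zero_closed yE] SE.diff_zero[OF zE] SE.diff_zero[OF yE] by metis
      finally show "y \<in> L" using y by (simp add: L_def)
    qed
  qed
  have "coboundaries p E U \<subseteq> preboundaries p"
  proof
    fix x assume x: "x \<in> coboundaries p E U"
    then obtain y where y: "\<And>i. x i \<in> U" "\<And>l. y l \<in> U" "\<And>i. i < b (Suc p) \<Longrightarrow> x i = del p E y i"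
      by (rule coboundariesE) blast
    have "(\<lambda>i. g (x i)) \<in> coboundaries p E' U'"
      by (rule coboundariesI[of _ U' "\<lambda>l. g (y l)"]) (use y gU g_del[of y p] in auto)
    then show "x \<in> preboundaries p"
      using x coboundaries_subset_cocycles[OF E U] by (auto simp: preboundaries_def)
  qed
  then show ?thesis unfolding ext_in_def
    by (intro subquotient_extension[OF seqE submodule_cocycles[OF E U] submodule_preboundaries
        submodule_coboundaries[OF E U] _ _ 2 1]) (auto simp: preboundaries_def)
qed

text \<open>Ext^p(R/I, U') is an extension of a submodule of Ext^(p+1)(R/I, K) by the image of
  Ext^p(R/I, U). About the latter group only a quotient by some \<open>T\<close> below the kernel
  has to be known; this covers the case where Hom(R/I, Z^s) is controlled only modulo the
  coboundaries of Hom(R/I, E).\<close>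

lemma ext_in_quotient:
  assumes T: "T \<subseteq> preboundaries p" "subquotient_in R S (sequence_module E) (cocycles p E U) T"
    and extK: "ext_in (Suc p) E K"
  shows "ext_in p E' U'"
proof -
  have sq: "subquotient_in R S (sequence_module E) (cocycles p E U) (preboundaries p)"
    by (rule subquotient_quotient[OF seqE submodule_cocycles[OF E U] submodule_preboundaries _ T])
      (auto simp: preboundaries_def)
  \<comment> \<open>Passing to a lift embeds the image of Ext^p(R/I, U) into the cocycles of
    \<open>U\<close> modulo \<open>preboundaries\<close>.\<close>
  have "subquotient_in R S (sequence_module E') (lifted p) (coboundaries p E' U')"
  proof (rule subquotient_embed[OF seqE' seqE submodule_lifted submodule_cocycles[OF E U] _ _ _
        module.submoduleD(1)[OF seqE' submodule_coboundaries[OF E' U']] sq])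
    show "linear_relation R (sequence_module E') (sequence_module E)
        (\<lambda>z x. (\<forall>i. x i \<in> U) \<and> (\<forall>i<b (Suc p). z i = g (x i)))"
      by (rule linear_relationI) (use gD(2,3) UD(3,6) in auto)
    show "\<exists>x\<in>cocycles p E U. (\<forall>i. x i \<in> U) \<and> (\<forall>i<b (Suc p). z i = g (x i))" if z: "z \<in> lifted p" for z
    proof -
      obtain x where "x \<in> cocycles p E U" "\<And>i. i < b (Suc p) \<Longrightarrow> z i = g (x i)"
        using z by (rule liftedE) blast
      then show ?thesis using cocyclesD(1)[of x p E U] by blast
    qed
    fix z x assume z: "z \<in> lifted p" and x: "x \<in> cocycles p E U"
      and zx: "(\<forall>i. x i \<in> U) \<and> (\<forall>i<b (Suc p). z i = g (x i))"
    have "(\<lambda>i. g (x i)) \<in> coboundaries p E' U' \<longleftrightarrow> z \<in> coboundaries p E' U'"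
      unfolding coboundaries_def using z zx gU by (auto simp: lifted_def)
    then show "x \<in> preboundaries p \<longleftrightarrow> z \<in> coboundaries p E' U'"
      using x by (simp add: preboundaries_def)
  qed
  then show ?thesis unfolding ext_in_def
    by (intro subquotient_extension[OF seqE' submodule_cocycles[OF E' U'] submodule_lifted
        submodule_coboundaries[OF E' U'] coboundaries_lifted lifted_subset _ shift_embed[OF extK]])
qed

end

section \<open>Injective resolutions\<close>

text \<open>Zorn's lemma is applied to the graphs of partial extensions.\<close>

lemma divisible_extension:
  fixes B :: "('b, 'c) monoid_scheme" and D :: "('d, 'e) monoid_scheme"
  assumes B: "comm_group B" and D: "comm_group D"
    and div: "\<And>(n::nat) d. 0 < n \<Longrightarrow> d \<in> carrier D \<Longrightarrow> \<exists>d'\<in>carrier D. d' [^]\<^bsub>D\<^esub> n = d"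
    and A: "subgroup A B" and g: "g \<in> hom (B\<lparr>carrier := A\<rparr>) D"
  shows "\<exists>h\<in>hom B D. \<forall>a\<in>A. h a = g a"
proof -
  interpret B: comm_group B by fact
  interpret D: comm_group D by fact
  interpret A: subgroup A B by fact
  interpret P: group "B \<times>\<times> D" by (rule DirProd_group) (rule B.is_group D.is_group)+
  let ?P = "B \<times>\<times> D"
  have gA: "g a \<in> carrier D" "g (a \<otimes>\<^bsub>B\<^esub> a') = g a \<otimes>\<^bsub>D\<^esub> g a'" if "a \<in> A" "a' \<in> A" for a a'
    using g that by (auto simp: hom_def)
  have g1: "g \<one>\<^bsub>B\<^esub> = \<one>\<^bsub>D\<^esub>"
  proof -
    have "g \<one>\<^bsub>B\<^esub> \<otimes>\<^bsub>D\<^esub> g \<one>\<^bsub>B\<^esub> = g \<one>\<^bsub>B\<^esub>"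
      using gA(2)[of "\<one>\<^bsub>B\<^esub>" "\<one>\<^bsub>B\<^esub>"] A.one_closed by simp
    then show ?thesis using gA(1)[OF A.one_closed A.one_closed] D.r_cancel_one' by metis
  qed
  have ginv: "g (inv\<^bsub>B\<^esub> a) = inv\<^bsub>D\<^esub> g a" if a: "a \<in> A" for a
  proof -
    have "g (inv\<^bsub>B\<^esub> a) \<otimes>\<^bsub>D\<^esub> g a = \<one>\<^bsub>D\<^esub>"
      using gA(2)[OF A.m_inv_closed[OF a] a] a g1 by simp
    then show ?thesis using gA(1) A.m_inv_closed a D.inv_equality by metis
  qed
  define \<G> where "\<G> = {G. subgroup G ?P \<and> (\<forall>d. (\<one>\<^bsub>B\<^esub>, d) \<in> G \<longrightarrow> d = \<one>\<^bsub>D\<^esub>) \<and> (\<lambda>a. (a, g a)) ` A \<subseteq> G}"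
  have "\<exists>G\<in>\<G>. \<forall>X\<in>\<G>. G \<subseteq> X \<longrightarrow> X = G"
  proof (rule subset_Zorn_nonempty)
    have "subgroup ((\<lambda>a. (a, g a)) ` A) ?P"
    proof (rule P.subgroupI)
      show "(\<lambda>a. (a, g a)) ` A \<noteq> {}" using A.one_closed by blast
      show "inv\<^bsub>?P\<^esub> x \<in> (\<lambda>a. (a, g a)) ` A" if x: "x \<in> (\<lambda>a. (a, g a)) ` A" for x
      proof -
        obtain a where "a \<in> A" "x = (a, g a)" using x by blast
        then show ?thesis using gA(1) ginv
          by (intro image_eqI[of _ _ "inv\<^bsub>B\<^esub> a"]) (auto simp: B.is_group D.is_group)
      qed
      show "x \<otimes>\<^bsub>?P\<^esub> y \<in> (\<lambda>a. (a, g a)) ` A"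
        if "x \<in> (\<lambda>a. (a, g a)) ` A" "y \<in> (\<lambda>a. (a, g a)) ` A" for x y
        using that gA(2) by (auto intro!: image_eqI)
    qed (use gA(1) in auto)
    then have "(\<lambda>a. (a, g a)) ` A \<in> \<G>" using g1 by (auto simp: \<G>_def)
    then show "\<G> \<noteq> {}" by blast
    fix C assume C: "C \<noteq> {}" "subset.chain \<G> C"
    have C\<G>: "X \<in> \<G>" if "X \<in> C" for X using C(2) that by (auto simp: subset_chain_def)
    have Csub: "subgroup X ?P" if "X \<in> C" for X using C\<G>[OF that] by (simp add: \<G>_def)
    have "subgroup (\<Union>C) ?P"
    proof (rule P.subgroupI)
      show "\<Union>C \<subseteq> carrier ?P" using subgroup.subset[OF Csub] by blast
      show "\<Union>C \<noteq> {}" using C(1) subgroup.one_closed[OF Csub] by blast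
      show "inv\<^bsub>?P\<^esub> x \<in> \<Union>C" if "x \<in> \<Union>C" for x
        using that subgroup.m_inv_closed[OF Csub] by blast
      fix x y assume "x \<in> \<Union>C" "y \<in> \<Union>C"
      then obtain X Y where XY: "X \<in> C" "x \<in> X" "Y \<in> C" "y \<in> Y" by blast
      then have "X \<subseteq> Y \<or> Y \<subseteq> X" using C(2) by (auto simp: subset_chain_def)
      then obtain Z where "Z \<in> C" "x \<in> Z" "y \<in> Z" using XY by blast
      then show "x \<otimes>\<^bsub>?P\<^esub> y \<in> \<Union>C" using subgroup.m_closed[OF Csub] by blast
    qed
    then show "\<Union>C \<in> \<G>" using C\<G> C(1) by (fastforce simp: \<G>_def)
  qed
  then obtain G where G\<G>: "G \<in> \<G>" and max: "\<And>X. X \<in> \<G> \<Longrightarrow> G \<subseteq> X \<Longrightarrow> X = G" by blast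
  have Gs: "subgroup G ?P" and Gu: "\<And>d. (\<one>\<^bsub>B\<^esub>, d) \<in> G \<Longrightarrow> d = \<one>\<^bsub>D\<^esub>"
    and Gg: "\<And>a. a \<in> A \<Longrightarrow> (a, g a) \<in> G" using G\<G> by (auto simp: \<G>_def)
  have GB: "x \<in> carrier B" and GD: "y \<in> carrier D" if "(x, y) \<in> G" for x y
    using subgroup.subset[OF Gs] that by auto
  have G1: "(\<one>\<^bsub>B\<^esub>, \<one>\<^bsub>D\<^esub>) \<in> G" using subgroup.one_closed[OF Gs] by simp
  have Gm: "(x \<otimes>\<^bsub>B\<^esub> x', y \<otimes>\<^bsub>D\<^esub> y') \<in> G" if "(x, y) \<in> G" "(x', y') \<in> G" for x y x' y'
    using subgroup.m_closed[OF Gs that] by simp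
  have Gi: "(inv\<^bsub>B\<^esub> x, inv\<^bsub>D\<^esub> y) \<in> G" if "(x, y) \<in> G" for x y
    using subgroup.m_inv_closed[OF Gs that] GB[OF that] GD[OF that] by (simp add: B.is_group D.is_group)
  have Gpn: "(x [^]\<^bsub>B\<^esub> n, y [^]\<^bsub>D\<^esub> n) \<in> G" if "(x, y) \<in> G" for x y and n :: nat
    by (induction n) (use G1 Gm that in auto)
  have Gp: "(x [^]\<^bsub>B\<^esub> n, y [^]\<^bsub>D\<^esub> n) \<in> G" if "(x, y) \<in> G" for x y and n :: int
    unfolding int_pow_def2 using Gpn[OF that, of "nat n"] Gi[OF Gpn[OF that, of "nat (- n)"]]
    by (cases "n < 0") (simp_all only: if_True if_False)
  have "\<exists>y. (b, y) \<in> G" if b: "b \<in> carrier B" for b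
  proof -
    \<comment> \<open>A value \<open>d\<close> for \<open>b\<close> is admissible if it respects the
      values already fixed on powers of \<open>b\<close>. These powers are all powers of the least
      positive one in the domain, so a root of its value will do.\<close>
    have "\<exists>d\<in>carrier D. \<forall>n::int. \<forall>y. (b [^]\<^bsub>B\<^esub> n, y) \<in> G \<longrightarrow> y = d [^]\<^bsub>D\<^esub> n"
    proof (cases "\<exists>n::nat. 0 < n \<and> (\<exists>y. (b [^]\<^bsub>B\<^esub> n, y) \<in> G)")
      case True
      define k where "k = (LEAST n::nat. 0 < n \<and> (\<exists>y. (b [^]\<^bsub>B\<^esub> n, y) \<in> G))"
      have "0 < k \<and> (\<exists>y. (b [^]\<^bsub>B\<^esub> k, y) \<in> G)" unfolding k_def by (rule LeastI_ex[OF True])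
      then obtain c where k: "0 < k" "(b [^]\<^bsub>B\<^esub> k, c) \<in> G" by blast
      obtain d where d: "d \<in> carrier D" "d [^]\<^bsub>D\<^esub> k = c" using div[OF k(1) GD[OF k(2)]] by blast
      have least: "\<not> (0 < m \<and> (\<exists>y. (b [^]\<^bsub>B\<^esub> m, y) \<in> G))" if "m < k" for m :: nat
        using not_less_Least[of m] that unfolding k_def by blast
      have "y = d [^]\<^bsub>D\<^esub> n" if n: "(b [^]\<^bsub>B\<^esub> n, y) \<in> G" for n :: int and y
      proof -
        \<comment> \<open>Division with remainder: the remainder of \<open>n\<close> modulo
          \<open>k\<close> is again an exponent in the domain, so it is 0 by minimality of
          \<open>k\<close>.\<close>
        define q where "q = - (n div int k)"
        have "((b [^]\<^bsub>B\<^esub> int k) [^]\<^bsub>B\<^esub> q, (d [^]\<^bsub>D\<^esub> int k) [^]\<^bsub>D\<^esub> q) \<in> G"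
          using Gp[OF k(2), of q] d(2) by (simp add: int_pow_int)
        then have "(b [^]\<^bsub>B\<^esub> (int k * q), d [^]\<^bsub>D\<^esub> (int k * q)) \<in> G"
          using b d(1) by (simp add: B.int_pow_pow D.int_pow_pow)
        from Gm[OF n this] have r: "(b [^]\<^bsub>B\<^esub> (n + int k * q), y \<otimes>\<^bsub>D\<^esub> d [^]\<^bsub>D\<^esub> (int k * q)) \<in> G"
          using b by (simp add: B.int_pow_mult)
        have nk: "n + int k * q = n mod int k"
          unfolding q_def using minus_mult_div_eq_mod[of n "int k"] by simp
        have "n mod int k = int (nat (n mod int k))" "nat (n mod int k) < k" using k(1) by (simp_all add: nat_less_iff)
        then have "nat (n mod int k) = 0"
          using least[of "nat (n mod int k)"] r unfolding nk by (metis int_pow_int neq0_conv)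
        then have 0: "n + int k * q = 0" using nk k(1) \<open>n mod int k = int (nat (n mod int k))\<close> by simp
        then have "y \<otimes>\<^bsub>D\<^esub> d [^]\<^bsub>D\<^esub> (- n) = \<one>\<^bsub>D\<^esub>"
        proof -
          have "int k * q = - n" using 0 by simp
          then show ?thesis using Gu r by simp
        qed
        then show ?thesis
          using GD[OF n] d(1) D.inv_equality[of y "d [^]\<^bsub>D\<^esub> (- n)"] by (simp add: D.int_pow_neg)
      qed
      then show ?thesis using d(1) by blast
    next
      case False
      \<comment> \<open>No power of \<open>b\<close> with nonzero exponent is in the domain, so
        nothing is prescribed and the unit can serve as \<open>d\<close>.\<close>
      have "y = \<one>\<^bsub>D\<^esub> [^]\<^bsub>D\<^esub> n" if n: "(b [^]\<^bsub>B\<^esub> n, y) \<in> G" for n :: int and y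
      proof (cases "n = 0")
        case True
        then show ?thesis using Gu n by simp
      next
        case n0: False
        have "(b [^]\<^bsub>B\<^esub> (- n), inv\<^bsub>D\<^esub> y) \<in> G" using Gi[OF n] b by (simp add: B.int_pow_neg)
        then have "\<exists>y. (b [^]\<^bsub>B\<^esub> \<bar>n\<bar>, y) \<in> G" using n by (auto simp: abs_if)
        moreover have "b [^]\<^bsub>B\<^esub> \<bar>n\<bar> = b [^]\<^bsub>B\<^esub> nat \<bar>n\<bar>" by (metis abs_ge_zero int_nat_eq int_pow_int)
        ultimately have "\<exists>y. (b [^]\<^bsub>B\<^esub> nat \<bar>n\<bar>, y) \<in> G" by (simp only:)
        moreover have "0 < nat \<bar>n\<bar>" using n0 by simp
        ultimately show ?thesis using False by blast
      qed
      then show ?thesis using D.one_closed by blast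
    qed
    then obtain d where d: "d \<in> carrier D" "\<And>(n::int) y. (b [^]\<^bsub>B\<^esub> n, y) \<in> G \<Longrightarrow> y = d [^]\<^bsub>D\<^esub> n" by blast
    \<comment> \<open>The subgroup generated by \<open>G\<close> and \<open>(b, d)\<close>;
      maximality of \<open>G\<close> then shows that \<open>b\<close> was in its domain.\<close>
    define G' where "G' = {(x \<otimes>\<^bsub>B\<^esub> b [^]\<^bsub>B\<^esub> n, y \<otimes>\<^bsub>D\<^esub> d [^]\<^bsub>D\<^esub> n) |x y (n::int). (x, y) \<in> G}"
    have G'I: "z \<in> G'" if "(x, y) \<in> G" "z = (x \<otimes>\<^bsub>B\<^esub> b [^]\<^bsub>B\<^esub> n, y \<otimes>\<^bsub>D\<^esub> d [^]\<^bsub>D\<^esub> n)" for x y z and n :: int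
      using that by (auto simp: G'_def)
    have "subgroup G' ?P"
    proof (rule P.subgroupI)
      show "G' \<subseteq> carrier ?P" using GB GD b d(1) by (auto simp: G'_def)
      show "G' \<noteq> {}" using G'I[OF G1 refl] by blast
    next
      fix z assume "z \<in> G'"
      then obtain x y and n :: int where z: "(x, y) \<in> G" "z = (x \<otimes>\<^bsub>B\<^esub> b [^]\<^bsub>B\<^esub> n, y \<otimes>\<^bsub>D\<^esub> d [^]\<^bsub>D\<^esub> n)"
        by (auto simp: G'_def)
      show "inv\<^bsub>?P\<^esub> z \<in> G'"
        by (rule G'I[OF Gi[OF z(1)], of _ "- n"])
          (use GB[OF z(1)] GD[OF z(1)] b d(1) z(2) in
            \<open>simp add: B.is_group D.is_group B.inv_mult D.inv_mult B.int_pow_neg D.int_pow_neg\<close>)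
    next
      fix z z' assume "z \<in> G'" "z' \<in> G'"
      then obtain x y x' y' and n n' :: int where
        z: "(x, y) \<in> G" "z = (x \<otimes>\<^bsub>B\<^esub> b [^]\<^bsub>B\<^esub> n, y \<otimes>\<^bsub>D\<^esub> d [^]\<^bsub>D\<^esub> n)"
        and z': "(x', y') \<in> G" "z' = (x' \<otimes>\<^bsub>B\<^esub> b [^]\<^bsub>B\<^esub> n', y' \<otimes>\<^bsub>D\<^esub> d [^]\<^bsub>D\<^esub> n')"
        by (auto simp: G'_def)
      show "z \<otimes>\<^bsub>?P\<^esub> z' \<in> G'"
        by (rule G'I[OF Gm[OF z(1) z'(1)], of _ "n + n'"])
          (use GB[OF z(1)] GD[OF z(1)] GB[OF z'(1)] GD[OF z'(1)] b d(1) z(2) z'(2) in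
            \<open>simp add: B.int_pow_mult D.int_pow_mult B.m_ac D.m_ac\<close>)
    qed
    moreover have "e = \<one>\<^bsub>D\<^esub>" if e: "(\<one>\<^bsub>B\<^esub>, e) \<in> G'" for e
    proof -
      obtain x y and n :: int where z: "(x, y) \<in> G" "\<one>\<^bsub>B\<^esub> = x \<otimes>\<^bsub>B\<^esub> b [^]\<^bsub>B\<^esub> n" "e = y \<otimes>\<^bsub>D\<^esub> d [^]\<^bsub>D\<^esub> n"
        using e by (auto simp: G'_def)
      have "x = b [^]\<^bsub>B\<^esub> (- n)"
        using B.inv_equality[OF z(2)[symmetric]] GB[OF z(1)] b by (simp add: B.int_pow_neg)
      then have "y = d [^]\<^bsub>D\<^esub> (- n)" using d(2) z(1) by blast
      then show ?thesis using z(3) d(1) by (simp add: D.int_pow_neg)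
    qed
    moreover have GG': "G \<subseteq> G'"
    proof
      fix z assume z: "z \<in> G"
      obtain x y where xy: "z = (x, y)" by (cases z)
      show "z \<in> G'" by (rule G'I[of x y z 0]) (use z xy GB GD in auto)
    qed
    ultimately have "G' \<in> \<G>" using Gg by (auto simp: \<G>_def)
    then have "G' = G" using max GG' by blast
    moreover have "(b, d) \<in> G'" by (rule G'I[OF G1, of _ 1]) (use b d(1) in simp)
    ultimately show ?thesis by blast
  qed
  then obtain h where h: "\<And>b. b \<in> carrier B \<Longrightarrow> (b, h b) \<in> G" by metis
  have uniq: "y = y'" if "(x, y) \<in> G" "(x, y') \<in> G" for x y y'
  proof -
    have "(\<one>\<^bsub>B\<^esub>, y \<otimes>\<^bsub>D\<^esub> inv\<^bsub>D\<^esub> y') \<in> G" using Gm[OF that(1) Gi[OF that(2)]] GB[OF that(1)] by simp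
    then have "y \<otimes>\<^bsub>D\<^esub> inv\<^bsub>D\<^esub> y' = \<one>\<^bsub>D\<^esub>" by (rule Gu)
    then show ?thesis using D.inv_equality[of y "inv\<^bsub>D\<^esub> y'"] GD[OF that(1)] GD[OF that(2)] by simp
  qed
  show ?thesis
  proof (intro bexI[of _ h] ballI homI)
    show "h x \<in> carrier D" if "x \<in> carrier B" for x using GD[OF h[OF that]] .
    show "h (x \<otimes>\<^bsub>B\<^esub> y) = h x \<otimes>\<^bsub>D\<^esub> h y" if "x \<in> carrier B" "y \<in> carrier B" for x y
      using uniq[OF h Gm[OF h[OF that(1)] h[OF that(2)]]] that by simp
    show "h a = g a" if "a \<in> A" for a using uniq[OF h Gg] A.subset that by blast
  qed
qed

text \<open>A finitely supported function is determined by its graph over the support, a finite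
  subset of a set of the cardinality of \<open>'w\<close>; an infinite set has as many finite
  subsets as elements.\<close>

lemma poly_mapping_encoding:
  assumes "infinite (UNIV :: 'w set)"
  obtains e :: "('w \<Rightarrow>\<^sub>0 rat) \<Rightarrow> 'w" where "inj e"
proof -
  define gr :: "('w \<Rightarrow>\<^sub>0 rat) \<Rightarrow> ('w \<times> rat) set" where
    "gr v = (\<lambda>x. (x, Poly_Mapping.lookup v x)) ` Poly_Mapping.keys v" for v
  have "inj gr"
  proof (rule injI, rule poly_mapping_eqI)
    fix u v :: "'w \<Rightarrow>\<^sub>0 rat" and x assume eq: "gr u = gr v"
    have *: "(x, q) \<in> gr w \<longleftrightarrow> q = Poly_Mapping.lookup w x \<and> q \<noteq> 0" for q w
      by (auto simp: gr_def in_keys_iff)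
    show "Poly_Mapping.lookup u x = Poly_Mapping.lookup v x" using *[of _ u] *[of _ v] eq by metis
  qed
  moreover have "range gr \<subseteq> Fpow UNIV" by (auto simp: gr_def Fpow_def)
  ultimately have 1: "(card_of (UNIV :: ('w \<Rightarrow>\<^sub>0 rat) set), card_of (Fpow (UNIV :: ('w \<times> rat) set))) \<in> ordLeq"
    using card_of_ordLeq by blast
  have "infinite (UNIV :: ('w \<times> rat) set)" using assms by (simp add: finite_prod)
  then have 2: "(card_of (Fpow (UNIV :: ('w \<times> rat) set)), card_of (UNIV :: ('w \<times> rat) set)) \<in> ordIso"
    by (rule card_of_Fpow_infinite)
  have "(card_of (UNIV :: rat set), card_of (UNIV :: nat set)) \<in> ordLeq"
    using card_of_ordLeq[of "UNIV :: rat set" "UNIV :: nat set"] inj_to_nat by blast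
  moreover have "(card_of (UNIV :: nat set), card_of (UNIV :: 'w set)) \<in> ordLeq"
    using assms infinite_iff_card_of_nat by blast
  ultimately have "(card_of (UNIV :: rat set), card_of (UNIV :: 'w set)) \<in> ordLeq" by (rule ordLeq_transitive)
  then have 3: "(card_of ((UNIV :: 'w set) \<times> (UNIV :: rat set)), card_of (UNIV :: 'w set)) \<in> ordIso"
    using card_of_Times_infinite[of "UNIV :: 'w set" "UNIV :: rat set"] assms by blast
  have "(card_of (UNIV :: ('w \<Rightarrow>\<^sub>0 rat) set), card_of (UNIV :: 'w set)) \<in> ordLeq"
    using ordLeq_ordIso_trans[OF ordLeq_ordIso_trans[OF 1 2]] 3 by (simp add: UNIV_Times_UNIV)
  then show thesis using that card_of_ordLeq[of "UNIV :: ('w \<Rightarrow>\<^sub>0 rat) set" "UNIV :: 'w set"] by blast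
qed

text \<open>An abelian group \<open>N\<close> embeds in a quotient of the rational vector space with basis \<open>N\<close>,
  by the relations that hold among elements of \<open>N\<close>.\<close>

lemma divisible_embedding:
  fixes N :: "('w, 'c) ring_scheme"
  assumes N: "abelian_group N" and inf: "infinite (UNIV :: 'w set)"
  shows "\<exists>(D :: 'w ring) j. abelian_group D \<and>
    (\<forall>n::nat. \<forall>d\<in>carrier D. 0 < n \<longrightarrow> (\<exists>d'\<in>carrier D. d' [^]\<^bsub>add_monoid D\<^esub> n = d)) \<and>
    j ` carrier N \<subseteq> carrier D \<and>
    (\<forall>x\<in>carrier N. \<forall>y\<in>carrier N. j (x \<oplus>\<^bsub>N\<^esub> y) = j x \<oplus>\<^bsub>D\<^esub> j y) \<and> inj_on j (carrier N)"
proof -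
  interpret N: abelian_group N by fact
  obtain e :: "('w \<Rightarrow>\<^sub>0 rat) \<Rightarrow> 'w" where e: "inj e" using poly_mapping_encoding[OF inf] .
  let ?F = "free_Abelian_group (carrier N)"
  interpret F: comm_group ?F by (rule abelian_free_Abelian_group)
  obtain \<sigma> where \<sigma>: "\<sigma> \<in> hom ?F (add_monoid N)" and \<sigma>_of: "\<And>x. x \<in> carrier N \<Longrightarrow> \<sigma> (frag_of x) = x"
    using comm_group.free_Abelian_group_universal[OF N.a_comm_group, of "\<lambda>x. x" "carrier N"] by auto
  interpret \<sigma>: group_hom ?F "add_monoid N" \<sigma>
    using \<sigma> by (intro group_hom.intro group_hom_axioms.intro) (auto simp: N.a_group)
  define \<iota> :: "('w \<Rightarrow>\<^sub>0 int) \<Rightarrow> ('w \<Rightarrow>\<^sub>0 rat)" where "\<iota> = Poly_Mapping.map rat_of_int"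
  have lookup_\<iota>: "Poly_Mapping.lookup (\<iota> f) x = of_int (Poly_Mapping.lookup f x)" for f x
    by (simp add: \<iota>_def Poly_Mapping.map.rep_eq when_def)
  have \<iota>_add: "\<iota> (f + f') = \<iota> f + \<iota> f'" and \<iota>_minus: "\<iota> (- f) = - \<iota> f" and \<iota>_0: "\<iota> 0 = 0" for f f'
    by (rule poly_mapping_eqI, simp add: lookup_\<iota> lookup_add lookup_uminus)+
  have \<iota>_inj: "f = f'" if "\<iota> f = \<iota> f'" for f f'
    by (rule poly_mapping_eqI) (metis lookup_\<iota> of_int_eq_iff that)
  \<comment> \<open>Only the subgroup of integral relations is divided out; the rational subspace
    spanned by them would kill the torsion of \<open>N\<close>.\<close>
  define K where "K = {\<iota> f |f. Poly_Mapping.keys f \<subseteq> carrier N \<and> \<sigma> f = \<zero>\<^bsub>N\<^esub>}"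
  have K0: "0 \<in> K" unfolding K_def using \<sigma>.hom_one \<iota>_0 by force
  have Kadd: "u + v \<in> K" if "u \<in> K" "v \<in> K" for u v
  proof -
    obtain f f' where f: "u = \<iota> f" "Poly_Mapping.keys f \<subseteq> carrier N" "\<sigma> f = \<zero>\<^bsub>N\<^esub>"
      "v = \<iota> f'" "Poly_Mapping.keys f' \<subseteq> carrier N" "\<sigma> f' = \<zero>\<^bsub>N\<^esub>" using \<open>u \<in> K\<close> \<open>v \<in> K\<close> by (auto simp: K_def)
    have "\<sigma> (f + f') = \<zero>\<^bsub>N\<^esub>" using \<sigma>.hom_mult[of f f'] f by simp
    moreover have "Poly_Mapping.keys (f + f') \<subseteq> carrier N"
      using F.m_closed[of f f'] f by simp
    ultimately show ?thesis using f \<iota>_add[of f f'] by (auto simp: K_def intro!: exI[of _ "f + f'"])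
  qed
  have Kminus: "- u \<in> K" if "u \<in> K" for u
  proof -
    obtain f where f: "u = \<iota> f" "Poly_Mapping.keys f \<subseteq> carrier N" "\<sigma> f = \<zero>\<^bsub>N\<^esub>" using \<open>u \<in> K\<close> by (auto simp: K_def)
    have "\<sigma> (- f) = \<zero>\<^bsub>N\<^esub>" using \<sigma>.hom_inv[of f] f monoid.inv_one[OF group.is_monoid[OF N.a_group]] by simp
    then show ?thesis using f \<iota>_minus[of f] by (auto simp: K_def intro!: exI[of _ "- f"])
  qed
  \<comment> \<open>The class of \<open>v\<close> modulo \<open>K\<close> is named by an encoded
    representative, which brings the quotient into the type \<open>'w\<close>.\<close>
  define \<psi> where "\<psi> v = e (SOME v'. v - v' \<in> K)" for v
  have rep: "v - (SOME v'. v - v' \<in> K) \<in> K" for v by (rule someI[of _ v]) (simp add: K0)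
  have fib: "\<psi> u = \<psi> v \<longleftrightarrow> u - v \<in> K" for u v
  proof
    assume "\<psi> u = \<psi> v"
    then have eq: "(SOME v'. u - v' \<in> K) = (SOME v'. v - v' \<in> K)" using e by (simp add: \<psi>_def inj_eq)
    have "(u - (SOME v'. u - v' \<in> K)) + - (v - (SOME v'. v - v' \<in> K)) \<in> K"
      by (rule Kadd[OF rep Kminus[OF rep]])
    then show "u - v \<in> K" unfolding eq by simp
  next
    assume uv: "u - v \<in> K"
    have "u - v' \<in> K \<longleftrightarrow> v - v' \<in> K" for v'
      using Kadd[OF uv, of "v - v'"] Kadd[OF Kminus[OF uv], of "u - v'"] by auto
    then show "\<psi> u = \<psi> v" by (simp add: \<psi>_def)
  qed
  define \<tau> where "\<tau> w = (SOME v. \<psi> v = w)" for w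
  have \<tau>: "\<psi> (\<tau> (\<psi> v)) = \<psi> v" for v unfolding \<tau>_def by (rule someI[of _ v]) simp
  define D :: "'w ring" where "D = \<lparr>carrier = range \<psi>, monoid.mult = undefined, one = undefined,
    ring.zero = \<psi> 0, ring.add = (\<lambda>a b. \<psi> (\<tau> a + \<tau> b))\<rparr>"
  have add: "\<psi> u \<oplus>\<^bsub>D\<^esub> \<psi> v = \<psi> (u + v)" for u v
  proof -
    have "\<tau> (\<psi> u) - u \<in> K" "\<tau> (\<psi> v) - v \<in> K" using fib \<tau> by blast+
    from Kadd[OF this] have "(\<tau> (\<psi> u) + \<tau> (\<psi> v)) - (u + v) \<in> K" by (simp add: algebra_simps)
    then show ?thesis using fib by (simp add: D_def)
  qed
  have car: "carrier D = range \<psi>" and zero: "\<zero>\<^bsub>D\<^esub> = \<psi> 0" by (simp_all add: D_def)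
  have D: "abelian_group D"
  proof (rule abelian_groupI)
    show "\<exists>y\<in>carrier D. y \<oplus>\<^bsub>D\<^esub> x = \<zero>\<^bsub>D\<^esub>" if x: "x \<in> carrier D" for x
    proof -
      obtain v where "x = \<psi> v" using x car by auto
      then show ?thesis by (intro bexI[of _ "\<psi> (- v)"]) (simp_all add: car add zero)
    qed
  qed (auto simp: car add zero ac_simps)
  define sc where "sc n v = Poly_Mapping.map ((*) (of_nat n)) v" for n and v :: "'w \<Rightarrow>\<^sub>0 rat"
  have lookup_sc: "Poly_Mapping.lookup (sc n v) x = of_nat n * Poly_Mapping.lookup v x" for n v x
    by (simp add: sc_def Poly_Mapping.map.rep_eq when_def)
  have pow: "(\<psi> v) [^]\<^bsub>add_monoid D\<^esub> (n::nat) = \<psi> (sc n v)" for v n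
  proof (induction n)
    case 0
    have "sc 0 v = 0" by (rule poly_mapping_eqI) (simp add: lookup_sc)
    then show ?case by (simp add: zero)
  next
    case (Suc n)
    have "sc (Suc n) v = sc n v + v"
      by (rule poly_mapping_eqI) (simp add: lookup_sc lookup_add algebra_simps)
    then show ?case using Suc by (simp add: add)
  qed
  define j where "j x = \<psi> (\<iota> (frag_of x))" for x
  show ?thesis
  proof (rule exI[of _ D], rule exI[of _ j], intro conjI allI ballI impI)
    fix n :: nat and d assume "d \<in> carrier D" and n: "0 < n"
    then obtain v where v: "d = \<psi> v" using car by auto
    define v' where "v' = Poly_Mapping.map (\<lambda>q. q / of_nat n) v"
    have lookup_v': "Poly_Mapping.lookup v' x = Poly_Mapping.lookup v x / of_nat n" for x
      by (simp add: v'_def Poly_Mapping.map.rep_eq when_def)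
    have sc_v': "sc n v' = v"
      using n by (intro poly_mapping_eqI) (simp add: lookup_sc lookup_v')
    show "\<exists>d'\<in>carrier D. d' [^]\<^bsub>add_monoid D\<^esub> n = d"
      using v car pow[of v' n] unfolding sc_v' by blast
  next
    show "abelian_group D" by (rule D)
    show "j ` carrier N \<subseteq> carrier D" by (auto simp: j_def car)
    show "j (x \<oplus>\<^bsub>N\<^esub> y) = j x \<oplus>\<^bsub>D\<^esub> j y" if "x \<in> carrier N" "y \<in> carrier N" for x y
    proof -
      define c where "c = frag_of x + frag_of y"
      define f where "f = frag_of (x \<oplus>\<^bsub>N\<^esub> y) + - c"
      have c: "c \<in> carrier ?F" and xy: "frag_of (x \<oplus>\<^bsub>N\<^esub> y) \<in> carrier ?F"
        using F.m_closed[of "frag_of x" "frag_of y"] that by (auto simp: c_def)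
      have "f = frag_of (x \<oplus>\<^bsub>N\<^esub> y) \<otimes>\<^bsub>?F\<^esub> inv\<^bsub>?F\<^esub> c" using c by (simp add: f_def)
      then have "f \<in> carrier ?F" "\<sigma> f = \<sigma> (frag_of (x \<oplus>\<^bsub>N\<^esub> y)) \<ominus>\<^bsub>N\<^esub> \<sigma> c"
        using F.m_closed[OF xy F.inv_closed[OF c]] \<sigma>.hom_mult[OF xy F.inv_closed[OF c]] \<sigma>.hom_inv[OF c]
        by (simp_all only: a_minus_def a_inv_def) simp
      moreover have "\<sigma> c = x \<oplus>\<^bsub>N\<^esub> y"
        unfolding c_def using \<sigma>.hom_mult[of "frag_of x" "frag_of y"] that \<sigma>_of by simp
      ultimately have "f \<in> carrier ?F" "\<sigma> f = \<zero>\<^bsub>N\<^esub>" using that \<sigma>_of by (simp_all add: N.diff_eq_zero_iff)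
      then have "\<iota> f \<in> K" by (auto simp: K_def)
      moreover have "\<iota> f = \<iota> (frag_of (x \<oplus>\<^bsub>N\<^esub> y)) - (\<iota> (frag_of x) + \<iota> (frag_of y))"
        unfolding f_def c_def by (simp only: \<iota>_add \<iota>_minus diff_conv_add_uminus)
      ultimately have "\<iota> (frag_of (x \<oplus>\<^bsub>N\<^esub> y)) - (\<iota> (frag_of x) + \<iota> (frag_of y)) \<in> K" by (simp only:)
      then show ?thesis by (simp add: j_def add fib)
    qed
    show "inj_on j (carrier N)"
    proof (rule inj_onI)
      fix x y assume xy: "x \<in> carrier N" "y \<in> carrier N" "j x = j y"
      then have "\<iota> (frag_of x) - \<iota> (frag_of y) \<in> K" by (simp add: j_def fib)
      then obtain f where f: "\<iota> (frag_of x) - \<iota> (frag_of y) = \<iota> f" "f \<in> carrier ?F" "\<sigma> f = \<zero>\<^bsub>N\<^esub>"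
        by (auto simp: K_def)
      \<comment> \<open>Injectivity of \<open>\<iota>\<close> brings the equation back to integral
        combinations, where \<open>\<sigma>\<close> can be applied.\<close>
      have "\<iota> (frag_of x) = \<iota> (f + frag_of y)" using f(1) by (simp add: \<iota>_add algebra_simps)
      then have "frag_of x = f + frag_of y" by (rule \<iota>_inj)
      then have "\<sigma> (frag_of x) = \<sigma> f \<oplus>\<^bsub>N\<^esub> \<sigma> (frag_of y)"
        using \<sigma>.hom_mult[of f "frag_of y"] f(2) xy by simp
      then show "x = y" using f(3) xy \<sigma>_of by simp
    qed
  qed
qed

text \<open>The additive maps from the ring to \<open>D\<close>, the right adjoint of the forgetful
  functor to abelian groups. Scalars act on the argument.\<close>

definition coinduced_module :: "('r, 'k) ring_scheme \<Rightarrow> 'w ring \<Rightarrow> ('r, 'r \<Rightarrow> 'w) module" where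
  "coinduced_module R D =
    \<lparr>carrier = {\<phi> \<in> carrier R \<rightarrow>\<^sub>E carrier D.
       \<forall>r\<in>carrier R. \<forall>s\<in>carrier R. \<phi> (r \<oplus>\<^bsub>R\<^esub> s) = \<phi> r \<oplus>\<^bsub>D\<^esub> \<phi> s},
     monoid.mult = undefined, one = undefined,
     ring.zero = (\<lambda>r\<in>carrier R. \<zero>\<^bsub>D\<^esub>),
     ring.add = (\<lambda>\<phi> \<chi>. \<lambda>r\<in>carrier R. \<phi> r \<oplus>\<^bsub>D\<^esub> \<chi> r),
     smult = (\<lambda>r \<phi>. \<lambda>s\<in>carrier R. \<phi> (s \<otimes>\<^bsub>R\<^esub> r))\<rparr>"

lemma coinduced_module_simps:
  "\<phi> \<in> carrier (coinduced_module R D) \<longleftrightarrow> \<phi> \<in> carrier R \<rightarrow>\<^sub>E carrier D \<and>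
     (\<forall>r\<in>carrier R. \<forall>s\<in>carrier R. \<phi> (r \<oplus>\<^bsub>R\<^esub> s) = \<phi> r \<oplus>\<^bsub>D\<^esub> \<phi> s)"
  "\<zero>\<^bsub>coinduced_module R D\<^esub> = (\<lambda>r\<in>carrier R. \<zero>\<^bsub>D\<^esub>)"
  "\<phi> \<oplus>\<^bsub>coinduced_module R D\<^esub> \<chi> = (\<lambda>r\<in>carrier R. \<phi> r \<oplus>\<^bsub>D\<^esub> \<chi> r)"
  "r \<odot>\<^bsub>coinduced_module R D\<^esub> \<phi> = (\<lambda>s\<in>carrier R. \<phi> (s \<otimes>\<^bsub>R\<^esub> r))"
  by (simp_all add: coinduced_module_def)

lemma coinduced_moduleI:
  "(\<And>r. r \<in> carrier R \<Longrightarrow> \<phi> r \<in> carrier D) \<Longrightarrow>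
   (\<And>r s. r \<in> carrier R \<Longrightarrow> s \<in> carrier R \<Longrightarrow> r \<oplus>\<^bsub>R\<^esub> s \<in> carrier R \<and> \<phi> (r \<oplus>\<^bsub>R\<^esub> s) = \<phi> r \<oplus>\<^bsub>D\<^esub> \<phi> s) \<Longrightarrow>
   restrict \<phi> (carrier R) \<in> carrier (coinduced_module R D)"
  by (simp add: coinduced_module_simps)

lemma module_coinduced:
  assumes R: "cring R" and D: "abelian_group D"
  shows "module R (coinduced_module R D)"
proof -
  interpret R: cring R by fact
  interpret D: abelian_group D by fact
  let ?E = "coinduced_module R D"
  have car: "\<phi> r \<in> carrier D" "\<phi> \<in> extensional (carrier R)"
    if "\<phi> \<in> carrier ?E" "r \<in> carrier R" for \<phi> r
    using that by (auto simp: coinduced_module_simps PiE_def)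
  have hom: "\<phi> (r \<oplus>\<^bsub>R\<^esub> s) = \<phi> r \<oplus>\<^bsub>D\<^esub> \<phi> s"
    if "\<phi> \<in> carrier ?E" "r \<in> carrier R" "s \<in> carrier R" for \<phi> r s
    using that by (simp add: coinduced_module_simps)
  have ext: "\<phi> = \<chi>" if "\<phi> \<in> extensional (carrier R)" "\<chi> \<in> extensional (carrier R)"
    "\<And>r. r \<in> carrier R \<Longrightarrow> \<phi> r = \<chi> r" for \<phi> \<chi> :: "'a \<Rightarrow> 'c"
    using that by (rule extensionalityI)
  note simps = coinduced_module_simps(2-4)
  show ?thesis
  proof (rule moduleI)
    show "abelian_group ?E"
    proof (rule abelian_groupI)
      show "\<phi> \<oplus>\<^bsub>?E\<^esub> \<chi> \<in> carrier ?E" if "\<phi> \<in> carrier ?E" "\<chi> \<in> carrier ?E" for \<phi> \<chi>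
        unfolding simps by (rule coinduced_moduleI) (use that in \<open>simp_all add: car hom D.a_ac\<close>)
      show "\<zero>\<^bsub>?E\<^esub> \<in> carrier ?E"
        unfolding simps by (rule coinduced_moduleI) auto
      show "\<exists>\<chi>\<in>carrier ?E. \<chi> \<oplus>\<^bsub>?E\<^esub> \<phi> = \<zero>\<^bsub>?E\<^esub>" if "\<phi> \<in> carrier ?E" for \<phi>
      proof (rule bexI)
        show "(\<lambda>r\<in>carrier R. \<ominus>\<^bsub>D\<^esub> \<phi> r) \<in> carrier ?E"
          by (rule coinduced_moduleI) (use that in \<open>simp_all add: car hom D.minus_add\<close>)
        show "(\<lambda>r\<in>carrier R. \<ominus>\<^bsub>D\<^esub> \<phi> r) \<oplus>\<^bsub>?E\<^esub> \<phi> = \<zero>\<^bsub>?E\<^esub>"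
          unfolding simps by (rule ext) (use that in \<open>simp_all add: car D.l_neg\<close>)
      qed
    next
      fix \<phi> assume \<phi>: "\<phi> \<in> carrier ?E"
      show "\<zero>\<^bsub>?E\<^esub> \<oplus>\<^bsub>?E\<^esub> \<phi> = \<phi>"
        unfolding simps by (rule ext) (use \<phi> car(2)[OF \<phi> R.zero_closed] in \<open>simp_all add: car\<close>)
      fix \<chi> assume \<chi>: "\<chi> \<in> carrier ?E"
      show "\<phi> \<oplus>\<^bsub>?E\<^esub> \<chi> = \<chi> \<oplus>\<^bsub>?E\<^esub> \<phi>"
        unfolding simps by (rule ext) (use \<phi> \<chi> in \<open>simp_all add: car D.a_comm\<close>)
      fix \<xi> assume \<xi>: "\<xi> \<in> carrier ?E"
      show "\<phi> \<oplus>\<^bsub>?E\<^esub> \<chi> \<oplus>\<^bsub>?E\<^esub> \<xi> = \<phi> \<oplus>\<^bsub>?E\<^esub> (\<chi> \<oplus>\<^bsub>?E\<^esub> \<xi>)"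
        unfolding simps by (rule ext) (use \<phi> \<chi> \<xi> in \<open>simp_all add: car D.a_assoc\<close>)
    qed
  next
    fix r \<phi> assume r: "r \<in> carrier R" and \<phi>: "\<phi> \<in> carrier ?E"
    show "r \<odot>\<^bsub>?E\<^esub> \<phi> \<in> carrier ?E"
      unfolding simps by (rule coinduced_moduleI) (use r \<phi> in \<open>simp_all add: car hom R.l_distr\<close>)
    show "(r \<oplus>\<^bsub>R\<^esub> s) \<odot>\<^bsub>?E\<^esub> \<phi> = r \<odot>\<^bsub>?E\<^esub> \<phi> \<oplus>\<^bsub>?E\<^esub> s \<odot>\<^bsub>?E\<^esub> \<phi>" if "s \<in> carrier R" for s
      unfolding simps by (rule ext) (use r \<phi> that in \<open>simp_all add: car hom R.r_distr\<close>)
    show "r \<odot>\<^bsub>?E\<^esub> (\<phi> \<oplus>\<^bsub>?E\<^esub> \<chi>) = r \<odot>\<^bsub>?E\<^esub> \<phi> \<oplus>\<^bsub>?E\<^esub> r \<odot>\<^bsub>?E\<^esub> \<chi>" if "\<chi> \<in> carrier ?E" for \<chi>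
      unfolding simps by (rule ext) (use r \<phi> that in \<open>simp_all add: car\<close>)
    show "(r \<otimes>\<^bsub>R\<^esub> s) \<odot>\<^bsub>?E\<^esub> \<phi> = r \<odot>\<^bsub>?E\<^esub> (s \<odot>\<^bsub>?E\<^esub> \<phi>)" if "s \<in> carrier R" for s
      unfolding simps by (rule ext) (use r \<phi> that in \<open>simp_all add: car R.m_assoc\<close>)
  next
    fix \<phi> assume \<phi>: "\<phi> \<in> carrier ?E"
    show "\<one>\<^bsub>R\<^esub> \<odot>\<^bsub>?E\<^esub> \<phi> = \<phi>"
      unfolding simps by (rule ext) (use \<phi> car(2)[OF \<phi> R.zero_closed] in \<open>simp_all add: car\<close>)
  qed (rule R)
qed

lemma injective_moduleI:
  fixes R :: "('r, 'k) ring_scheme" and E :: "('r, 'm) module"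
  assumes "module R E"
    and "\<And>(A :: ('r, 'r) module) (B :: ('r, 'r) module) f g.
      \<lbrakk>f \<in> module_hom R A B; g \<in> module_hom R A E; module R A; module R B; inj_on f (carrier A)\<rbrakk> \<Longrightarrow>
      \<exists>h\<in>module_hom R B E. \<forall>x\<in>carrier A. h (f x) = g x"
  shows "injective_module R E"
  unfolding injective_module_def
  by (intro conjI allI ballI impI, rule assms(1), elim conjE, rule assms(2))

text \<open>By adjunction, linear maps into the coinduced module correspond to additive maps into
  \<open>D\<close>, by evaluation at 1. The additive map extends because \<open>D\<close> is
  divisible, and \<open>h\<close> is the linear map belonging to the extension.\<close>

lemma coinduced_injective:
  fixes D :: "'w ring"
  assumes R: "cring R" and D: "abelian_group D"
    and div: "\<And>(n::nat) d. 0 < n \<Longrightarrow> d \<in> carrier D \<Longrightarrow> \<exists>d'\<in>carrier D. d' [^]\<^bsub>add_monoid D\<^esub> n = d"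
  shows "injective_module R (coinduced_module R D)"
proof (rule injective_moduleI)
  show E: "module R (coinduced_module R D)" by (rule module_coinduced[OF R D])
  let ?E = "coinduced_module R D"
  interpret R: cring R by fact
  interpret D: abelian_group D by fact
  fix A B :: "('a, 'a) module" and f g
  assume f: "f \<in> module_hom R A B" and g: "g \<in> module_hom R A ?E"
    and A: "module R A" and B: "module R B" and inj: "inj_on f (carrier A)"
  interpret A: module R A by fact
  interpret B: module R B by fact
  note fD = module_homD[OF f] and gD = module_homD[OF g]
  have gD1: "g a r \<in> carrier D" if "a \<in> carrier A" "r \<in> carrier R" for a r
    using gD(1)[OF that(1)] that(2) by (auto simp: coinduced_module_simps)
  define g0 where "g0 b = g (inv_into (carrier A) f b) \<one>\<^bsub>R\<^esub>" for b
  have g0: "g0 (f a) = g a \<one>\<^bsub>R\<^esub>" if "a \<in> carrier A" for a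
    using inv_into_f_f[OF inj that] by (simp add: g0_def)
  have fA: "submodule (f ` carrier A) R B"
    by (rule linear_on_image[OF A B A.carrier_is_submodule fD(5)])
  have "g0 \<in> hom (add_monoid B\<lparr>carrier := f ` carrier A\<rparr>) (add_monoid D)"
  proof (rule homI)
    fix x assume "x \<in> carrier (add_monoid B\<lparr>carrier := f ` carrier A\<rparr>)"
    then obtain a where a: "a \<in> carrier A" "x = f a" by auto
    then show "g0 x \<in> carrier (add_monoid D)" using gD1 by (simp add: g0)
    fix y assume "y \<in> carrier (add_monoid B\<lparr>carrier := f ` carrier A\<rparr>)"
    then obtain b where b: "b \<in> carrier A" "y = f b" by auto
    show "g0 (x \<otimes>\<^bsub>add_monoid B\<lparr>carrier := f ` carrier A\<rparr>\<^esub> y) = g0 x \<otimes>\<^bsub>add_monoid D\<^esub> g0 y"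
      using a b fD(2)[of a b, symmetric] gD(2)[of a b] by (simp add: g0 coinduced_module_simps)
  qed
  from divisible_extension[OF B.a_comm_group D.a_comm_group _ submodule.axioms(1)[OF fA] this]
  obtain h0 where h0: "h0 \<in> hom (add_monoid B) (add_monoid D)"
    and h0g: "\<And>a. a \<in> carrier A \<Longrightarrow> h0 (f a) = g a \<one>\<^bsub>R\<^esub>"
    using div by (auto simp: g0)
  have h0c: "h0 b \<in> carrier D" and h0a: "h0 (b \<oplus>\<^bsub>B\<^esub> b') = h0 b \<oplus>\<^bsub>D\<^esub> h0 b'"
    if "b \<in> carrier B" "b' \<in> carrier B" for b b'
    using h0 that by (auto simp: hom_def)
  define h where "h = (\<lambda>b. \<lambda>s\<in>carrier R. h0 (s \<odot>\<^bsub>B\<^esub> b))"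
  have "linear_on R B ?E (carrier B) h"
  proof (rule linear_onI)
    fix b assume b: "b \<in> carrier B"
    show "h b \<in> carrier ?E"
      unfolding h_def by (rule coinduced_moduleI) (use b h0c h0a in \<open>simp_all add: B.smult_l_distr\<close>)
    show "h (b \<oplus>\<^bsub>B\<^esub> b') = h b \<oplus>\<^bsub>?E\<^esub> h b'" if "b' \<in> carrier B" for b'
      unfolding h_def coinduced_module_simps
      by (rule extensionalityI[where A = "carrier R"]) (use b that in \<open>simp_all add: B.smult_r_distr h0a\<close>)
    show "h (r \<odot>\<^bsub>B\<^esub> b) = r \<odot>\<^bsub>?E\<^esub> h b" if "r \<in> carrier R" for r
      unfolding h_def coinduced_module_simps
      by (rule extensionalityI[where A = "carrier R"]) (use b that in \<open>simp_all add: B.smult_assoc1\<close>)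
  qed
  then have "restrict h (carrier B) \<in> module_hom R B ?E" by (rule restrict_module_hom[OF B])
  moreover have "restrict h (carrier B) (f a) = g a" if a: "a \<in> carrier A" for a
  proof (rule extensionalityI)
    show "restrict h (carrier B) (f a) \<in> extensional (carrier R)" using fD(1)[OF a] by (simp add: h_def)
    show "g a \<in> extensional (carrier R)" using gD(1)[OF a] by (simp add: coinduced_module_simps PiE_def)
    fix s assume s: "s \<in> carrier R"
    have "h0 (s \<odot>\<^bsub>B\<^esub> f a) = g (s \<odot>\<^bsub>A\<^esub> a) \<one>\<^bsub>R\<^esub>"
      using h0g[of "s \<odot>\<^bsub>A\<^esub> a"] fD(3)[OF s a] a s by simp
    also have "\<dots> = g a s" using gD(3)[OF s a] s by (simp add: coinduced_module_simps)
    finally show "restrict h (carrier B) (f a) s = g a s" using fD(1)[OF a] s by (simp add: h_def)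
  qed
  ultimately show "\<exists>h\<in>module_hom R B ?E. \<forall>x\<in>carrier A. h (f x) = g x" by blast
qed

text \<open>Extension problems are carried to \<open>E\<close> by the inverse of
  \<open>\<psi>\<close> and the solutions are carried back. This moves the coinduced module from its
  function type into the type of the resolution.\<close>

lemma injective_module_transport:
  fixes E :: "('r, 'm) module" and N :: "('r, 'n) module"
  assumes E: "injective_module R E" and N: "module R N"
    and \<psi>: "linear_on R E N (carrier E) \<psi>" "inj_on \<psi> (carrier E)" "\<psi> ` carrier E = carrier N"
  shows "injective_module R N"
proof (rule injective_moduleI)
  show "module R N" by fact
  fix A B :: "('r, 'r) module" and f g
  assume f: "f \<in> module_hom R A B" and g: "g \<in> module_hom R A N"
    and A: "module R A" and B: "module R B" and inj: "inj_on f (carrier A)"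
  have Em: "module R E" using E by (simp add: injective_module_def)
  interpret E: module R E by fact
  interpret A: module R A by fact
  interpret B: module R B by fact
  note gD = module_homD[OF g]
  have \<psi>0: "x = \<zero>\<^bsub>E\<^esub>" if "x \<in> carrier E" "\<psi> x = \<zero>\<^bsub>N\<^esub>" for x
    using inj_onD[OF \<psi>(2), of x "\<zero>\<^bsub>E\<^esub>"] linear_on_zero[OF Em N E.carrier_is_submodule \<psi>(1)] that by simp
  have id: "linear_on R E E (carrier E) (\<lambda>x. x)" by (rule linear_onI) auto
  obtain \<theta> where \<theta>: "linear_on R N E (\<psi> ` carrier E) \<theta>" "\<And>x. x \<in> carrier E \<Longrightarrow> \<theta> (\<psi> x) = x"
    by (rule linear_factor[OF Em N Em E.carrier_is_submodule \<psi>(1) id \<psi>0]) auto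
  note \<theta>D = linear_onD[OF \<theta>(1)[unfolded \<psi>(3)]]
  have "linear_on R A E (carrier A) (\<lambda>a. \<theta> (g a))"
    by (rule linear_onI) (use gD \<theta>D in auto)
  then have "restrict (\<lambda>a. \<theta> (g a)) (carrier A) \<in> module_hom R A E" by (rule restrict_module_hom[OF A])
  then obtain h where h: "h \<in> module_hom R B E" "\<And>x. x \<in> carrier A \<Longrightarrow> h (f x) = \<theta> (g x)"
    using E[unfolded injective_module_def, THEN conjunct2, rule_format, OF f _ conjI[OF A conjI[OF B inj]]]
    by fastforce
  note hD = module_homD[OF h(1)]
  have "linear_on R B N (carrier B) (\<lambda>b. \<psi> (h b))"
    by (rule linear_onI) (use hD linear_onD[OF \<psi>(1)] in auto)
  then have "restrict (\<lambda>b. \<psi> (h b)) (carrier B) \<in> module_hom R B N" by (rule restrict_module_hom[OF B])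
  moreover have "restrict (\<lambda>b. \<psi> (h b)) (carrier B) (f x) = g x" if x: "x \<in> carrier A" for x
  proof -
    obtain e where "e \<in> carrier E" "g x = \<psi> e" using gD(1)[OF x] \<psi>(3) by blast
    then show ?thesis using h(2)[OF x] \<theta>(2) module_homD(1)[OF f x] by simp
  qed
  ultimately show "\<exists>h\<in>module_hom R B N. \<forall>x\<in>carrier A. h (f x) = g x" by blast
qed

text \<open>An element \<open>x\<close> is sent to the additive map r |-> j(rx), and
  \<open>enc\<close> brings the coinduced module back to the type \<open>'w\<close>; evaluation at 1
  recovers \<open>j x\<close>, whence injectivity.\<close>

lemma injective_embedding:
  fixes N :: "('r, 'w) module" and enc :: "('r \<Rightarrow> 'w) \<Rightarrow> 'w"
  assumes N: "module R N" and inf: "infinite (UNIV :: 'w set)" and enc: "inj enc"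
  obtains E :: "('r, 'w) module" and \<epsilon> where "injective_module R E" "linear_on R N E (carrier N) \<epsilon>"
    "inj_on \<epsilon> (carrier N)"
proof -
  interpret N: module R N by fact
  obtain D :: "'w ring" and j where D: "abelian_group D"
    and "\<forall>n::nat. \<forall>d\<in>carrier D. 0 < n \<longrightarrow> (\<exists>d'\<in>carrier D. d' [^]\<^bsub>add_monoid D\<^esub> n = d)"
    and "j ` carrier N \<subseteq> carrier D"
    and "\<forall>x\<in>carrier N. \<forall>y\<in>carrier N. j (x \<oplus>\<^bsub>N\<^esub> y) = j x \<oplus>\<^bsub>D\<^esub> j y"
    and j_inj: "inj_on j (carrier N)"
    using divisible_embedding[OF N.abelian_group_axioms inf] by (elim exE conjE) (rule that)
  then have div: "\<And>(n::nat) d. 0 < n \<Longrightarrow> d \<in> carrier D \<Longrightarrow> \<exists>d'\<in>carrier D. d' [^]\<^bsub>add_monoid D\<^esub> n = d"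
    and j: "\<And>x. x \<in> carrier N \<Longrightarrow> j x \<in> carrier D"
    and j_add: "\<And>x y. \<lbrakk>x \<in> carrier N; y \<in> carrier N\<rbrakk> \<Longrightarrow> j (x \<oplus>\<^bsub>N\<^esub> y) = j x \<oplus>\<^bsub>D\<^esub> j y"
    by (simp_all add: image_subset_iff)
  let ?C = "coinduced_module R D"
  have C: "injective_module R ?C" by (rule coinduced_injective[OF N.R.is_cring D div])
  then have Cm: "module R ?C" by (simp add: injective_module_def)
  interpret C: module R ?C by fact
  have fib: "enc x = enc y \<longleftrightarrow> x \<ominus>\<^bsub>?C\<^esub> y \<in> {\<zero>\<^bsub>?C\<^esub>}" if "x \<in> carrier ?C" "y \<in> carrier ?C" for x y
    using enc that C.diff_eq_zero_iff by (simp add: inj_eq)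
  obtain E :: "('r, 'w) module" where E: "module R E" "linear_on R ?C E (carrier ?C) enc"
    "enc ` carrier ?C = carrier E"
    by (rule transport_module[OF Cm C.carrier_is_submodule C.submodule_zero fib]) auto
  have Einj: "injective_module R E"
    by (rule injective_module_transport[OF C E(1,2) _ E(3)]) (use enc in \<open>auto intro: inj_on_subset\<close>)
  define \<epsilon> where "\<epsilon> x = (\<lambda>r\<in>carrier R. j (r \<odot>\<^bsub>N\<^esub> x))" for x
  have \<epsilon>: "linear_on R N ?C (carrier N) \<epsilon>"
  proof (rule linear_onI)
    fix x assume x: "x \<in> carrier N"
    show "\<epsilon> x \<in> carrier ?C"
      unfolding \<epsilon>_def by (rule coinduced_moduleI) (use x j j_add in \<open>simp_all add: N.smult_l_distr\<close>)
    show "\<epsilon> (x \<oplus>\<^bsub>N\<^esub> y) = \<epsilon> x \<oplus>\<^bsub>?C\<^esub> \<epsilon> y" if "y \<in> carrier N" for y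
      unfolding \<epsilon>_def coinduced_module_simps
      by (rule extensionalityI[where A = "carrier R"]) (use x that in \<open>simp_all add: N.smult_r_distr j_add\<close>)
    show "\<epsilon> (r \<odot>\<^bsub>N\<^esub> x) = r \<odot>\<^bsub>?C\<^esub> \<epsilon> x" if "r \<in> carrier R" for r
      unfolding \<epsilon>_def coinduced_module_simps
      by (rule extensionalityI[where A = "carrier R"]) (use x that in \<open>simp_all add: N.smult_assoc1\<close>)
  qed
  show thesis
  proof (rule that[OF Einj])
    show "linear_on R N E (carrier N) (\<lambda>x. enc (\<epsilon> x))"
      by (rule linear_onI) (use linear_onD[OF \<epsilon>] linear_onD[OF E(2)] in auto)
    show "inj_on (\<lambda>x. enc (\<epsilon> x)) (carrier N)"
    proof (rule inj_onI)
      fix x y assume xy: "x \<in> carrier N" "y \<in> carrier N" "enc (\<epsilon> x) = enc (\<epsilon> y)"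
      have "\<epsilon> x = \<epsilon> y" using xy(3) by (rule injD[OF enc])
      then have "\<epsilon> x \<one>\<^bsub>R\<^esub> = \<epsilon> y \<one>\<^bsub>R\<^esub>" by simp
      then show "x = y" using xy(1,2) inj_onD[OF j_inj] by (simp add: \<epsilon>_def)
    qed
  qed
qed

text \<open>The cokernel is realised on coset representatives, hence again on \<open>'w\<close>, so
  that the construction can be iterated on one type.\<close>

lemma injective_embedding_cokernel:
  fixes Q :: "('r, 'w) module" and enc :: "('r \<Rightarrow> 'w) \<Rightarrow> 'w"
  assumes Q: "module R Q" and inf: "infinite (UNIV :: 'w set)" and enc: "inj enc"
  obtains E Q' :: "('r, 'w) module" and \<epsilon> \<pi> where "injective_module R E" "linear_on R Q E (carrier Q) \<epsilon>"
    "inj_on \<epsilon> (carrier Q)" "module R Q'" "linear_on R E Q' (carrier E) \<pi>" "\<pi> ` carrier E = carrier Q'"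
    "\<And>x. x \<in> carrier E \<Longrightarrow> \<pi> x = \<zero>\<^bsub>Q'\<^esub> \<longleftrightarrow> x \<in> \<epsilon> ` carrier Q"
proof -
  obtain E :: "('r, 'w) module" and \<epsilon> where E: "injective_module R E" "linear_on R Q E (carrier Q) \<epsilon>"
    "inj_on \<epsilon> (carrier Q)" using injective_embedding[OF Q inf enc] by blast
  have Em: "module R E" using E(1) by (simp add: injective_module_def)
  interpret Q: module R Q by fact
  interpret E: module R E by fact
  have im: "submodule (\<epsilon> ` carrier Q) R E" by (rule linear_on_image[OF Q Em Q.carrier_is_submodule E(2)])
  obtain \<pi> :: "'w \<Rightarrow> 'w" where fib: "\<And>x y. \<lbrakk>x \<in> carrier E; y \<in> carrier E\<rbrakk> \<Longrightarrow>
      \<pi> x = \<pi> y \<longleftrightarrow> x \<ominus>\<^bsub>E\<^esub> y \<in> \<epsilon> ` carrier Q"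
    using E.coset_representatives[OF im] by blast
  obtain Q' :: "('r, 'w) module" where Q': "module R Q'" "linear_on R E Q' (carrier E) \<pi>"
    "\<pi> ` carrier E = carrier Q'" "\<And>x. x \<in> carrier E \<Longrightarrow> \<pi> x = \<zero>\<^bsub>Q'\<^esub> \<longleftrightarrow> x \<in> \<epsilon> ` carrier Q"
    by (rule transport_module[OF Em E.carrier_is_submodule im fib]) auto
  show thesis by (rule that[OF E Q'])
qed

section \<open>Existence of injective resolutions on the type used in the definition\<close>

lemma infinite_resolution_type: "infinite (UNIV :: ('r list \<Rightarrow> 'm + nat) set)"
proof -
  have "inj (\<lambda>n::nat. \<lambda>_::'r list. Inr n :: 'm + nat)" by (auto simp: inj_def fun_eq_iff)
  then show ?thesis using infinite_iff_countable_subset by blast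
qed

text \<open>Uncurrying: the two arguments \<open>r\<close> and \<open>l'\<close> become the single
  list \<open>r # l'\<close>, and the value at the empty list is arbitrary.\<close>

lemma resolution_type_encoding:
  obtains enc :: "('r \<Rightarrow> ('r list \<Rightarrow> 'm + nat)) \<Rightarrow> 'r list \<Rightarrow> 'm + nat" where "inj enc"
proof
  let ?enc = "\<lambda>(F :: 'r \<Rightarrow> 'r list \<Rightarrow> 'm + nat) l. case l of [] \<Rightarrow> Inr 0 | r # l' \<Rightarrow> F r l'"
  show "inj ?enc"
  proof (rule injI, intro ext)
    fix F G r l' assume "?enc F = ?enc G"
    from fun_cong[OF this, of "r # l'"] show "F r l' = G r l'" by simp
  qed
qed

theorem injective_resolution_exists:
  fixes M :: "('r, 'm) module"
  assumes M: "module R M"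
  shows "\<exists>X :: (nat \<Rightarrow> ('r, 'r list \<Rightarrow> 'm + nat) module) \<times>
     (nat \<Rightarrow> ('r list \<Rightarrow> 'm + nat) \<Rightarrow> ('r list \<Rightarrow> 'm + nat)). injective_resolution R M X"
proof -
  interpret M: module R M by fact
  obtain enc :: "('r \<Rightarrow> ('r list \<Rightarrow> 'm + nat)) \<Rightarrow> 'r list \<Rightarrow> 'm + nat" where enc: "inj enc"
    by (rule resolution_type_encoding)
  define \<iota> :: "'m \<Rightarrow> 'r list \<Rightarrow> 'm + nat" where "\<iota> m = (\<lambda>_. Inl m)" for m
  have \<iota>: "inj \<iota>" by (auto simp: inj_def \<iota>_def fun_eq_iff)
  have fib: "\<iota> x = \<iota> y \<longleftrightarrow> x \<ominus>\<^bsub>M\<^esub> y \<in> {\<zero>\<^bsub>M\<^esub>}" if "x \<in> carrier M" "y \<in> carrier M" for x y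
    using \<iota> that M.diff_eq_zero_iff by (simp add: inj_eq)
  obtain M' :: "('r, 'r list \<Rightarrow> 'm + nat) module" where M': "module R M'" "linear_on R M M' (carrier M) \<iota>"
    "\<iota> ` carrier M = carrier M'"
    by (rule transport_module[OF M M.carrier_is_submodule M.submodule_zero fib]) auto
  define good where "good Q E \<epsilon> Q' \<pi> \<longleftrightarrow> injective_module R E \<and> linear_on R Q E (carrier Q) \<epsilon> \<and>
    inj_on \<epsilon> (carrier Q) \<and> module R Q' \<and> linear_on R E Q' (carrier E) \<pi> \<and> \<pi> ` carrier E = carrier Q' \<and>
    (\<forall>x\<in>carrier E. \<pi> x = \<zero>\<^bsub>Q'\<^esub> \<longleftrightarrow> x \<in> \<epsilon> ` carrier Q)"
    for Q E Q' :: "('r, 'r list \<Rightarrow> 'm + nat) module" and \<epsilon> \<pi>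
  have "\<exists>E \<epsilon> Q' \<pi>. module R Q \<longrightarrow> good Q E \<epsilon> Q' \<pi>" for Q
  proof (cases "module R Q")
    case True
    show ?thesis
      by (rule injective_embedding_cokernel[OF True infinite_resolution_type enc])
        (unfold good_def, blast)
  qed simp
  then obtain fE f\<epsilon> fQ f\<pi> where good: "\<And>Q. module R Q \<Longrightarrow> good Q (fE Q) (f\<epsilon> Q) (fQ Q) (f\<pi> Q)"
    by metis
  \<comment> \<open>The successive cokernels, beginning with a copy \<open>M'\<close> of the module
    on the type of the resolution.\<close>
  define Qs where "Qs n = (fQ ^^ n) M'" for n
  have Qs: "module R (Qs n)" for n
  proof (induction n)
    case 0
    then show ?case using M'(1) by (simp add: Qs_def)
  next
    case (Suc n)
    from good[OF this] show ?case by (simp add: good_def Qs_def)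
  qed
  define E where "E n = fE (Qs n)" for n
  define e where "e n = f\<epsilon> (Qs n)" for n
  define p where "p n = f\<pi> (Qs n)" for n
  have g: "good (Qs n) (E n) (e n) (Qs (Suc n)) (p n)" for n
    using good[OF Qs, of n] by (simp add: Qs_def E_def e_def p_def)
  have Einj: "injective_module R (E n)" and e_lin: "linear_on R (Qs n) (E n) (carrier (Qs n)) (e n)"
    and e_inj: "inj_on (e n) (carrier (Qs n))"
    and p_lin: "linear_on R (E n) (Qs (Suc n)) (carrier (E n)) (p n)"
    and p_im: "p n ` carrier (E n) = carrier (Qs (Suc n))"
    and p_ker: "\<And>x. x \<in> carrier (E n) \<Longrightarrow> p n x = \<zero>\<^bsub>Qs (Suc n)\<^esub> \<longleftrightarrow> x \<in> e n ` carrier (Qs n)" for n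
    using g[of n] by (auto simp: good_def)
  have Em: "module R (E n)" for n using Einj by (simp add: injective_module_def)
  \<comment> \<open>The projection to the cokernel followed by its embedding. As the embedding is
    injective, the kernel of \<open>d n\<close> is that of \<open>p n\<close>; as the projection is
    onto, the image of \<open>d n\<close> is that of \<open>e (Suc n)\<close>.\<close>
  define d where "d n = restrict (\<lambda>x. e (Suc n) (p n x)) (carrier (E n))" for n
  have d_hom: "d n \<in> module_hom R (E n) (E (Suc n))" for n
    unfolding d_def
    by (rule restrict_module_hom[OF Em], rule linear_onI)
      (use linear_onD[OF p_lin[of n]] linear_onD[OF e_lin[of "Suc n"]] in auto)
  have e0: "e n \<zero>\<^bsub>Qs n\<^esub> = \<zero>\<^bsub>E n\<^esub>" for n
    by (rule linear_on_zero[OF Qs Em module.carrier_is_submodule[OF Qs] e_lin])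
  have Q0: "\<zero>\<^bsub>Qs n\<^esub> \<in> carrier (Qs n)" for n
    by (rule module.submoduleD(1)[OF Qs module.carrier_is_submodule[OF Qs]])
  have e_ker: "e n x = \<zero>\<^bsub>E n\<^esub> \<longleftrightarrow> x = \<zero>\<^bsub>Qs n\<^esub>" if "x \<in> carrier (Qs n)" for n x
    using inj_onD[OF e_inj, of n x "\<zero>\<^bsub>Qs n\<^esub>"] e0[of n] Q0[of n] that by auto
  have e_im: "e n x \<in> carrier (E n)" if "x \<in> carrier (Qs n)" for n x
    using linear_onD(1)[OF e_lin that] .
  have ker_d: "a_kernel (E n) (E (Suc n)) (d n) = e n ` carrier (Qs n)" for n
  proof -
    have "d n x = \<zero>\<^bsub>E (Suc n)\<^esub> \<longleftrightarrow> x \<in> e n ` carrier (Qs n)" if "x \<in> carrier (E n)" for x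
      using p_ker[OF that] e_ker[of "p n x" "Suc n"] linear_onD(1)[OF p_lin that] that by (simp add: d_def)
    then show ?thesis using e_im by (auto simp: a_kernel_def')
  qed
  have im_d: "d n ` carrier (E n) = e (Suc n) ` carrier (Qs (Suc n))" for n
    unfolding p_im[symmetric] by (auto simp: d_def)
  define \<epsilon> where "\<epsilon> = restrict (\<lambda>x. e 0 (\<iota> x)) (carrier M)"
  have Qs0: "Qs 0 = M'" by (simp add: Qs_def)
  have "\<epsilon> \<in> module_hom R M (E 0)"
    unfolding \<epsilon>_def
    by (rule restrict_module_hom[OF M], rule linear_onI)
      (use linear_onD[OF M'(2)] linear_onD[OF e_lin[of 0, unfolded Qs0]] in auto)
  moreover have "inj_on \<epsilon> (carrier M)"
  proof (rule inj_onI)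
    fix x y assume xy: "x \<in> carrier M" "y \<in> carrier M" "\<epsilon> x = \<epsilon> y"
    have "\<iota> x \<in> carrier (Qs 0)" "\<iota> y \<in> carrier (Qs 0)" unfolding Qs0 M'(3)[symmetric] using xy by auto
    then have "\<iota> x = \<iota> y" using inj_onD[OF e_inj[of 0]] xy by (simp add: \<epsilon>_def)
    then show "x = y" using \<iota> by (simp add: inj_eq)
  qed
  moreover have "\<epsilon> ` carrier M = a_kernel (E 0) (E 1) (d 0)"
    using ker_d[of 0] unfolding Qs0 M'(3)[symmetric] by (auto simp: \<epsilon>_def)
  ultimately have "injective_resolution R M (E, d)"
    unfolding injective_resolution_def using Einj d_hom im_d ker_d by auto
  then show ?thesis by blast
qed

lemma chosen_resolution:
  assumes "module R M"
  shows "injective_resolution R M (chosen_resolution R M)"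
  unfolding chosen_resolution_def by (rule someI_ex) (rule injective_resolution_exists[OF assms])

section \<open>Comparison with Ext and local cohomology\<close>

context ext_setup
begin

abbreviation X :: "('r, 'r set) module" where "X \<equiv> cyclic_module R I"
abbreviation RR :: "('r, 'r) module" where "RR \<equiv> regular_module R"
abbreviation coset :: "'r \<Rightarrow> 'r set" where "coset r \<equiv> I +>\<^bsub>regular_module R\<^esub> r"

interpretation R: cring R by (rule cring)

lemma RR: "module R RR" by (rule R.module_regular)

lemma I_submodule: "submodule I R RR"
  using ideal by (simp add: R.submodule_regular_iff)

lemma I_carrier: "I \<subseteq> carrier R"
  using ideal.Icarr[OF ideal] by blast

lemmas X_projection = quotient_module_projection[OF RR I_submodule, folded cyclic_module_def,
    unfolded regular_module_simps(1)]

lemma X_module: "module R X" by (rule X_projection(5))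

lemma coset_smult: "r \<in> carrier R \<Longrightarrow> coset r = r \<odot>\<^bsub>X\<^esub> coset \<one>\<^bsub>R\<^esub>"
  using linear_onD(3)[OF X_projection(1), of r "\<one>\<^bsub>R\<^esub>"] by (simp add: regular_module_simps)

lemma coset_one: "coset \<one>\<^bsub>R\<^esub> \<in> carrier X"
  using X_projection(2) by blast

lemma module_hom_coset:
  assumes "f \<in> module_hom R X N" "r \<in> carrier R"
  shows "f (coset r) = r \<odot>\<^bsub>N\<^esub> f (coset \<one>\<^bsub>R\<^esub>)"
  using module_homD(3)[OF assms(1,2) coset_one] coset_smult[OF assms(2)] by simp

context
  fixes N :: "('r, 'n) module"
  assumes N: "module R N"
begin

interpretation N: module R N by (rule N)

lemma eval_annihilated:
  assumes f: "f \<in> module_hom R X N"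
  shows "f (coset \<one>\<^bsub>R\<^esub>) \<in> annihilated N I"
proof -
  have "f \<zero>\<^bsub>X\<^esub> = \<zero>\<^bsub>N\<^esub>"
    by (rule linear_on_zero[OF X_module N module.carrier_is_submodule[OF X_module] module_homD(5)[OF f]])
  moreover have "coset r = \<zero>\<^bsub>X\<^esub>" if "r \<in> I" for r using X_projection(4)[of r] that I_carrier by blast
  ultimately have "r \<odot>\<^bsub>N\<^esub> f (coset \<one>\<^bsub>R\<^esub>) = \<zero>\<^bsub>N\<^esub>" if "r \<in> I" for r
    using module_hom_coset[OF f, of r] that I_carrier by auto
  then show ?thesis using module_homD(1)[OF f coset_one] by (simp add: annihilated_def)
qed

lemma eval_inj:
  assumes f: "f \<in> module_hom R X N" and g: "g \<in> module_hom R X N"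
    and "f (coset \<one>\<^bsub>R\<^esub>) = g (coset \<one>\<^bsub>R\<^esub>)"
  shows "f = g"
proof (rule extensionalityI[OF module_homD(4)[OF f] module_homD(4)[OF g]])
  fix C assume "C \<in> carrier X"
  then obtain r where r: "r \<in> carrier R" "C = coset r" unfolding X_projection(2)[symmetric] by blast
  show "f C = g C"
    unfolding r(2) module_hom_coset[OF f r(1)] module_hom_coset[OF g r(1)] assms(3) ..
qed

text \<open>The map r |-> rx vanishes on \<open>I\<close> and therefore factors through the
  cosets.\<close>

lemma eval_surj:
  assumes x: "x \<in> annihilated N I"
  shows "\<exists>f\<in>module_hom R X N. f (coset \<one>\<^bsub>R\<^esub>) = x"
proof -
  have xN: "x \<in> carrier N" and Ix: "\<And>r. r \<in> I \<Longrightarrow> r \<odot>\<^bsub>N\<^esub> x = \<zero>\<^bsub>N\<^esub>"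
    using x by (auto simp: annihilated_def)
  have \<psi>: "linear_on R RR N (carrier R) (\<lambda>r. r \<odot>\<^bsub>N\<^esub> x)"
    by (rule linear_onI) (use xN in \<open>auto simp: regular_module_simps N.smult_l_distr N.smult_assoc1\<close>)
  have ker: "r \<odot>\<^bsub>N\<^esub> x = \<zero>\<^bsub>N\<^esub>" if "r \<in> carrier R" "coset r = \<zero>\<^bsub>X\<^esub>" for r
    using that Ix X_projection(4) by simp
  have sub: "submodule (carrier R) R RR"
    using module.carrier_is_submodule[OF RR] by (simp add: regular_module_simps)
  obtain f where f: "linear_on R X N (coset ` carrier R) f"
    "\<And>r. r \<in> carrier R \<Longrightarrow> f (coset r) = r \<odot>\<^bsub>N\<^esub> x"
    by (rule linear_factor[OF RR X_module N sub X_projection(1) \<psi> ker]) auto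
  have "restrict f (carrier X) \<in> module_hom R X N"
    by (rule restrict_module_hom[OF X_module f(1)[unfolded X_projection(2)]])
  moreover have "restrict f (carrier X) (coset \<one>\<^bsub>R\<^esub>) = x"
    using f(2)[of "\<one>\<^bsub>R\<^esub>"] coset_one xN by simp
  ultimately show ?thesis by blast
qed

lemma Hom_simps:
  "carrier (Hom R X N) = module_hom R X N" "\<zero>\<^bsub>Hom R X N\<^esub> = (\<lambda>x\<in>carrier X. \<zero>\<^bsub>N\<^esub>)"
  "f \<oplus>\<^bsub>Hom R X N\<^esub> g = (\<lambda>x\<in>carrier X. f x \<oplus>\<^bsub>N\<^esub> g x)"
  "r \<odot>\<^bsub>Hom R X N\<^esub> f = (\<lambda>x\<in>carrier X. r \<odot>\<^bsub>N\<^esub> f x)"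
  by (simp_all add: Hom_def)

lemma Hom_eval:
  "\<zero>\<^bsub>Hom R X N\<^esub> (coset \<one>\<^bsub>R\<^esub>) = \<zero>\<^bsub>N\<^esub>"
  "(f \<oplus>\<^bsub>Hom R X N\<^esub> g) (coset \<one>\<^bsub>R\<^esub>) = f (coset \<one>\<^bsub>R\<^esub>) \<oplus>\<^bsub>N\<^esub> g (coset \<one>\<^bsub>R\<^esub>)"
  "(r \<odot>\<^bsub>Hom R X N\<^esub> f) (coset \<one>\<^bsub>R\<^esub>) = r \<odot>\<^bsub>N\<^esub> f (coset \<one>\<^bsub>R\<^esub>)"
  using coset_one by (simp_all add: Hom_simps)

lemma Hom_closed:
  "\<zero>\<^bsub>Hom R X N\<^esub> \<in> module_hom R X N"
  "f \<in> module_hom R X N \<Longrightarrow> g \<in> module_hom R X N \<Longrightarrow> f \<oplus>\<^bsub>Hom R X N\<^esub> g \<in> module_hom R X N"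
  "r \<in> carrier R \<Longrightarrow> f \<in> module_hom R X N \<Longrightarrow> r \<odot>\<^bsub>Hom R X N\<^esub> f \<in> module_hom R X N"
proof -
  show "\<zero>\<^bsub>Hom R X N\<^esub> \<in> module_hom R X N"
    unfolding Hom_simps by (rule restrict_module_hom[OF X_module]) (rule linear_onI, auto)
  show "f \<oplus>\<^bsub>Hom R X N\<^esub> g \<in> module_hom R X N" if f: "f \<in> module_hom R X N" and g: "g \<in> module_hom R X N"
    unfolding Hom_simps
    by (rule restrict_module_hom[OF X_module], rule linear_onI)
      (use module_homD[OF f] module_homD[OF g] in \<open>auto simp: N.smult_r_distr N.a_ac\<close>)
  show "r \<odot>\<^bsub>Hom R X N\<^esub> f \<in> module_hom R X N" if r: "r \<in> carrier R" and f: "f \<in> module_hom R X N"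
    unfolding Hom_simps
    by (rule restrict_module_hom[OF X_module], rule linear_onI)
      (use r module_homD[OF f] in \<open>auto simp: N.smult_r_distr N.smult_assoc1[symmetric] R.m_comm\<close>)
qed

text \<open>The module axioms are transported from the annihilated submodule along
  \<open>\<theta>\<close>, the inverse of evaluation at the class of 1.\<close>

lemma Hom_module: "module R (Hom R X N)"
proof -
  define \<theta> where "\<theta> x = (SOME f. f \<in> module_hom R X N \<and> f (coset \<one>\<^bsub>R\<^esub>) = x)" for x
  have \<theta>: "\<theta> x \<in> module_hom R X N" "\<theta> x (coset \<one>\<^bsub>R\<^esub>) = x" if "x \<in> annihilated N I" for x
    using someI_ex[of "\<lambda>f. f \<in> module_hom R X N \<and> f (coset \<one>\<^bsub>R\<^esub>) = x"] eval_surj[OF that]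
    unfolding \<theta>_def by blast+
  have \<theta>eq: "\<theta> x = f" if "f \<in> module_hom R X N" "f (coset \<one>\<^bsub>R\<^esub>) = x" for x f
    using eval_inj[OF \<theta>(1) that(1)] \<theta>(2) eval_annihilated[OF that(1)] that(2) by simp
  have sub: "submodule (annihilated N I) R N" by (rule submodule_annihilated[OF N I_carrier])
  show ?thesis
  proof (rule epimorphic_image_module[OF submodule.submodule_is_module[OF sub N], of \<theta>])
    show "\<theta> ` carrier (N\<lparr>carrier := annihilated N I\<rparr>) = carrier (Hom R X N)"
      using \<theta>(1) \<theta>eq[OF _ refl, symmetric] eval_annihilated by (force simp: Hom_simps)
    show "\<theta> \<zero>\<^bsub>N\<lparr>carrier := annihilated N I\<rparr>\<^esub> = \<zero>\<^bsub>Hom R X N\<^esub>"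
      by (rule \<theta>eq) (auto simp: Hom_closed Hom_eval simp del: Hom_simps)
    fix x assume "x \<in> carrier (N\<lparr>carrier := annihilated N I\<rparr>)"
    then have x: "x \<in> annihilated N I" by simp
    show "\<theta> (x \<oplus>\<^bsub>N\<lparr>carrier := annihilated N I\<rparr>\<^esub> y) = \<theta> x \<oplus>\<^bsub>Hom R X N\<^esub> \<theta> y"
      if "y \<in> carrier (N\<lparr>carrier := annihilated N I\<rparr>)" for y
      by (rule \<theta>eq) (use x that \<theta> in \<open>auto simp: Hom_closed Hom_eval\<close>)
    show "\<theta> (r \<odot>\<^bsub>N\<lparr>carrier := annihilated N I\<rparr>\<^esub> x) = r \<odot>\<^bsub>Hom R X N\<^esub> \<theta> x" if "r \<in> carrier R" for r
      by (rule \<theta>eq) (use x that \<theta> in \<open>auto simp: Hom_closed Hom_eval\<close>)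
  qed
qed

lemma eval_relation: "linear_relation R (Hom R X N) N (\<lambda>f x. f (coset \<one>\<^bsub>R\<^esub>) = x)"
  by (rule linear_relationI) (auto simp: Hom_eval)

lemma annihilated_iff_generators:
  assumes x: "x \<in> carrier N"
  shows "x \<in> annihilated N I \<longleftrightarrow> (\<forall>k<b 2. D 1 k 0 \<odot>\<^bsub>N\<^esub> x = \<zero>\<^bsub>N\<^esub>)"
proof -
  have I_eq: "I = {lincomb RR (b 2) w (\<lambda>k. D 1 k 0) |w. \<forall>k. w k \<in> carrier R}"
    using resolution by (simp add: free_resolution_def)
  interpret RR: module R RR by (rule RR)
  show ?thesis
  proof
    assume "x \<in> annihilated N I"
    moreover have "D 1 k 0 \<in> I" if "k < b 2" for k
    proof -
      have "D 1 k 0 = lincomb RR (b 2) (\<lambda>i. if i = k then \<one>\<^bsub>R\<^esub> else \<zero>\<^bsub>R\<^esub>) (\<lambda>k. D 1 k 0)"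
        using RR.lincomb_unit[of "\<lambda>k. D 1 k 0" "b 2" k] D_closed that by (simp add: regular_module_simps)
      then show ?thesis unfolding I_eq
        by (intro CollectI exI[of _ "\<lambda>i. if i = k then \<one>\<^bsub>R\<^esub> else \<zero>\<^bsub>R\<^esub>"]) auto
    qed
    ultimately show "\<forall>k<b 2. D 1 k 0 \<odot>\<^bsub>N\<^esub> x = \<zero>\<^bsub>N\<^esub>" by (simp add: annihilated_def)
  next
    assume gen: "\<forall>k<b 2. D 1 k 0 \<odot>\<^bsub>N\<^esub> x = \<zero>\<^bsub>N\<^esub>"
    have "r \<odot>\<^bsub>N\<^esub> x = \<zero>\<^bsub>N\<^esub>" if "r \<in> I" for r
    proof -
      obtain w where w: "\<And>k. w k \<in> carrier R" "r = lincomb RR (b 2) w (\<lambda>k. D 1 k 0)"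
        using \<open>r \<in> I\<close> unfolding I_eq by blast
      have "r \<odot>\<^bsub>N\<^esub> x = lincomb N (b 2) w (\<lambda>k. D 1 k 0 \<odot>\<^bsub>N\<^esub> x)"
        unfolding w(2) by (rule N.lincomb_smult_vector[symmetric]) (use w(1) D_closed x in auto)
      also have "\<dots> = lincomb N (b 2) w (\<lambda>k. \<zero>\<^bsub>N\<^esub>)"
        by (rule lincomb_cong) (use gen in auto)
      finally show ?thesis using N.lincomb_zero[OF w(1)] by simp
    qed
    then show "x \<in> annihilated N I" using x by (simp add: annihilated_def)
  qed
qed

text \<open>As \<open>b 1\<close> is 1, only entry 0 is a genuine coordinate, and the differential
  multiplies it by the generators of \<open>I\<close>.\<close>

lemma cocycles_0:
  assumes K: "submodule K R N"
  shows "x \<in> cocycles 0 N K \<longleftrightarrow> (\<forall>i. x i \<in> K) \<and> x 0 \<in> annihilated N I"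
proof (cases "\<forall>i. x i \<in> K")
  case True
  then have "x 0 \<in> carrier N" using N.submoduleD(2)[OF K] by blast
  moreover have "del (Suc 0) N x k = D 1 k 0 \<odot>\<^bsub>N\<^esub> x 0" for k
    using b_1 D_closed \<open>x 0 \<in> carrier N\<close> by (simp add: del_def)
  ultimately show ?thesis
    using True annihilated_iff_generators[of "x 0"] by (simp add: cocycles_def numeral_2_eq_2)
qed (auto simp: cocycles_def)

lemma coboundaries_0:
  assumes K: "submodule K R N"
  shows "x \<in> coboundaries 0 N K \<longleftrightarrow> (\<forall>i. x i \<in> K) \<and> x 0 = \<zero>\<^bsub>N\<^esub>"
  using N.submoduleD(1)[OF K] b_0 b_1 by (auto simp: coboundaries_def del_def)

lemma entry_0_relation: "linear_relation R N (sequence_module N) (\<lambda>x y. y 0 = x)"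
  by (rule linear_relationI) auto

text \<open>\<open>C\<close> is kept general because two denominators occur: the coboundaries for
  Hom itself, and the set \<open>lifted 0\<close> for Hom modulo the image of another Hom.\<close>

lemma entry_0_iso:
  assumes K: "submodule K R N" and "\<zero>\<^bsub>N\<^esub> \<in> B" "\<zero>\<^bsub>sequence_module N\<^esub> \<in> C"
    and C: "\<And>z. z \<in> cocycles 0 N K \<Longrightarrow> z \<in> C \<longleftrightarrow> z 0 \<in> B"
  shows "subquotient_in R S N (K \<inter> annihilated N I) B \<longleftrightarrow>
    subquotient_in R S (sequence_module N) (cocycles 0 N K) C"
proof (rule subquotient_iso[OF N N.module_sequence _ submodule_cocycles[OF N K] entry_0_relation])
  show "submodule (K \<inter> annihilated N I) R N"
    by (rule N.submodule_criterion)
      (use N.submoduleD[OF K] N.submoduleD[OF submodule_annihilated[OF N I_carrier]] in auto)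
  show "\<exists>y\<in>cocycles 0 N K. y 0 = z" if "z \<in> K \<inter> annihilated N I" for z
    using that by (intro bexI[of _ "\<lambda>_. z"]) (auto simp: cocycles_0[OF K])
qed (use assms in \<open>auto simp: cocycles_0[OF K]\<close>)

lemma ext_in_0: "ext_in 0 N (carrier N) \<longleftrightarrow> belongs_to R (Hom R X N) S"
proof -
  have "belongs_to R (Hom R X N) S \<longleftrightarrow>
    subquotient_in R S (Hom R X N) (carrier (Hom R X N)) {\<zero>\<^bsub>Hom R X N\<^esub>}"
    by (rule belongs_to_iff[OF Hom_module])
  also have "\<dots> \<longleftrightarrow> subquotient_in R S N (annihilated N I) {\<zero>\<^bsub>N\<^esub>}"
  proof (rule subquotient_iso[OF Hom_module N module.carrier_is_submodule[OF Hom_module]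
        submodule_annihilated[OF N I_carrier] eval_relation])
    show "\<exists>f\<in>carrier (Hom R X N). f (coset \<one>\<^bsub>R\<^esub>) = x" if "x \<in> annihilated N I" for x
      using eval_surj[OF that] by (simp add: Hom_simps)
    show "x \<in> {\<zero>\<^bsub>N\<^esub>} \<longleftrightarrow> f \<in> {\<zero>\<^bsub>Hom R X N\<^esub>}"
      if "f \<in> carrier (Hom R X N)" "f (coset \<one>\<^bsub>R\<^esub>) = x" for f x
      using that eval_inj[of f "\<zero>\<^bsub>Hom R X N\<^esub>"] Hom_closed(1) Hom_eval(1) by (auto simp: Hom_simps(1))
  qed (use eval_annihilated in \<open>auto simp: Hom_simps(1)\<close>)
  also have "\<dots> \<longleftrightarrow> subquotient_in R S N (carrier N \<inter> annihilated N I) {\<zero>\<^bsub>N\<^esub>}"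
    by (rule arg_cong[where f = "\<lambda>Z. subquotient_in R S N Z {\<zero>\<^bsub>N\<^esub>}"]) (auto simp: annihilated_def)
  also have "\<dots> \<longleftrightarrow> ext_in 0 N (carrier N)"
    unfolding ext_in_def
  proof (rule entry_0_iso[OF N.carrier_is_submodule])
    show "z \<in> coboundaries 0 N (carrier N) \<longleftrightarrow> z 0 \<in> {\<zero>\<^bsub>N\<^esub>}" if "z \<in> cocycles 0 N (carrier N)" for z
      using that by (auto simp: coboundaries_0[OF N.carrier_is_submodule] cocycles_def)
  qed (auto simp: coboundaries_0[OF N.carrier_is_submodule])
  finally show ?thesis ..
qed

text \<open>An injective linear map commutes with the differentials and reflects their vanishing and
  solvability. It carries Ext across carrier types, notably along the augmentation of a
  resolution.\<close>

lemma ext_in_iso: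
  fixes M :: "('r, 'm) module"
  assumes M: "module R M" and K: "submodule K R M" and g: "linear_on R M N K g" and inj: "inj_on g K"
  shows "ext_in p M K \<longleftrightarrow> ext_in p N (g ` K)"
  unfolding ext_in_def
proof -
  interpret M: module R M by (rule M)
  note KD = M.submoduleD[OF K] and gD = linear_onD[OF g]
  have gK: "submodule (g ` K) R N" by (rule linear_on_image[OF M N K g])
  have gdel: "g (del q M y i) = del q N (\<lambda>l. g (y l)) i" if "\<And>l. y l \<in> K" for q y i
    by (rule del_linear_on[OF M N K g that])
  have g0: "g \<zero>\<^bsub>M\<^esub> = \<zero>\<^bsub>N\<^esub>" by (rule linear_on_zero[OF M N K g])
  have delK: "del q M y i \<in> K" if "\<And>l. y l \<in> K" for q y i by (rule del_in_submodule[OF M K that])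
  have injD: "u = v" if "g u = g v" "u \<in> K" "v \<in> K" for u v using inj_onD[OF inj that] .
  have gz: "g u = \<zero>\<^bsub>N\<^esub> \<longleftrightarrow> u = \<zero>\<^bsub>M\<^esub>" if "u \<in> K" for u
    using injD[of u "\<zero>\<^bsub>M\<^esub>"] g0 that KD(1) by auto
  have lift: "\<exists>x. (\<forall>i. x i \<in> K) \<and> y = (\<lambda>i. g (x i))" if y: "\<And>i. y i \<in> g ` K" for y :: "nat \<Rightarrow> 'n"
  proof -
    have "\<forall>i. \<exists>u. u \<in> K \<and> y i = g u" using y by blast
    then obtain x where "\<forall>i. x i \<in> K \<and> y i = g (x i)" by metis
    then show ?thesis by (intro exI[of _ x]) auto
  qed
  have cocyc: "(\<lambda>i. g (x i)) \<in> cocycles p N (g ` K) \<longleftrightarrow> x \<in> cocycles p M K" if x: "\<And>i. x i \<in> K" for x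
  proof -
    have "del (Suc p) N (\<lambda>i. g (x i)) k = \<zero>\<^bsub>N\<^esub> \<longleftrightarrow> del (Suc p) M x k = \<zero>\<^bsub>M\<^esub>" for k
      unfolding gdel[OF x, symmetric] by (rule gz[OF delK[OF x]])
    then show ?thesis using x by (simp add: cocycles_def)
  qed
  have cob: "(\<lambda>i. g (x i)) \<in> coboundaries p N (g ` K) \<longleftrightarrow> x \<in> coboundaries p M K" if x: "\<And>i. x i \<in> K" for x
  proof
    assume "(\<lambda>i. g (x i)) \<in> coboundaries p N (g ` K)"
    then obtain y where y: "\<And>l. y l \<in> g ` K" "\<And>i. i < b (Suc p) \<Longrightarrow> g (x i) = del p N y i"
      by (rule coboundariesE) blast
    obtain u where u: "\<forall>i. u i \<in> K" "y = (\<lambda>i. g (u i))"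
      using lift[of y, OF y(1)] by (elim exE conjE)
    have uK: "u i \<in> K" for i using u(1) by blast
    have "x i = del p M u i" if "i < b (Suc p)" for i
    proof (rule injD[OF _ x delK[OF uK]])
      show "g (x i) = g (del p M u i)" using y(2)[OF that] unfolding gdel[OF uK] u(2) .
    qed
    then show "x \<in> coboundaries p M K" using x u(1) by (intro coboundariesI[of x K u]) auto
  next
    assume "x \<in> coboundaries p M K"
    then obtain u where u: "\<And>l. u l \<in> K" "\<And>i. i < b (Suc p) \<Longrightarrow> x i = del p M u i"
      by (rule coboundariesE) blast
    show "(\<lambda>i. g (x i)) \<in> coboundaries p N (g ` K)"
      by (rule coboundariesI[of _ _ "\<lambda>l. g (u l)"]) (use x u gdel[OF u(1)] in auto)
  qed
  show "subquotient_in R S (sequence_module M) (cocycles p M K) (coboundaries p M K) \<longleftrightarrow>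
    subquotient_in R S (sequence_module N) (cocycles p N (g ` K)) (coboundaries p N (g ` K))"
  proof (rule subquotient_iso[OF M.module_sequence N.module_sequence submodule_cocycles[OF M K]
        submodule_cocycles[OF N gK]])
    show "linear_relation R (sequence_module M) (sequence_module N)
      (\<lambda>x y. (\<forall>i. x i \<in> K) \<and> y = (\<lambda>i. g (x i)))"
      by (rule linear_relationI) (use gD KD in auto)
    show "\<exists>y\<in>cocycles p N (g ` K). (\<forall>i. z i \<in> K) \<and> y = (\<lambda>i. g (z i))" if "z \<in> cocycles p M K" for z
      using cocyc[of z] cocyclesD(1)[OF that] that by blast
    show "\<exists>z\<in>cocycles p M K. (\<forall>i. z i \<in> K) \<and> y = (\<lambda>i. g (z i))" if y: "y \<in> cocycles p N (g ` K)" for y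
    proof -
      obtain x where x: "\<forall>i. x i \<in> K" "y = (\<lambda>i. g (x i))"
        using lift[of y, OF cocyclesD(1)[OF y]] by (elim exE conjE)
      then show ?thesis using cocyc[of x] y by blast
    qed
    show "y \<in> coboundaries p N (g ` K) \<longleftrightarrow> z \<in> coboundaries p M K"
      if "z \<in> cocycles p M K" "y \<in> cocycles p N (g ` K)" "(\<forall>i. z i \<in> K) \<and> y = (\<lambda>i. g (z i))" for z y
      using cob[of z] that(3) by simp
  qed (rule module.submoduleD(1)[OF M.module_sequence submodule_coboundaries[OF M K]],
      rule module.submoduleD(1)[OF N.module_sequence submodule_coboundaries[OF N gK]])
qed

end

end

section \<open>Agreement of the two computations of Ext\<close>

locale ext_resolution = ext_setup R S I b D
  for R :: "('r, 'k) ring_scheme" and S :: "('r, 'u::infinite) module set" and I b D +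
  fixes N :: "('r, 'n) module" and E :: "nat \<Rightarrow> ('r, 'e) module" and d :: "nat \<Rightarrow> 'e \<Rightarrow> 'e"
  assumes N: "module R N" and inj_res: "injective_resolution R N (E, d)"
begin

lemma E_injective: "injective_module R (E n)"
  and d_hom: "d n \<in> module_hom R (E n) (E (Suc n))"
  and d_exact: "d n ` carrier (E n) = a_kernel (E (Suc n)) (E (Suc (Suc n))) (d (Suc n))"
  and augmentation: "\<exists>\<epsilon>\<in>module_hom R N (E 0). inj_on \<epsilon> (carrier N) \<and>
    \<epsilon> ` carrier N = a_kernel (E 0) (E 1) (d 0)"
  using inj_res by (auto simp: injective_resolution_def)

lemma E_module: "module R (E n)"
  using E_injective by (simp add: injective_module_def)

definition ker_d :: "nat \<Rightarrow> 'e set" where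
  "ker_d n = {x \<in> carrier (E n). d n x = \<zero>\<^bsub>E (Suc n)\<^esub>}"

lemma ker_d_eq: "a_kernel (E n) (E (Suc n)) (d n) = ker_d n"
  by (simp add: a_kernel_def' ker_d_def)

lemmas E_carrier = module.carrier_is_submodule[OF E_module]
  and d_linear = module_homD(5)[OF d_hom] and d_closed = module_homD(1)[OF d_hom]

lemma ker_d_submodule: "submodule (ker_d n) R (E n)"
  unfolding ker_d_def by (rule linear_on_kernel[OF E_module E_module E_carrier d_linear])

lemma d_d: "x \<in> carrier (E n) \<Longrightarrow> d (Suc n) (d n x) = \<zero>\<^bsub>E (Suc (Suc n))\<^esub>"
  using d_exact[of n] unfolding ker_d_eq by (auto simp: ker_d_def)

lemma E_acyclic: "cocycles (Suc p) (E n) (carrier (E n)) \<subseteq> coboundaries (Suc p) (E n) (carrier (E n))"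
  by (rule baer_acyclic[OF E_module E_carrier injective_module_baer[OF E_injective]]) simp

lemma E_sequence: "ext_sequence R S I b D (E n) (E (Suc n)) (carrier (E n)) (d n) (ker_d n) (ker_d (Suc n))"
  by (intro ext_sequence.intro ext_setup_axioms ext_sequence_axioms.intro E_module E_carrier d_linear)
    (use d_exact[of n] in \<open>auto simp: ker_d_eq ker_d_def\<close>)

text \<open>Dimension shifting along 0 -> ker d^q -> E^q -> ker d^(q+1) -> 0. The degree is kept
  positive because Hom(R/I, E^q) need not vanish.\<close>

lemma E_shift: "ext_in (Suc p) (E q) (ker_d q) \<longleftrightarrow> ext_in (Suc p + q) (E 0) (ker_d 0)"
proof (induction q arbitrary: p)
  case (Suc q)
  have "ext_in (Suc p) (E (Suc q)) (ker_d (Suc q)) \<longleftrightarrow> ext_in (Suc (Suc p)) (E q) (ker_d q)"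
    by (rule ext_sequence.dimension_shift[OF E_sequence E_acyclic E_acyclic])
  then show ?case using Suc[of "Suc p"] by simp
qed simp

lemma ext_in_augmentation: "ext_in p N (carrier N) \<longleftrightarrow> ext_in p (E 0) (ker_d 0)"
proof -
  obtain \<epsilon> where \<epsilon>: "\<epsilon> \<in> module_hom R N (E 0)" "inj_on \<epsilon> (carrier N)" "\<epsilon> ` carrier N = ker_d 0"
    using augmentation ker_d_eq[of 0] by auto
  show ?thesis
    using ext_in_iso[OF E_module N module.carrier_is_submodule[OF N] module_homD(5)[OF \<epsilon>(1)] \<epsilon>(2)] \<epsilon>(3)
    by simp
qed

text \<open>The coboundaries of the complex Hom(R/I, E), seen through evaluation at the class of
  1.\<close>

definition ext_boundaries :: "nat \<Rightarrow> 'e set" where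
  "ext_boundaries j = (case j of 0 \<Rightarrow> {\<zero>\<^bsub>E 0\<^esub>} | Suc k \<Rightarrow> d k ` annihilated (E k) I)"

text \<open>In degree k + 1 the left-hand side is Hom(R/I, ker d^(k+1)) modulo the image of Hom(R/I,
  E^k). The connecting homomorphism identifies this with Ext^1(R/I, ker d^k), and
  \<open>E_shift\<close> turns it into Ext^(k+1) of \<open>ker_d 0\<close>, a copy of
  \<open>N\<close>.\<close>

lemma ext_model_iff:
  "subquotient_in R S (E j) (ker_d j \<inter> annihilated (E j) I) (ext_boundaries j) \<longleftrightarrow> ext_in j N (carrier N)"
proof (cases j)
  case 0
  interpret E0: module R "E 0" by (rule E_module)
  have "subquotient_in R S (E 0) (ker_d 0 \<inter> annihilated (E 0) I) {\<zero>\<^bsub>E 0\<^esub>} \<longleftrightarrow> ext_in 0 (E 0) (ker_d 0)"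
    unfolding ext_in_def
  proof (rule entry_0_iso[OF E_module ker_d_submodule])
    show "z \<in> coboundaries 0 (E 0) (ker_d 0) \<longleftrightarrow> z 0 \<in> {\<zero>\<^bsub>E 0\<^esub>}" if "z \<in> cocycles 0 (E 0) (ker_d 0)" for z
      using that by (auto simp: coboundaries_0[OF E_module ker_d_submodule] cocycles_def)
  qed (use E0.submoduleD(1)[OF ker_d_submodule] in \<open>auto simp: coboundaries_0[OF E_module ker_d_submodule]\<close>)
  then show ?thesis using 0 by (simp add: ext_boundaries_def ext_in_augmentation)
next
  case (Suc k)
  interpret seq: ext_sequence R S I b D "E k" "E (Suc k)" "carrier (E k)" "d k" "ker_d k" "ker_d (Suc k)"
    by (rule E_sequence)
  interpret Ek: module R "E k" by (rule E_module)
  have zero: "d k \<zero>\<^bsub>E k\<^esub> = \<zero>\<^bsub>E (Suc k)\<^esub>"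
    by (rule linear_on_zero[OF E_module E_module E_carrier d_linear])
  have ann0: "\<zero>\<^bsub>E k\<^esub> \<in> annihilated (E k) I"
    by (rule Ek.submoduleD(1)[OF submodule_annihilated[OF E_module I_carrier]])
  have "subquotient_in R S (E (Suc k)) (ker_d (Suc k) \<inter> annihilated (E (Suc k)) I) (d k ` annihilated (E k) I) \<longleftrightarrow>
    subquotient_in R S (sequence_module (E (Suc k))) (cocycles 0 (E (Suc k)) (ker_d (Suc k))) (seq.lifted 0)"
  proof (rule entry_0_iso[OF E_module ker_d_submodule])
    show "\<zero>\<^bsub>E (Suc k)\<^esub> \<in> d k ` annihilated (E k) I" using zero ann0 by (metis imageI)
    show "\<zero>\<^bsub>sequence_module (E (Suc k))\<^esub> \<in> seq.lifted 0"
      by (rule module.submoduleD(1)[OF seq.seqE' seq.submodule_lifted])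
    fix z assume z: "z \<in> cocycles 0 (E (Suc k)) (ker_d (Suc k))"
    show "z \<in> seq.lifted 0 \<longleftrightarrow> z 0 \<in> d k ` annihilated (E k) I"
    proof
      assume "z \<in> seq.lifted 0"
      then obtain e where e: "e \<in> cocycles 0 (E k) (carrier (E k))" "\<And>i. i < b (Suc 0) \<Longrightarrow> z i = d k (e i)"
        by (rule seq.liftedE) blast
      then show "z 0 \<in> d k ` annihilated (E k) I"
        using b_1 cocycles_0[OF E_module E_carrier, of e] by auto
    next
      assume "z 0 \<in> d k ` annihilated (E k) I"
      then obtain e where e: "e \<in> annihilated (E k) I" "z 0 = d k e" by blast
      show "z \<in> seq.lifted 0"
      proof (rule seq.liftedI)
        show "(\<lambda>_. e) \<in> cocycles 0 (E k) (carrier (E k))"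
          using e(1) by (simp add: cocycles_0[OF E_module E_carrier] annihilated_def)
      qed (use z e(2) b_1 in \<open>auto simp: cocycles_def\<close>)
    qed
  qed
  also have "\<dots> \<longleftrightarrow> ext_in (Suc 0) (E k) (ker_d k)" by (rule seq.shift_iff[OF E_acyclic])
  also have "\<dots> \<longleftrightarrow> ext_in j N (carrier N)" using E_shift[of 0 k] Suc by (simp add: ext_in_augmentation)
  finally show ?thesis using Suc by (simp add: ext_boundaries_def)
qed

definition Hom_map :: "nat \<Rightarrow> ('r set \<Rightarrow> 'e) \<Rightarrow> ('r set \<Rightarrow> 'e)" where
  "Hom_map n = (\<lambda>f\<in>module_hom R X (E n). compose (carrier X) (d n) f)"

lemma Hom_map_closed:
  assumes f: "f \<in> module_hom R X (E n)"
  shows "Hom_map n f \<in> module_hom R X (E (Suc n))"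
proof -
  have "restrict (\<lambda>x. d n (f x)) (carrier X) \<in> module_hom R X (E (Suc n))"
    by (rule restrict_module_hom[OF X_module], rule linear_onI)
      (use module_homD[OF f] module_homD[OF d_hom] in auto)
  then show ?thesis using f by (simp add: Hom_map_def compose_def)
qed

lemma Hom_map_eval:
  "f \<in> module_hom R X (E n) \<Longrightarrow> Hom_map n f (coset \<one>\<^bsub>R\<^esub>) = d n (f (coset \<one>\<^bsub>R\<^esub>))"
  using coset_one by (simp add: Hom_map_def compose_def)

lemma Hom_map_linear: "linear_on R (Hom R X (E n)) (Hom R X (E (Suc n))) (module_hom R X (E n)) (Hom_map n)"
proof (rule linear_onI)
  fix f assume f: "f \<in> module_hom R X (E n)"
  show "Hom_map n f \<in> carrier (Hom R X (E (Suc n)))"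
    using Hom_map_closed[OF f] by (simp add: Hom_simps(1)[OF E_module])
  show "Hom_map n (f \<oplus>\<^bsub>Hom R X (E n)\<^esub> g) = Hom_map n f \<oplus>\<^bsub>Hom R X (E (Suc n))\<^esub> Hom_map n g"
    if g: "g \<in> module_hom R X (E n)" for g
    by (rule eval_inj[OF E_module[of "Suc n"]])
      (use f g Hom_closed(2)[OF E_module f g] in
        \<open>simp_all add: Hom_map_closed Hom_closed[OF E_module] Hom_map_eval Hom_eval[OF E_module]
          module_homD[OF d_hom] module_homD(1)[OF _ coset_one]\<close>)
  show "Hom_map n (r \<odot>\<^bsub>Hom R X (E n)\<^esub> f) = r \<odot>\<^bsub>Hom R X (E (Suc n))\<^esub> Hom_map n f" if r: "r \<in> carrier R" for r
    by (rule eval_inj[OF E_module[of "Suc n"]])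
      (use f r Hom_closed(3)[OF E_module r f] in
        \<open>simp_all add: Hom_map_closed Hom_closed[OF E_module] Hom_map_eval Hom_eval[OF E_module]
          module_homD[OF d_hom] module_homD(1)[OF _ coset_one]\<close>)
qed

lemma Hom_map_zero_iff:
  assumes f: "f \<in> module_hom R X (E n)"
  shows "Hom_map n f = \<zero>\<^bsub>Hom R X (E (Suc n))\<^esub> \<longleftrightarrow> f (coset \<one>\<^bsub>R\<^esub>) \<in> ker_d n"
proof -
  have "Hom_map n f = \<zero>\<^bsub>Hom R X (E (Suc n))\<^esub> \<longleftrightarrow> Hom_map n f (coset \<one>\<^bsub>R\<^esub>) = \<zero>\<^bsub>E (Suc n)\<^esub>"
    using eval_inj[OF E_module Hom_map_closed[OF f] Hom_closed(1)[OF E_module]] Hom_eval(1)[OF E_module, of "Suc n"]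
    by auto
  then show ?thesis
    using Hom_map_eval[OF f] module_homD(1)[OF f coset_one] by (simp add: ker_d_def)
qed

text \<open>Evaluation at the class of 1 matches cocycles and coboundaries of the Hom complex with
  the submodules in \<open>ext_model_iff\<close>.\<close>

lemma Hom_cohomology_iff:
  "belongs_to R (cohomology (\<lambda>n. Hom R X (E n)) Hom_map j) S \<longleftrightarrow> ext_in j N (carrier N)"
proof -
  let ?H = "\<lambda>n. Hom R X (E n)"
  have Hm: "module R (?H n)" and Hc: "carrier (?H n) = module_hom R X (E n)" for n
    using Hom_module[OF E_module] Hom_simps(1)[OF E_module] by auto
  have Hs: "submodule (module_hom R X (E n)) R (?H n)" for n
    using module.carrier_is_submodule[OF Hm] by (simp add: Hc)
  define Z where "Z = {f \<in> module_hom R X (E j). Hom_map j f = \<zero>\<^bsub>?H (Suc j)\<^esub>}"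
  define B where "B = (case j of 0 \<Rightarrow> {\<zero>\<^bsub>?H 0\<^esub>} | Suc k \<Rightarrow> Hom_map k ` module_hom R X (E k))"
  have Z: "submodule Z R (?H j)" unfolding Z_def by (rule linear_on_kernel[OF Hm Hm Hs Hom_map_linear])
  have B: "submodule B R (?H j)"
  proof (cases j)
    case 0
    then show ?thesis using module.submodule_zero[OF Hm] by (simp add: B_def)
  next
    case (Suc k)
    then show ?thesis using linear_on_image[OF Hm Hm Hs Hom_map_linear, of k] by (simp add: B_def)
  qed
  have Z_iff: "f \<in> Z \<longleftrightarrow> f (coset \<one>\<^bsub>R\<^esub>) \<in> ker_d j" if "f \<in> module_hom R X (E j)" for f
    using that Hom_map_zero_iff[OF that] by (simp add: Z_def)
  have B_iff: "f \<in> B \<longleftrightarrow> f (coset \<one>\<^bsub>R\<^esub>) \<in> ext_boundaries j" if f: "f \<in> module_hom R X (E j)" for f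
  proof (cases j)
    case 0
    then show ?thesis
      using eval_inj[OF E_module f Hom_closed(1)[OF E_module]] Hom_eval(1)[OF E_module, of 0]
      by (auto simp: B_def ext_boundaries_def)
  next
    case (Suc k)
    have "f \<in> Hom_map k ` module_hom R X (E k) \<longleftrightarrow> f (coset \<one>\<^bsub>R\<^esub>) \<in> d k ` annihilated (E k) I"
    proof
      assume "f \<in> Hom_map k ` module_hom R X (E k)"
      then show "f (coset \<one>\<^bsub>R\<^esub>) \<in> d k ` annihilated (E k) I"
        using Hom_map_eval eval_annihilated[OF E_module] by auto
    next
      assume "f (coset \<one>\<^bsub>R\<^esub>) \<in> d k ` annihilated (E k) I"
      then obtain x where x: "x \<in> annihilated (E k) I" "f (coset \<one>\<^bsub>R\<^esub>) = d k x" by blast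
      obtain g where g: "g \<in> module_hom R X (E k)" "g (coset \<one>\<^bsub>R\<^esub>) = x"
        using eval_surj[OF E_module x(1)] by blast
      have "f = Hom_map k g"
        by (rule eval_inj[OF E_module, of _ "Suc k"])
          (use f Suc g x Hom_map_closed Hom_map_eval in auto)
      then show "f \<in> Hom_map k ` module_hom R X (E k)" using g(1) by blast
    qed
    then show ?thesis using Suc by (simp add: B_def ext_boundaries_def)
  qed
  have "B \<subseteq> Z"
  proof
    fix f assume f: "f \<in> B"
    then have fh: "f \<in> module_hom R X (E j)" using module.submoduleD(2)[OF Hm B] by (simp add: Hc)
    have "f (coset \<one>\<^bsub>R\<^esub>) \<in> ker_d j"
    proof (cases j)
      case 0
      then show ?thesis using B_iff[OF fh] f module.submoduleD(1)[OF E_module ker_d_submodule]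
        by (auto simp: ext_boundaries_def)
    next
      case (Suc k)
      then show ?thesis using B_iff[OF fh] f d_d d_closed
        by (auto simp: ext_boundaries_def ker_d_def annihilated_def)
    qed
    then show "f \<in> Z" using Z_iff[OF fh] by simp
  qed
  have "cohomology ?H Hom_map j = quotient_module ((?H j)\<lparr>carrier := Z\<rparr>) B"
    unfolding cohomology_def Z_def B_def a_kernel_def' Hc ..
  then have "belongs_to R (cohomology ?H Hom_map j) S \<longleftrightarrow> subquotient_in R S (?H j) Z B"
    using belongs_to_subquotient[OF Hm Z B \<open>B \<subseteq> Z\<close>] by simp
  also have "\<dots> \<longleftrightarrow> subquotient_in R S (E j) (ker_d j \<inter> annihilated (E j) I) (ext_boundaries j)"
  proof (rule subquotient_iso[OF Hm E_module Z _ eval_relation[OF E_module]])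
    show "submodule (ker_d j \<inter> annihilated (E j) I) R (E j)"
      by (rule module.submodule_criterion[OF E_module])
        (use module.submoduleD[OF E_module ker_d_submodule]
          module.submoduleD[OF E_module submodule_annihilated[OF E_module I_carrier]] in auto)
    show "\<exists>y\<in>ker_d j \<inter> annihilated (E j) I. f (coset \<one>\<^bsub>R\<^esub>) = y" if "f \<in> Z" for f
      using that Z_iff[of f] eval_annihilated[OF E_module, of f] by (auto simp: Z_def)
    show "\<exists>f\<in>Z. f (coset \<one>\<^bsub>R\<^esub>) = y" if "y \<in> ker_d j \<inter> annihilated (E j) I" for y
      using that eval_surj[OF E_module, of y] Z_iff by blast
    show "y \<in> ext_boundaries j \<longleftrightarrow> f \<in> B" if "f \<in> Z" "f (coset \<one>\<^bsub>R\<^esub>) = y" for f y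
      using that B_iff[of f] by (auto simp: Z_def)
    show zB: "\<zero>\<^bsub>?H j\<^esub> \<in> B" by (rule module.submoduleD(1)[OF Hm B])
    then show "\<zero>\<^bsub>E j\<^esub> \<in> ext_boundaries j"
      using B_iff[OF Hom_closed(1)[OF E_module]] Hom_eval(1)[OF E_module, of j] by simp
  qed
  also have "\<dots> \<longleftrightarrow> ext_in j N (carrier N)" by (rule ext_model_iff)
  finally show ?thesis .
qed

end

text \<open>The right-hand side no longer refers to a resolution of \<open>N\<close>, which is what
  makes Ext of different modules comparable.\<close>

lemma (in ext_setup) Ext_iff:
  fixes N :: "('r, 'n) module"
  assumes N: "module R N"
  shows "belongs_to R (Ext R j X N) S \<longleftrightarrow> ext_in j N (carrier N)"
proof -
  obtain E d where Ed: "chosen_resolution R N = (E, d)" by (cases "chosen_resolution R N")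
  interpret ext_resolution R S I b D N E d
    by (intro ext_resolution.intro ext_setup_axioms ext_resolution_axioms.intro N)
      (use chosen_resolution[OF N] Ed in simp)
  have "Ext R j X N = cohomology (\<lambda>n. Hom R X (E n)) Hom_map j"
    unfolding Ext_def right_derived_def Ed Hom_map_def by simp
  then show ?thesis using Hom_cohomology_iff by simp
qed

section \<open>The torsion complex and local cohomology\<close>

context ext_resolution
begin

definition tors :: "nat \<Rightarrow> 'e set" where "tors n = carrier (torsion R I (E n))"

definition tors_cocycles :: "nat \<Rightarrow> 'e set" where
  "tors_cocycles n = {x \<in> tors n. d n x = \<zero>\<^bsub>E (Suc n)\<^esub>}"

definition tors_boundaries :: "nat \<Rightarrow> 'e set" where
  "tors_boundaries n = (case n of 0 \<Rightarrow> {\<zero>\<^bsub>E 0\<^esub>} | Suc k \<Rightarrow> d k ` tors k)"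

definition H :: "nat \<Rightarrow> ('r, 'e set) module" where
  "H n = quotient_module ((E n)\<lparr>carrier := tors_cocycles n\<rparr>) (tors_boundaries n)"

lemma tors_submodule: "submodule (tors n) R (E n)"
  unfolding tors_def by (rule cring.submodule_torsion[OF cring ideal E_module])

lemma tors_carrier: "tors n \<subseteq> carrier (E n)"
  using module.submoduleD(2)[OF E_module tors_submodule] by blast

lemma d_tors: "x \<in> tors n \<Longrightarrow> d n x \<in> tors (Suc n)"
  unfolding tors_def by (rule cring.linear_on_torsion[OF cring E_module E_module d_linear _ ideal])

lemma d_tors_linear: "linear_on R (E n) (E (Suc n)) (tors n) (d n)"
  by (rule linear_on_mono[OF d_linear tors_carrier])

lemma tors_cocycles_submodule: "submodule (tors_cocycles n) R (E n)"
  unfolding tors_cocycles_def by (rule linear_on_kernel[OF E_module E_module tors_submodule d_tors_linear])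

lemma tors_boundaries_submodule: "submodule (tors_boundaries n) R (E n)"
proof (cases n)
  case 0
  then show ?thesis using module.submodule_zero[OF E_module] by (simp add: tors_boundaries_def)
next
  case (Suc k)
  then show ?thesis
    using linear_on_image[OF E_module E_module tors_submodule d_tors_linear, of k]
    by (simp add: tors_boundaries_def)
qed

lemma tors_boundaries_subset: "tors_boundaries n \<subseteq> tors_cocycles n"
proof (cases n)
  case 0
  then show ?thesis using module.submoduleD(1)[OF E_module tors_cocycles_submodule[of 0]]
    by (simp add: tors_boundaries_def)
next
  case (Suc k)
  then show ?thesis using d_tors d_d tors_carrier[of k]
    by (auto simp: tors_boundaries_def tors_cocycles_def)
qed

text \<open>The torsion part inherits Baer's property from \<open>E n\<close>, and
  \<open>baer_acyclic\<close> asks for no more than that.\<close>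

lemma tors_acyclic: "cocycles (Suc p) (E n) (tors n) \<subseteq> coboundaries (Suc p) (E n) (tors n)"
proof (rule baer_acyclic[OF E_module tors_submodule])
  show "baer_property R (E n) (tors n)"
    unfolding tors_def by (rule noetherian_cring.torsion_baer[OF noetherian_cring ideal E_module injective_module_baer[OF E_injective]])
qed simp

lemma tors_sequence: "ext_sequence R S I b D (E n) (E (Suc n)) (tors n) (d n) (tors_cocycles n) (tors_boundaries (Suc n))"
  by (intro ext_sequence.intro ext_setup_axioms ext_sequence_axioms.intro E_module tors_submodule d_tors_linear)
    (simp_all add: tors_cocycles_def tors_boundaries_def)

lemma tors_cocycles_module: "module R ((E n)\<lparr>carrier := tors_cocycles n\<rparr>)"
  by (rule submodule.submodule_is_module[OF tors_cocycles_submodule E_module])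

lemmas H_projection = quotient_module_projection[OF tors_cocycles_module
    module.submodule_restrict[OF E_module tors_boundaries_submodule tors_cocycles_submodule tors_boundaries_subset],
    folded H_def, simplified]

definition proj :: "nat \<Rightarrow> 'e \<Rightarrow> 'e set" where
  "proj n x = tors_boundaries n +>\<^bsub>(E n)\<lparr>carrier := tors_cocycles n\<rparr>\<^esub> x"

lemma H_module: "module R (H n)" by (rule H_projection(5))

lemma H_sequence: "ext_sequence R S I b D (E n) (H n) (tors_cocycles n) (proj n) (tors_boundaries n) (carrier (H n))"
proof (intro ext_sequence.intro ext_setup_axioms ext_sequence_axioms.intro E_module H_module tors_cocycles_submodule)
  show "linear_on R (E n) (H n) (tors_cocycles n) (proj n)"
    using H_projection(1)[of n] by (simp add: proj_def[abs_def])
  show "tors_boundaries n = {u \<in> tors_cocycles n. proj n u = \<zero>\<^bsub>H n\<^esub>}"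
    using H_projection(4)[of _ n] tors_boundaries_subset[of n] by (auto simp: proj_def)
  show "carrier (H n) = proj n ` tors_cocycles n"
    using H_projection(2)[of n] by (simp add: proj_def[abs_def])
qed

lemma torsion_cohomology:
  "cohomology (\<lambda>n. torsion R I (E n)) (\<lambda>n. restrict (d n) (carrier (torsion R I (E n)))) n = H n"
proof -
  have "a_kernel (torsion R I (E n)) (torsion R I (E (Suc n))) (restrict (d n) (tors n)) = tors_cocycles n"
    by (auto simp: a_kernel_def' tors_cocycles_def tors_def torsion_def)
  moreover have "(case n of 0 \<Rightarrow> {\<zero>\<^bsub>torsion R I (E 0)\<^esub>}
    | Suc k \<Rightarrow> restrict (d k) (tors k) ` carrier (torsion R I (E k))) = tors_boundaries n"
    by (cases n) (auto simp: tors_boundaries_def tors_def torsion_def)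
  moreover have "(torsion R I (E n))\<lparr>carrier := Y\<rparr> = (E n)\<lparr>carrier := Y\<rparr>" for Y
    by (simp add: torsion_def)
  ultimately show ?thesis unfolding cohomology_def H_def tors_def by simp
qed

text \<open>The degree \<open>j\<close> is left arbitrary in the induction because each step uses
  the previous one in the next higher degree.\<close>

lemma ext_in_tors_boundaries:
  assumes hyp: "\<And>i j. i < s \<Longrightarrow> ext_in j (H i) (carrier (H i))"
  shows "i \<le> s \<Longrightarrow> ext_in (Suc j) (E i) (tors_boundaries i)"
proof (induction i arbitrary: j)
  case 0
  have z: "submodule {\<zero>\<^bsub>E 0\<^esub>} R (E 0)" by (rule module.submodule_zero[OF E_module])
  interpret SE: module R "sequence_module (E 0)" by (rule module.module_sequence[OF E_module])
  \<comment> \<open>B^0 is zero, so every cochain with values in it vanishes.\<close>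
  have "cocycles (Suc j) (E 0) {\<zero>\<^bsub>E 0\<^esub>} \<subseteq> {\<zero>\<^bsub>sequence_module (E 0)\<^esub>}"
    by (auto simp: cocycles_def)
  then have "cocycles (Suc j) (E 0) {\<zero>\<^bsub>E 0\<^esub>} = coboundaries (Suc j) (E 0) {\<zero>\<^bsub>E 0\<^esub>}"
    using coboundaries_subset_cocycles[OF E_module z] SE.submoduleD(1)[OF submodule_coboundaries[OF E_module z]]
    by blast
  then show ?case
    using subquotient_refl[OF SE.module_axioms submodule_coboundaries[OF E_module z, of "Suc j"]]
    by (simp add: ext_in_def tors_boundaries_def)
next
  case (Suc i)
  have "ext_in (Suc (Suc j)) (E i) (tors_cocycles i)"
    by (rule ext_sequence.ext_in_middle[OF H_sequence]) (use Suc hyp in auto)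
  then show ?case
    using ext_sequence.dimension_shift[OF tors_sequence tors_acyclic tors_acyclic] by blast
qed

lemma ext_in_H_0:
  assumes hyp: "\<And>i j. i < s \<Longrightarrow> ext_in j (H i) (carrier (H i))" and ext: "ext_in s N (carrier N)"
  shows "ext_in 0 (H s) (carrier (H s))"
proof -
  interpret seq: ext_sequence R S I b D "E s" "H s" "tors_cocycles s" "proj s" "tors_boundaries s" "carrier (H s)"
    by (rule H_sequence)
  note Z = tors_cocycles_submodule[of s]
  \<comment> \<open>\<open>T\<close> is the kernel of the map from Hom(R/I, Z^s) to Ext^s(R/I, M).
    It lies in \<open>preboundaries\<close> because a map from R/I to \<open>E\<close> lands in the
    torsion part, so that its coboundary takes values in B^s.\<close>
  define T where "T = {z \<in> cocycles 0 (E s) (tors_cocycles s). z 0 \<in> ext_boundaries s}"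
  have bd: "ext_boundaries s \<subseteq> tors_boundaries s"
  proof (cases s)
    case (Suc k)
    then show ?thesis
      using image_mono[OF cring.annihilated_subset_torsion[OF cring ideal, of "E k"], of "d k"]
      by (simp add: ext_boundaries_def tors_boundaries_def tors_def)
  qed (simp add: ext_boundaries_def tors_boundaries_def)
  have bd0: "\<zero>\<^bsub>E s\<^esub> \<in> ext_boundaries s"
  proof (cases s)
    case (Suc k)
    have "d k \<zero>\<^bsub>E k\<^esub> = \<zero>\<^bsub>E (Suc k)\<^esub>"
      by (rule linear_on_zero[OF E_module E_module E_carrier d_linear])
    moreover have "\<zero>\<^bsub>E k\<^esub> \<in> annihilated (E k) I"
      by (rule module.submoduleD(1)[OF E_module submodule_annihilated[OF E_module I_carrier]])
    ultimately show ?thesis using Suc by (simp add: ext_boundaries_def) (metis imageI)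
  qed (simp add: ext_boundaries_def)
  have zc: "\<zero>\<^bsub>sequence_module (E s)\<^esub> \<in> cocycles 0 (E s) (tors_cocycles s)"
    by (rule module.submoduleD(1)[OF seq.seqE submodule_cocycles[OF E_module Z]])
  have kz: "submodule (ker_d s \<inter> annihilated (E s) I) R (E s)"
    by (rule module.submodule_criterion[OF E_module])
      (use module.submoduleD[OF E_module ker_d_submodule]
        module.submoduleD[OF E_module submodule_annihilated[OF E_module I_carrier]] in auto)
  have "subquotient_in R S (sequence_module (E s)) (cocycles 0 (E s) (tors_cocycles s)) T"
  proof (rule subquotient_embed[OF seq.seqE E_module submodule_cocycles[OF E_module Z] kz
        _ _ _ _ iffD2[OF ext_model_iff ext]])
    show "linear_relation R (sequence_module (E s)) (E s) (\<lambda>z x. z 0 = x)"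
      by (rule linear_relationI) auto
    show "\<exists>x\<in>ker_d s \<inter> annihilated (E s) I. z 0 = x" if "z \<in> cocycles 0 (E s) (tors_cocycles s)" for z
    proof -
      have "z 0 \<in> tors_cocycles s" "z 0 \<in> annihilated (E s) I"
        using that unfolding cocycles_0[OF E_module Z] by blast+
      then show ?thesis using tors_carrier[of s] by (auto simp: tors_cocycles_def ker_d_def)
    qed
  qed (use zc bd0 in \<open>auto simp: T_def\<close>)
  moreover have "T \<subseteq> seq.preboundaries 0"
  proof
    fix z assume "z \<in> T"
    then have z: "z \<in> cocycles 0 (E s) (tors_cocycles s)" "z 0 \<in> tors_boundaries s"
      using bd by (auto simp: T_def)
    have "(\<lambda>i. proj s (z i)) \<in> coboundaries 0 (H s) (carrier (H s))"
      using cocyclesD(1)[OF seq.image_cocycle[OF z(1)]] z(2) seq.K_eq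
      by (simp add: coboundaries_0[OF H_module module.carrier_is_submodule[OF H_module]])
    then show "z \<in> seq.preboundaries 0" using z(1) by (simp add: seq.preboundaries_def)
  qed
  moreover have "ext_in (Suc 0) (E s) (tors_boundaries s)"
    by (rule ext_in_tors_boundaries[OF hyp order_refl])
  ultimately show ?thesis by (intro seq.ext_in_quotient)
qed

end

theorem theoremA:
  fixes R :: "('r, 'k) ring_scheme" and \<aa> :: "'r set"
    and S :: "('r, 'u::infinite) module set" and M :: "('r, 'm) module" and s :: nat
  assumes "cring R" and "noetherian_ring R" and "ideal \<aa> R"
    and "serre_class R S"
    and "module R M"
    and "belongs_to R (Ext R s (cyclic_module R \<aa>) M) S"
    and "\<And>i j. i < s \<Longrightarrow> belongs_to R (Ext R j (cyclic_module R \<aa>) (local_cohomology R \<aa> i M)) S"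
  shows "belongs_to R (Hom R (cyclic_module R \<aa>) (local_cohomology R \<aa> s M)) S"
proof -
  have "noetherian_cring R" by (intro noetherian_cring.intro assms(1,2))
  then obtain b D where "free_resolution R \<aa> b D"
    using noetherian_cring.free_resolution_exists assms(3) by blast
  then interpret ext_setup R S \<aa> b D
    by (intro ext_setup.intro serre.intro ext_setup_axioms.intro assms(1-4))
  obtain E d where Ed: "chosen_resolution R M = (E, d)" by (cases "chosen_resolution R M")
  interpret ext_resolution R S \<aa> b D M E d
    by (intro ext_resolution.intro ext_setup_axioms ext_resolution_axioms.intro assms(5))
      (use chosen_resolution[OF assms(5)] Ed in simp)
  \<comment> \<open>An equality of records, not just an isomorphism: both sides are formed from the
    same chosen resolution of \<open>M\<close>.\<close>
  have H: "local_cohomology R \<aa> i M = H i" for i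
    unfolding local_cohomology_def right_derived_def Ed using torsion_cohomology[of i] by simp
  have "ext_in j (H i) (carrier (H i))" if "i < s" for i j
    using assms(7)[OF that, of j] Ext_iff[OF H_module] unfolding H by blast
  moreover have "ext_in s M (carrier M)" using assms(6) Ext_iff[OF assms(5)] by blast
  ultimately have "ext_in 0 (H s) (carrier (H s))" by (rule ext_in_H_0)
  then show ?thesis unfolding H using ext_in_0[OF H_module] by blast
qed

end
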